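(* Let $n\ge0$ be an integer such that $8n+5$ is square-free. Then $$8\,C_4(n)=\overline{p}_e(8n+5)-\overline{p}_o(8n+5)=M2_e(8n+5)-M2_o(8n+5).$$
   Context: $C_4(n)$ denotes the number of partitions of $n$ which are $4$-cores, i.e. partitions none of whose hook lengths is divisible by $4$. An overpartition of $n$ is a partition of $n$ in which the first occurrence of each number may be overlined. The rank of an overpartition is its largest part minus its number of parts. For an overpartition $\lambda$, let $\ell(\lambda)$ be its largest part (size), $n(\lambda)$ its number of parts, $\lambda_o$ the subpartition consisting of the odd non-overlined parts of $\lambda$, and $\chi(\lambda)=1$ if the largest part of $\lambda$ is odd and non-overlined, $\chi(\lambda)=0$ otherwise; here, if the largest part occurs several times, it counts as overlined when its first occurrence is overlined. The $M2$-rank of $\lambda$ is $$\lceil \ell(\lambda)/2\rceil - n(\lambda) + n(\lambda_o) - \chi(\lambda).$$ $\overline{p}_e(n)$, $\overline{p}_o(n)$, $M2_e(n)$, $M2_o(n)$ denote the number of overpartitions of $n$ with even rank, odd rank, even $M2$-rank, odd $M2$-rank, respectively. *)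

theory Defs
  imports Complex_Main "HOL-Computational_Algebra.Squarefree"
begin

definition is_partition :: "nat list \<Rightarrow> nat \<Rightarrow> bool" where
  "is_partition xs n \<longleftrightarrow> sorted_wrt (\<ge>) xs \<and> 0 \<notin> set xs \<and> sum_list xs = n"

(* Arm + leg + 1 for the cell in row i and column j of the Young diagram;
   rows and columns are numbered from 0, so the cells are those with
   i < length xs and j < xs ! i. *)
definition hook_length :: "nat list \<Rightarrow> nat \<Rightarrow> nat \<Rightarrow> nat" where
  "hook_length xs i j = (xs ! i - Suc j) + card {k. i < k \<and> k < length xs \<and> j < xs ! k} + 1"

definition is_core :: "nat \<Rightarrow> nat list \<Rightarrow> bool" where
  "is_core t xs \<longleftrightarrow> (\<forall>i < length xs. \<forall>j < xs ! i. \<not> t dvd hook_length xs i j)"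

definition C4 :: "nat \<Rightarrow> nat" where
  "C4 n = card {xs. is_partition xs n \<and> is_core 4 xs}"

(* An overpartition is the list of its parts in weakly decreasing order, each with a
   flag saying whether it is overlined; only a first occurrence may carry the flag. *)
definition is_overpartition :: "(nat \<times> bool) list \<Rightarrow> nat \<Rightarrow> bool" where
  "is_overpartition ps n \<longleftrightarrow>
     is_partition (map fst ps) n \<and>
     (\<forall>i < length ps. snd (ps ! i) \<longrightarrow> fst (ps ! i) \<notin> set (map fst (take i ps)))"

(* The empty overpartition is given largest part 0. *)
definition largest_part :: "(nat \<times> bool) list \<Rightarrow> nat" where
  "largest_part ps = (case ps of [] \<Rightarrow> 0 | p # _ \<Rightarrow> fst p)"

definition num_parts :: "(nat \<times> bool) list \<Rightarrow> nat" where
  "num_parts ps = length ps"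

definition odd_nonoverlined :: "(nat \<times> bool) list \<Rightarrow> (nat \<times> bool) list" where
  "odd_nonoverlined ps = filter (\<lambda>p. odd (fst p) \<and> \<not> snd p) ps"

(* The head of the list is the first occurrence of the largest part, so its flag
   decides whether the largest part counts as overlined. *)
definition chi :: "(nat \<times> bool) list \<Rightarrow> nat" where
  "chi ps = (case ps of [] \<Rightarrow> 0 | p # _ \<Rightarrow> if odd (fst p) \<and> \<not> snd p then 1 else 0)"

definition overpartition_rank :: "(nat \<times> bool) list \<Rightarrow> int" where
  "overpartition_rank ps = int (largest_part ps) - int (num_parts ps)"

definition M2_rank :: "(nat \<times> bool) list \<Rightarrow> int" where
  "M2_rank ps =
     \<lceil>real (largest_part ps) / 2\<rceil> - int (num_parts ps)
       + int (num_parts (odd_nonoverlined ps)) - int (chi ps)"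

definition p_even :: "nat \<Rightarrow> nat" where
  "p_even n = card {ps. is_overpartition ps n \<and> even (overpartition_rank ps)}"

definition p_odd :: "nat \<Rightarrow> nat" where
  "p_odd n = card {ps. is_overpartition ps n \<and> odd (overpartition_rank ps)}"

definition M2_even :: "nat \<Rightarrow> nat" where
  "M2_even n = card {ps. is_overpartition ps n \<and> even (M2_rank ps)}"

definition M2_odd :: "nat \<Rightarrow> nat" where
  "M2_odd n = card {ps. is_overpartition ps n \<and> odd (M2_rank ps)}"

end

theory Submission
  imports Defs "HOL-Analysis.Infinite_Sum" "HOL-Analysis.Uniform_Limit"
begin

text \<open>Let \<open>\<theta> = \<Sum>(-1)\<^sup>n q\<^bsup>n\<^sup>2\<^esup>\<close>, and let \<open>f\<close>, \<open>g\<close> be the generating functions of (even minus odd) for the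
  rank and the \<open>M2\<close>-rank. Each of \<open>\<theta>\<close>, \<open>\<theta>\<^sup>4\<close>, \<open>f\<close>, \<open>g\<close> and the Lambert series for \<open>\<theta> f\<close>,
  \<open>\<theta> g\<close> is a value of a series in \<open>s\<close> with a functional equation relating \<open>s\<close> and \<open>p s\<close>, where \<open>p = q\<close> or
  \<open>p = q\<^sup>2\<close>; uniqueness of the solutions yields the product formulas (\<open>V = U\<^sup>2\<close> and \<open>L = U \<Psi>\<close> below).

  Let \<open>X\<^sub>\<nu>\<^sub>\<epsilon>\<close> be the generating function, up to divisor sums, of \<open>\<nu>\<^bsup>x+y\<^esup> \<epsilon>\<^sup>z\<close> over positive triples with
  \<open>xy + yz + zx = n\<close>. The addition theorem of the hyperbolic cotangent turns \<open>\<theta> X\<^sub>\<nu>\<^sub>\<epsilon>\<close> into a Lambert series,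
  and comparison gives \<open>X = \<theta>\<^sup>3, f, g\<close> for \<open>(\<nu>, \<epsilon>) = (-1, -1), (-1, 1), (1, -1)\<close>. If \<open>n \<equiv> 1\<close> modulo 4, exactly one
  of \<open>x, y, z\<close> is even, so the coefficients depend on the signs only through the factor \<open>1 + 2 \<nu> \<epsilon>\<close>: those of
  \<open>f\<close> and \<open>g\<close> agree, and those of \<open>\<theta>\<^sup>3\<close> are \<open>-3\<close> times as large. Finally beta sets identify the 4-cores of
  \<open>n\<close> with one in 24 of the representations of \<open>8n + 5\<close> as a sum of three squares.\<close>

section \<open>Series solving functional equations\<close>

text \<open>The parameter \<open>s\<close> supplies what the values needed in the end do not: a
  starting point. At \<open>s = -p\<close> all the series in \<open>s\<close> equal 1, and a
  functional equation carries an agreement there along \<open>-p, -p^2, ...\<close> to the limit 0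
  and from 0 to every \<open>s \<ge> 0\<close>. This needs a continuous variable, so the generating
  functions are taken as convergent series at real \<open>0 < p \<le> 1/4\<close>; an interval of
  values of \<open>p\<close> suffices to compare coefficients.

  Triples enter through \<open>xy + yz + zx = xy + (x + y) z\<close>. For fixed
  \<open>s = x + y\<close> the sum over \<open>z\<close> is geometric and gives a hyperbolic tangent
  or cotangent in \<open>s\<close>, while the sum over \<open>x\<close> is a finite sum
  \<open>S s\<close>. Multiplication by theta turns \<open>S s\<close> into a series over
  \<open>M\<close> of tangents at \<open>2 * M - s\<close>, and an addition theorem then separates
  \<open>s\<close> from \<open>M\<close>, after which the sums over \<open>s\<close> telescope.
  Neither \<open>1\<close> nor \<open>kap e s * t (2 * M - s)\<close> can be summed over
  \<open>s\<close> alone, so the two have to stay together until the order of summation has been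
  exchanged.\<close>

lemma continuous_on_suminf_geometric:
  fixes f :: "nat \<Rightarrow> real \<Rightarrow> real"
  assumes "\<And>r. continuous_on S (f r)" "\<And>r s. s \<in> S \<Longrightarrow> \<bar>f r s\<bar> \<le> C * c ^ r" "0 \<le> c" "c < 1"
  shows "continuous_on S (\<lambda>s. \<Sum>r. f r s)"
proof -
  have "summable (\<lambda>r. C * c ^ r)" using assms(3,4) by (intro summable_mult summable_geometric) simp
  then have "uniform_limit S (\<lambda>n s. \<Sum>r<n. f r s) (\<lambda>s. suminf (\<lambda>r. f r s)) sequentially"
    using assms(2) by (intro Weierstrass_m_test[where M = "\<lambda>r. C * c ^ r"]) simp_all
  then show ?thesis
    by (rule uniform_limit_theorem[rotated])
      (auto intro!: always_eventually continuous_on_sum assms(1))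
qed

lemma summable_geometric_bound:
  fixes f :: "nat \<Rightarrow> real"
  assumes "\<And>r. \<bar>f r\<bar> \<le> C * c ^ r" "0 \<le> c" "c < 1"
  shows "summable f"
  by (rule summable_comparison_test'[of "\<lambda>r. C * c ^ r" 0])
    (use assms in \<open>auto intro!: summable_mult summable_geometric\<close>)

text \<open>The bound \<open>1/4\<close> serves two estimates: for
  \<open>\<bar>s\<bar> \<le> 1/4\<close> each factor of \<open>w\<close> is at most
  \<open>(1/2) / (3/4) = 2/3\<close>, and there are at most \<open>3 ^ m\<close> overpartitions of
  \<open>m\<close>, so their weights are dominated by \<open>(3/4) ^ m\<close>.\<close>

locale base =
  fixes p :: real
  assumes p_pos: "0 < p" and p_le: "p \<le> 1/4"
begin

lemma p_power_le [simp]: "p ^ n \<le> 1" "p ^ Suc n \<le> 1/4" "0 < p ^ n" "0 \<le> p ^ n"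
proof -
  show "p ^ n \<le> 1" using p_pos p_le by (intro power_le_one) auto
  then show "p ^ Suc n \<le> 1/4" using p_pos p_le mult_mono[of p "1/4" "p ^ n" 1] by simp
  show "0 < p ^ n" "0 \<le> p ^ n" using p_pos by auto
qed

lemma abs_p [simp]: "\<bar>p\<bar> = p"
  using p_pos by simp

lemma one_plus_nz [simp]: "1 + p ^ n \<noteq> 0"
  using p_power_le(3)[of n] by linarith

abbreviation (input) dom :: "real set" where "dom \<equiv> {-1/4..1/4}"

text \<open>In \<open>q\<close>-notation with base \<open>p\<close> this is
  \<open>s^r (-p/s)_r / (-s)_r\<close>, written so that \<open>s = 0\<close> is allowed.\<close>

definition w :: "nat \<Rightarrow> real \<Rightarrow> real" where
  "w r s = (\<Prod>i<r. (s + p ^ Suc i) / (1 + s * p ^ i))"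

definition v :: "nat \<Rightarrow> real \<Rightarrow> real" where
  "v r s = w r s / ((1 + s * p ^ r) * (1 + s * p ^ Suc r))"

lemma dom_mult_p: "s \<in> dom \<Longrightarrow> s * p ^ n \<in> dom"
proof -
  assume "s \<in> dom"
  then have "\<bar>s\<bar> * p ^ n \<le> (1/4) * 1" by (intro mult_mono) auto
  then have "\<bar>s * p ^ n\<bar> \<le> 1/4" by (simp add: abs_mult)
  then show ?thesis by (auto simp: abs_le_iff)
qed

lemma den_ge: "s \<in> dom \<Longrightarrow> 3/4 \<le> 1 + s * p ^ n"
  using dom_mult_p[of s n] by auto

lemma den_nz: "s \<in> dom \<Longrightarrow> 1 + s * p ^ n \<noteq> 0"
  using den_ge[of s n] by auto

lemma w_bound: "s \<in> dom \<Longrightarrow> \<bar>w r s\<bar> \<le> (2/3) ^ r"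
proof (induction r)
  case 0 then show ?case by (simp add: w_def)
next
  case (Suc r)
  have "0 < p ^ Suc r" "p ^ Suc r \<le> 1/4" by (rule p_power_le)+
  then have "\<bar>s + p ^ Suc r\<bar> \<le> 1/2" using Suc.prems
    unfolding abs_le_iff atLeastAtMost_iff by linarith
  then have "\<bar>(s + p ^ Suc r) / (1 + s * p ^ r)\<bar> \<le> (1/2) / (3/4)"
    unfolding abs_divide using den_ge[OF Suc.prems, of r] by (intro frac_le) auto
  then have "\<bar>w r s\<bar> * \<bar>(s + p ^ Suc r) / (1 + s * p ^ r)\<bar> \<le> (2/3) ^ r * (2/3)"
    using Suc by (intro mult_mono) auto
  then show ?case by (simp add: w_def abs_mult ac_simps)
qed

lemma w_Suc: "s \<in> dom \<Longrightarrow> w (Suc r) s = v r s * ((s + p ^ Suc r) * (1 + s * p ^ Suc r))"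
proof -
  assume "s \<in> dom"
  then have "1 + s * p ^ r \<noteq> 0" "1 + s * p ^ Suc r \<noteq> 0" using den_ge[of s r] den_ge[of s "Suc r"] by auto
  then show ?thesis unfolding v_def w_def by (simp del: power_Suc)
qed

lemma w_div: "s \<in> dom \<Longrightarrow> w r s / (1 + s * p ^ r) = v r s * (1 + s * p ^ Suc r)"
  using den_ge[of s r] den_ge[of s "Suc r"] by (simp add: v_def)

text \<open>Passing from \<open>s\<close> to \<open>s * p\<close> shifts both products by one index.
  Together with \<open>w_Suc\<close> this makes the terms at \<open>s\<close> and at
  \<open>s * p\<close> polynomial multiples of the same \<open>v r s\<close>, so functional
  equations can be checked term by term.\<close>

lemma w_scale: "s \<in> dom \<Longrightarrow> w (Suc r) (s * p) = p ^ Suc r * (1 + s)\<^sup>2 * v r s"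
proof (induction r)
  case 0
  then have "1 + s \<noteq> 0" "1 + s * p \<noteq> 0" using den_ge[of s 0] den_ge[of s 1] by auto
  then show ?case by (simp add: w_def v_def power2_eq_square divide_simps) (simp add: algebra_simps)
next
  case (Suc r)
  have n: "1 + s * p ^ Suc r \<noteq> 0" "1 + s * p ^ Suc (Suc r) \<noteq> 0" "1 + s * p ^ r \<noteq> 0"
    using den_ge[of s "Suc r"] den_ge[of s "Suc (Suc r)"] den_ge[of s r] Suc.prems by auto
  have "w (Suc (Suc r)) (s * p) = w (Suc r) (s * p) * ((s * p + p ^ Suc (Suc r)) / (1 + s * p * p ^ Suc r))"
    by (simp add: w_def)
  also have "(s * p + p ^ Suc (Suc r)) / (1 + s * p * p ^ Suc r) = p * (s + p ^ Suc r) / (1 + s * p ^ Suc (Suc r))"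
    by (simp add: algebra_simps)
  also have "w (Suc r) (s * p) * \<dots> = p ^ Suc (Suc r) * (1 + s)\<^sup>2 * (v r s * ((s + p ^ Suc r) / (1 + s * p ^ Suc (Suc r))))"
    using Suc by simp
  also have "v r s * ((s + p ^ Suc r) / (1 + s * p ^ Suc (Suc r))) = v (Suc r) s"
    using w_Suc[OF Suc.prems, of r] n by (simp add: v_def[of "Suc r"])
  finally show ?case .
qed

lemma continuous_on_w: "continuous_on dom (w r)"
  unfolding w_def
proof (intro continuous_intros ballI)
  fix i s assume "s \<in> dom"
  then show "1 + s * p ^ i \<noteq> 0" using den_ge[of s i] by linarith
qed

text \<open>The factor with \<open>i = 0\<close> vanishes; this is why \<open>-p\<close> is the
  point where the series are known, and why the domain includes negative \<open>s\<close>.\<close>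

lemma w_minus_p: "w (Suc r) (- p) = 0"
  unfolding w_def by (rule prod_zero) (auto intro!: bexI[of _ 0])

text \<open>By \<open>U_feq\<close> and continuity, \<open>U s\<close> is \<open>U 0\<close> times
  the infinite product of \<open>(1 - s p^k) / (1 + s p^k)\<close>. At \<open>s = p\<close> the
  series \<open>V\<close> is Jacobi's Lambert series for the fourth power of theta.\<close>

definition U :: "real \<Rightarrow> real" where
  "U s = 1 + 2 * (\<Sum>r. (-1) ^ Suc r * p ^ (Suc r choose 2) * w (Suc r) s)"

definition V :: "real \<Rightarrow> real" where
  "V s = 1 + 4 * (\<Sum>r. (-1) ^ Suc r * w (Suc r) s / (1 + p ^ Suc r))"

definition L :: "real \<Rightarrow> real" where
  "L s = 1 + 8 * (\<Sum>r. (-1) ^ Suc r * p ^ (Suc (Suc r) choose 2) * w (Suc r) s / (1 + p ^ Suc r)\<^sup>2)"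

section \<open>Convergence, continuity and functional equations of the three series\<close>

lemma choose2_Suc: "Suc n choose 2 = (n choose 2) + n"
  by (simp add: numeral_2_eq_2)

lemma choose2_1: "Suc 0 choose 2 = 0"
  by (simp add: binomial_eq_0)

lemma coeff_bound:
  assumes "s \<in> dom" "\<bar>a\<bar> \<le> 1"
  shows "\<bar>a * w r s\<bar> \<le> 1 * (2/3) ^ r"
  using mult_mono[OF assms(2) w_bound[OF assms(1), of r]] by (simp add: abs_mult)

lemma coeff_w_Suc_bound:
  assumes "s \<in> dom" "\<bar>a\<bar> \<le> 1"
  shows "\<bar>a * w (Suc r) s\<bar> \<le> 1 * (2/3) ^ r"
proof -
  have "\<bar>a * w (Suc r) s\<bar> \<le> 1 * (2/3) ^ Suc r" by (rule coeff_bound[OF assms])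
  also have "\<dots> \<le> 1 * (2/3) ^ r" by simp
  finally show ?thesis .
qed

lemma inv_le: "\<bar>1 / (1 + p ^ n)\<bar> \<le> 1" "\<bar>1 / (1 + p ^ n)\<^sup>2\<bar> \<le> 1"
proof -
  have "1 \<le> 1 + p ^ n" by simp
  moreover from this have "1 \<le> (1 + p ^ n)\<^sup>2" by (intro one_le_power)
  ultimately show "\<bar>1 / (1 + p ^ n)\<bar> \<le> 1" "\<bar>1 / (1 + p ^ n)\<^sup>2\<bar> \<le> 1"
    by (simp_all add: divide_le_eq_1 add_pos_pos)
qed

lemma U_coeff: "\<bar>(-1) ^ Suc r * p ^ m\<bar> \<le> 1"
  by (simp add: abs_mult power_abs)

lemma V_coeff: "\<bar>(-1) ^ Suc r * (1 / (1 + p ^ n))\<bar> \<le> 1"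
  using inv_le(1)[of n] by (simp add: abs_mult power_abs)

lemma L_coeff: "\<bar>(-1) ^ Suc r * p ^ m * (1 / (1 + p ^ n)\<^sup>2)\<bar> \<le> 1"
  using mult_mono[OF U_coeff[of r m] inv_le(2)[of n]] by (simp add: abs_mult)

lemma V_alt: "V s = 1 + 4 * (\<Sum>r. ((-1) ^ Suc r * (1 / (1 + p ^ Suc r))) * w (Suc r) s)"
  unfolding V_def by simp

lemma L_alt: "L s = 1 + 8 * (\<Sum>r. ((-1) ^ Suc r * p ^ (Suc (Suc r) choose 2) * (1 / (1 + p ^ Suc r)\<^sup>2)) * w (Suc r) s)"
  unfolding L_def by (simp add: mult_ac)

lemma continuous_on_w_series:
  assumes "\<And>r. \<bar>a r\<bar> \<le> 1"
  shows "continuous_on dom (\<lambda>s. \<Sum>r. a r * w (Suc r) s)"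
  by (rule continuous_on_suminf_geometric[where C = 1 and c = "2/3"])
    (auto intro!: continuous_intros continuous_on_w[simplified] coeff_w_Suc_bound[simplified] assms simp del: power_Suc)

lemma summable_w_series:
  assumes "s \<in> dom" "\<And>r. \<bar>a r\<bar> \<le> 1"
  shows "summable (\<lambda>r. a r * w (Suc r) s)"
  by (rule summable_geometric_bound[where C = 1 and c = "2/3"])
    (use assms in \<open>auto intro!: coeff_w_Suc_bound[simplified] simp del: power_Suc\<close>)

lemma continuous_on_U: "continuous_on dom U"
  unfolding U_def[abs_def]
  by (intro continuous_intros continuous_on_w_series U_coeff)

lemma continuous_on_V: "continuous_on dom V"
  unfolding V_alt[abs_def]
  by (intro continuous_intros continuous_on_w_series V_coeff)

lemma continuous_on_L: "continuous_on dom L"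
  unfolding L_alt[abs_def]
  by (intro continuous_intros continuous_on_w_series L_coeff)

lemma UVL_minus_p: "U (- p) = 1" "V (- p) = 1" "L (- p) = 1"
  by (simp_all add: U_def V_def L_def w_minus_p)

text \<open>These are the differences of \<open>a r * w r s / (1 + s * p ^ r)\<close> expressed
  through \<open>v\<close>. That sequence tends to 0 because \<open>a\<close> is bounded and
  \<open>w\<close> decays geometrically.\<close>

lemma telescope_w:
  assumes s: "s \<in> dom" and a: "\<And>r. \<bar>a r\<bar> \<le> 1"
  shows "(\<lambda>r. a (Suc r) * (v r s * (s + p ^ Suc r)) - a r * (v r s * (1 + s * p ^ Suc r))) sums - (a 0 / (1 + s))"
proof -
  define W where "W r = a r * (w r s / (1 + s * p ^ r))" for r
  have "\<bar>W r\<bar> \<le> (4/3) * (2/3) ^ r" for r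
  proof -
    have "\<bar>a r * w r s\<bar> \<le> (2/3) ^ r" using coeff_bound[OF s a] by simp
    then have "\<bar>a r * w r s\<bar> / \<bar>1 + s * p ^ r\<bar> \<le> (2/3) ^ r / (3/4)"
      using den_ge[OF s, of r] by (intro frac_le) auto
    then show ?thesis unfolding W_def by (simp add: abs_mult)
  qed
  then have "summable W" by (rule summable_geometric_bound) auto
  then have "W \<longlonglongrightarrow> 0" by (rule summable_LIMSEQ_zero)
  from telescope_sums[OF this]
  have "(\<lambda>r. W (Suc r) - W r) sums (0 - W 0)" .
  moreover have "\<And>r. W (Suc r) = a (Suc r) * (v r s * (s + p ^ Suc r))"
    unfolding W_def w_Suc[OF s] using den_nz[OF s] by (simp del: power_Suc)
  moreover have "\<And>r. W r = a r * (v r s * (1 + s * p ^ Suc r))"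
    unfolding W_def using w_div[OF s] by simp
  moreover have "W 0 = a 0 / (1 + s)" by (simp add: W_def w_def)
  ultimately show ?thesis by (simp only: diff_0)
qed

lemma U_feq:
  assumes s: "s \<in> dom"
  shows "(1 + s) * U s = (1 - s) * U (s * p)"
proof -
  let ?a = "\<lambda>r. (-1) ^ Suc r * p ^ (Suc r choose 2)"
  let ?X = "\<lambda>r. p ^ Suc r"
  have sp: "s * p \<in> dom" using dom_mult_p[OF s, of 1] by simp
  have "(\<lambda>r. (1 + s) * (?a r * w (Suc r) s) - (1 - s) * (?a r * w (Suc r) (s * p))) sums
      ((1 + s) * (\<Sum>r. ?a r * w (Suc r) s) - (1 - s) * (\<Sum>r. ?a r * w (Suc r) (s * p)))"
    by (intro sums_diff sums_mult summable_sums summable_w_series s sp U_coeff)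
  \<comment> \<open>The boundary term at \<open>r = 0\<close> contributes \<open>-s\<close> in
    total, exactly what the constant terms 1 of \<open>U s\<close> and \<open>U (s * p)\<close>
    compensate.\<close>
  moreover have "(\<lambda>r. s * (1 + s) * ((-1) ^ Suc r * p ^ (Suc (Suc r) choose 2) * (v r s * (s + ?X r)) -
       (-1) ^ r * p ^ (Suc r choose 2) * (v r s * (1 + s * ?X r)))) sums (s * (1 + s) * - (1 / (1 + s)))"
    using telescope_w[OF s, of "\<lambda>r. (-1) ^ r * p ^ (Suc r choose 2)"]
    by (intro sums_mult) (simp add: abs_mult power_abs choose2_1 del: power_Suc binomial_Suc_Suc)
  moreover have "(1 + s) * (?a r * w (Suc r) s) - (1 - s) * (?a r * w (Suc r) (s * p)) =
     s * (1 + s) * ((-1) ^ Suc r * p ^ (Suc (Suc r) choose 2) * (v r s * (s + ?X r)) -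
       (-1) ^ r * p ^ (Suc r choose 2) * (v r s * (1 + s * ?X r)))" for r
    unfolding w_Suc[OF s] w_scale[OF s] choose2_Suc[of "Suc r"] power_add
    by (simp only: power_Suc[of "-1"]) algebra
  ultimately have "(1 + s) * (\<Sum>r. ?a r * w (Suc r) s) - (1 - s) * (\<Sum>r. ?a r * w (Suc r) (s * p)) = s * (1 + s) * - (1 / (1 + s))"
    by (simp only: sums_unique2)
  also have "\<dots> = - s" using den_ge[OF s, of 0] by simp
  finally show ?thesis unfolding U_def by (simp add: algebra_simps)
qed

lemma V_feq:
  assumes s: "s \<in> dom"
  shows "(1 + s)\<^sup>2 * V s = (1 - s)\<^sup>2 * V (s * p)"
proof -
  let ?a = "\<lambda>r. (-1) ^ Suc r * (1 / (1 + p ^ Suc r))"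
  let ?X = "\<lambda>r. p ^ Suc r"
  have sp: "s * p \<in> dom" using dom_mult_p[OF s, of 1] by simp
  have "(\<lambda>r. (1 + s)\<^sup>2 * (?a r * w (Suc r) s) - (1 - s)\<^sup>2 * (?a r * w (Suc r) (s * p))) sums
      ((1 + s)\<^sup>2 * (\<Sum>r. ?a r * w (Suc r) s) - (1 - s)\<^sup>2 * (\<Sum>r. ?a r * w (Suc r) (s * p)))"
    by (intro sums_diff sums_mult summable_sums summable_w_series s sp V_coeff)
  moreover have "(\<lambda>r. s * (1 + s) * ((-1) ^ Suc r * (v r s * (s + ?X r)) -
       (-1) ^ r * (v r s * (1 + s * ?X r)))) sums (s * (1 + s) * - (1 / (1 + s)))"
    using telescope_w[OF s, of "\<lambda>r. (-1) ^ r"] by (intro sums_mult) (simp add: power_abs)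
  moreover have "(1 + s)\<^sup>2 * (?a r * w (Suc r) s) - (1 - s)\<^sup>2 * (?a r * w (Suc r) (s * p)) =
     s * (1 + s) * ((-1) ^ Suc r * (v r s * (s + ?X r)) -
       (-1) ^ r * (v r s * (1 + s * ?X r)))" for r
  proof -
    have "(1 / (1 + ?X r)) * (1 + ?X r) = 1" by (simp del: power_Suc)
    moreover have "(1 + s)\<^sup>2 * (e * i * (K * ((s + x) * (1 + s * x)))) - (1 - s)\<^sup>2 * (e * i * (x * (1 + s)\<^sup>2 * K)) =
        s * (1 + s) * (e * (K * (s + x)) - - e * (K * (1 + s * x)))" if "i * (1 + x) = 1" for e i K x
      using that by algebra
    moreover have "(-1 :: real) ^ r = - ((-1) ^ Suc r)" by simp
    ultimately show ?thesis unfolding w_Suc[OF s] w_scale[OF s] by presburger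
  qed
  ultimately have "(1 + s)\<^sup>2 * (\<Sum>r. ?a r * w (Suc r) s) - (1 - s)\<^sup>2 * (\<Sum>r. ?a r * w (Suc r) (s * p)) = s * (1 + s) * - (1 / (1 + s))"
    by (simp only: sums_unique2)
  also have "\<dots> = - s" using den_ge[OF s, of 0] by simp
  finally show ?thesis unfolding V_alt by (simp add: algebra_simps power2_eq_square)
qed

text \<open>With \<open>x = p ^ Suc r\<close> one has
  \<open>(s + x) (1 + s x) - (1 - s)^2 x = s (1 + x)^2\<close>, which cancels the squared
  denominator. What remains is termwise the series of \<open>U (s * p)\<close>, without any
  telescoping.\<close>

lemma L_feq:
  assumes s: "s \<in> dom"
  shows "(1 + s)\<^sup>2 * L s - (1 - s)\<^sup>2 * L (s * p) = 4 * s * U (s * p)"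
proof -
  let ?a = "\<lambda>r. (-1) ^ Suc r * p ^ (Suc (Suc r) choose 2) * (1 / (1 + p ^ Suc r)\<^sup>2)"
  let ?b = "\<lambda>r. (-1) ^ Suc r * p ^ (Suc r choose 2)"
  let ?X = "\<lambda>r. p ^ Suc r"
  have sp: "s * p \<in> dom" using dom_mult_p[OF s, of 1] by simp
  have "(\<lambda>r. (1 + s)\<^sup>2 * (?a r * w (Suc r) s) - (1 - s)\<^sup>2 * (?a r * w (Suc r) (s * p))) sums
      ((1 + s)\<^sup>2 * (\<Sum>r. ?a r * w (Suc r) s) - (1 - s)\<^sup>2 * (\<Sum>r. ?a r * w (Suc r) (s * p)))"
    by (intro sums_diff sums_mult summable_sums summable_w_series s sp L_coeff)
  moreover have "(\<lambda>r. s * (?b r * w (Suc r) (s * p))) sums (s * (\<Sum>r. ?b r * w (Suc r) (s * p)))"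
    by (intro sums_mult summable_sums summable_w_series sp U_coeff)
  moreover have "(1 + s)\<^sup>2 * (?a r * w (Suc r) s) - (1 - s)\<^sup>2 * (?a r * w (Suc r) (s * p)) =
     s * (?b r * w (Suc r) (s * p))" for r
  proof -
    have "(1 / (1 + ?X r)\<^sup>2) * (1 + ?X r)\<^sup>2 = 1" by (simp del: power_Suc)
    moreover have "(1 + s)\<^sup>2 * (e * (b * x) * i * (K * ((s + x) * (1 + s * x)))) - (1 - s)\<^sup>2 * (e * (b * x) * i * (x * (1 + s)\<^sup>2 * K)) =
        s * (e * b * (x * (1 + s)\<^sup>2 * K))" if "i * (1 + x)\<^sup>2 = 1" for e b i K x
      using that by algebra
    ultimately show ?thesis unfolding w_Suc[OF s] w_scale[OF s] choose2_Suc[of "Suc r"] power_add by presburger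
  qed
  ultimately have "(1 + s)\<^sup>2 * (\<Sum>r. ?a r * w (Suc r) s) - (1 - s)\<^sup>2 * (\<Sum>r. ?a r * w (Suc r) (s * p)) = s * (\<Sum>r. ?b r * w (Suc r) (s * p))"
    by (simp only: sums_unique2)
  then show ?thesis unfolding L_alt U_def by (simp add: algebra_simps power2_eq_square)
qed

text \<open>The equation moves the zero at \<open>-p\<close> to all \<open>-p ^ Suc k\<close>, hence
  \<open>D 0 = 0\<close> by continuity. For \<open>s \<ge> 0\<close> the inequality
  \<open>(1 - s)^2 \<le> (1 + s)^2\<close> gives
  \<open>\<bar>D s\<bar> \<le> \<bar>D (s * p)\<bar>\<close>; iteration bounds
  \<open>\<bar>D s\<bar>\<close> by the limit \<open>\<bar>D 0\<bar>\<close>.\<close>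

lemma unique_solution:
  assumes cont: "continuous_on dom D" and D_p: "D (- p) = 0"
    and feq: "\<And>s. s \<in> dom \<Longrightarrow> (1 + s)\<^sup>2 * D s = (1 - s)\<^sup>2 * D (s * p)"
    and s: "0 \<le> s" "s \<le> 1/4"
  shows "D s = 0"
proof -
  have p_lim: "(\<lambda>k. c * p ^ k) \<longlonglongrightarrow> 0" for c
    using tendsto_mult_right_zero[OF LIMSEQ_power_zero[of p]] p_pos p_le by simp
  have lim: "(\<lambda>k. D (c * p ^ k)) \<longlonglongrightarrow> D 0" if "c \<in> dom" for c
    by (rule continuous_on_tendsto_compose[OF cont p_lim]) (use dom_mult_p[OF that] in auto)
  have mp: "- p \<in> dom" using p_pos p_le by auto
  have "D (- p * p ^ k) = 0" for k
  proof (induction k)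
    case (Suc k)
    have d: "- p * p ^ k \<in> dom" using dom_mult_p[OF mp] .
    have "(1 - - p * p ^ k)\<^sup>2 * D (- p * p ^ k * p) = 0" using feq[OF d] Suc by simp
    moreover have "1 - - p * p ^ k \<noteq> 0" using d by auto
    ultimately show ?case by (simp add: ac_simps)
  qed (use D_p in simp)
  then have D0: "D 0 = 0" using lim[OF mp] by (simp add: LIMSEQ_const_iff)
  have sd: "s \<in> dom" using s by auto
  have "\<bar>D s\<bar> \<le> \<bar>D (s * p ^ k)\<bar>" for k
  proof (induction k)
    case (Suc k)
    define x where "x = s * p ^ k"
    have x: "x \<in> dom" "0 \<le> x" using dom_mult_p[OF sd] s by (auto simp: x_def)
    have "(1 + x)\<^sup>2 * \<bar>D x\<bar> = (1 - x)\<^sup>2 * \<bar>D (x * p)\<bar>"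
      using arg_cong[OF feq[OF x(1)], of abs] by (simp add: abs_mult)
    also have "\<dots> \<le> (1 + x)\<^sup>2 * \<bar>D (x * p)\<bar>"
      using x by (intro mult_right_mono power_mono) auto
    finally have "\<bar>D x\<bar> \<le> \<bar>D (x * p)\<bar>" using x by (simp add: mult_le_cancel_left)
    with Suc show ?case by (simp add: x_def ac_simps)
  qed simp
  moreover have "(\<lambda>k. \<bar>D (s * p ^ k)\<bar>) \<longlonglongrightarrow> 0" using tendsto_rabs[OF lim[OF sd]] D0 by simp
  ultimately have "\<bar>D s\<bar> \<le> 0" by (rule_tac LIMSEQ_le_const) auto
  then show ?thesis by simp
qed

lemma V_eq: "0 \<le> s \<Longrightarrow> s \<le> 1/4 \<Longrightarrow> V s = (U s)\<^sup>2"
proof -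
  assume s: "0 \<le> s" "s \<le> 1/4"
  have "V s - (U s)\<^sup>2 = 0"
  proof (rule unique_solution[where D = "\<lambda>s. V s - (U s)\<^sup>2", OF _ _ _ s])
    show "continuous_on dom (\<lambda>s. V s - (U s)\<^sup>2)"
      by (intro continuous_intros continuous_on_U continuous_on_V)
    show "V (- p) - (U (- p))\<^sup>2 = 0" by (simp add: UVL_minus_p)
    fix s assume s: "s \<in> dom"
    show "(1 + s)\<^sup>2 * (V s - (U s)\<^sup>2) = (1 - s)\<^sup>2 * (V (s * p) - (U (s * p))\<^sup>2)"
      using U_feq[OF s] V_feq[OF s] by algebra
  qed
  then show ?thesis by simp
qed

text \<open>In \<open>U s * U (- s)\<close> the factors \<open>1 + s\<close> and
  \<open>1 - s\<close> of the functional equation change places, so the product is invariant under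
  \<open>s \<mapsto> s * p\<close>. Compare its value at \<open>p\<close>, where
  \<open>U (- p) = 1\<close>, with its limit at 0.\<close>

lemma U_p: "U p = (U 0)\<^sup>2"
proof -
  define D where "D s = U s * U (- s)" for s
  have cont: "continuous_on dom D" unfolding D_def
    by (intro continuous_intros continuous_on_U continuous_on_compose2[OF continuous_on_U]) auto
  have pd: "p \<in> dom" using p_pos p_le by auto
  have "D (p * p ^ k) = D p" for k
  proof (induction k)
    case (Suc k)
    define x where "x = p * p ^ k"
    have x: "x \<in> dom" "- x \<in> dom" using dom_mult_p[OF pd, of k] by (auto simp: x_def)
    have "(1 + x) * (1 - x) * D x = (1 + x) * (1 - x) * D (x * p)"
      unfolding D_def using U_feq[OF x(1)] U_feq[OF x(2)] by simp algebra
    moreover have "(1 + x) * (1 - x) \<noteq> 0" using x by auto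
    ultimately have "D x = D (x * p)" by simp
    with Suc show ?case by (simp add: x_def ac_simps)
  qed simp
  moreover have "(\<lambda>k. p * p ^ k) \<longlonglongrightarrow> 0"
    using tendsto_mult_right_zero[OF LIMSEQ_power_zero[of p]] p_pos p_le by simp
  then have "(\<lambda>k. D (p * p ^ k)) \<longlonglongrightarrow> D 0"
    by (rule continuous_on_tendsto_compose[OF cont]) (use dom_mult_p[OF pd] in auto)
  ultimately have "D 0 = D p" by (simp add: LIMSEQ_const_iff)
  then show ?thesis by (simp add: D_def UVL_minus_p power2_eq_square)
qed

text \<open>The generating function of overpartitions with all parts at most \<open>n\<close>, where
  every part carries the sign \<open>-1\<close>.\<close>

definition P :: "nat \<Rightarrow> real" where
  "P n = (\<Prod>i<n. (1 - p ^ Suc i) / (1 + p ^ Suc i))"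

definition Psi0 :: real where
  "Psi0 = 1 + 2 * (\<Sum>n. (-1) ^ n * P n * (p ^ Suc n / (1 + p ^ Suc n)))"

text \<open>\<open>Psi0\<close> is the rank series sorted by the largest part \<open>n + 1\<close>,
  with 2 for the choice of overlining it. For base \<open>p^2\<close> and \<open>s = p\<close> the
  additional sum will account for odd largest parts and \<open>Psi0\<close> for even ones, as the
  \<open>M2\<close>-rank requires.\<close>

definition Psi :: "real \<Rightarrow> real" where
  "Psi s = Psi0 + 2 * (\<Sum>n. (-1) ^ n * P n * (s * p ^ n / (1 - s * p ^ n)))"

lemma P_bound: "\<bar>P n\<bar> \<le> 1"
proof -
  have "\<bar>(1 - p ^ Suc i) / (1 + p ^ Suc i)\<bar> \<le> 1" for i
  proof -
    have "0 < p ^ Suc i" "p ^ Suc i \<le> 1/4" by (rule p_power_le)+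
    then show ?thesis unfolding abs_divide by (intro divide_le_eq_1_pos[THEN iffD2]) linarith+
  qed
  then show ?thesis unfolding P_def abs_prod by (intro prod_le_1) auto
qed

lemma P_Suc: "P (Suc n) * (1 + p ^ Suc n) = P n * (1 - p ^ Suc n)"
  unfolding P_def by (simp del: power_Suc)

lemma Psi0_term_bound: "\<bar>(-1) ^ n * P n * (p ^ Suc n / (1 + p ^ Suc n))\<bar> \<le> 1 * p ^ n"
proof -
  have "\<bar>P n\<bar> * \<bar>p ^ Suc n / (1 + p ^ Suc n)\<bar> \<le> 1 * p ^ Suc n"
  proof (intro mult_mono P_bound)
    show "\<bar>p ^ Suc n / (1 + p ^ Suc n)\<bar> \<le> p ^ Suc n"
      using p_power_le(3)[of "Suc n"] by (simp add: divide_le_eq add_pos_pos ring_distribs del: power_Suc)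
  qed auto
  also have "\<dots> \<le> 1 * p ^ n" using p_le p_pos by (simp add: mult_le_cancel_right1)
  finally show ?thesis by (simp add: abs_mult power_abs)
qed

lemma Psi_term_bound:
  assumes "s \<in> dom"
  shows "\<bar>(-1) ^ n * P n * (s * p ^ n / (1 - s * p ^ n))\<bar> \<le> 1 * p ^ n"
proof -
  have "- s \<in> dom" using assms by auto
  then have d: "3/4 \<le> 1 - s * p ^ n" using den_ge[of "- s" n] by simp
  have "\<bar>P n\<bar> * \<bar>s * p ^ n / (1 - s * p ^ n)\<bar> \<le> 1 * (((1/4) * p ^ n) / (3/4))"
  proof (intro mult_mono P_bound)
    show "\<bar>s * p ^ n / (1 - s * p ^ n)\<bar> \<le> ((1/4) * p ^ n) / (3/4)"
      unfolding abs_divide using d assms by (intro frac_le) (auto simp: abs_mult intro!: mult_right_mono)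
  qed auto
  also have "\<dots> \<le> 1 * p ^ n" by simp
  finally show ?thesis by (simp add: abs_mult power_abs)
qed

lemma continuous_on_Psi: "continuous_on dom Psi"
proof -
  have n: "1 - s * p ^ n \<noteq> 0" if "s \<in> dom" for s n
    using den_ge[of "- s" n] that by auto
  show ?thesis unfolding Psi_def[abs_def]
    by (intro continuous_intros continuous_on_suminf_geometric[where C = 1 and c = p])
      (use Psi_term_bound n p_pos p_le in auto)
qed

lemma summable_Psi: "s \<in> dom \<Longrightarrow> summable (\<lambda>n. (-1) ^ n * P n * (s * p ^ n / (1 - s * p ^ n)))"
  by (rule summable_geometric_bound[where C = 1 and c = p])
    (use Psi_term_bound p_pos p_le in auto)

lemma summable_Psi0: "summable (\<lambda>n. (-1) ^ n * P n * (p ^ Suc n / (1 + p ^ Suc n)))"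
  by (rule summable_geometric_bound[where C = 1 and c = p])
    (use Psi0_term_bound p_pos p_le in auto)

lemma Psi_minus_p: "Psi (- p) = 1"
proof -
  have "(\<Sum>n. (-1) ^ n * P n * (- p * p ^ n / (1 - - p * p ^ n))) =
      (\<Sum>n. - ((-1) ^ n * P n * (p ^ Suc n / (1 + p ^ Suc n))))" by simp
  also have "\<dots> = - (\<Sum>n. (-1) ^ n * P n * (p ^ Suc n / (1 + p ^ Suc n)))"
    by (rule suminf_minus[OF summable_Psi0])
  finally show ?thesis unfolding Psi_def Psi0_def by linarith
qed

text \<open>The term of index \<open>n + 1\<close> at \<open>s\<close> and the term of index
  \<open>n\<close> at \<open>s * p\<close> have the same denominator. By \<open>P_Suc\<close> their
  combination loses this denominator and becomes \<open>- 2 * s\<close> times a term of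
  \<open>Psi0\<close>; only the first term at \<open>s\<close> is left over.\<close>

lemma Psi_feq:
  assumes s: "s \<in> dom"
  shows "(1 + s) * Psi s - (1 - s) * Psi (s * p) = 4 * s / (1 - s)"
proof -
  define x where "x n = s * p ^ n / (1 - s * p ^ n)" for n
  define a where "a n = (-1) ^ n * P n" for n
  define u where "u n = p ^ Suc n / (1 + p ^ Suc n)" for n
  have sp: "s * p \<in> dom" using dom_mult_p[OF s, of 1] by simp
  have n: "1 - s * p ^ n \<noteq> 0" for n using den_ge[of "- s" n] s by auto
  have s1: "summable (\<lambda>n. a n * x n)" using summable_Psi[OF s] by (simp add: a_def x_def)
  have s1': "summable (\<lambda>n. a (Suc n) * x (Suc n))" using s1 by (subst summable_Suc_iff)
  have s2: "summable (\<lambda>n. a n * x (Suc n))" using summable_Psi[OF sp] by (simp add: a_def x_def ac_simps)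
  have s3: "summable (\<lambda>n. a n * u n)" using summable_Psi0 by (simp add: a_def u_def)
  have "(\<Sum>n. a n * x n) = a 0 * x 0 + (\<Sum>n. a (Suc n) * x (Suc n))"
    using suminf_split_head[OF s1] by simp
  then have "(1 + s) * (\<Sum>n. a n * x n) - (1 - s) * (\<Sum>n. a n * x (Suc n)) =
      (1 + s) * (a 0 * x 0) + ((1 + s) * (\<Sum>n. a (Suc n) * x (Suc n)) - (1 - s) * (\<Sum>n. a n * x (Suc n)))"
    by (simp add: algebra_simps)
  also have "(1 + s) * (\<Sum>n. a (Suc n) * x (Suc n)) - (1 - s) * (\<Sum>n. a n * x (Suc n)) =
      (\<Sum>n. (1 + s) * (a (Suc n) * x (Suc n)) - (1 - s) * (a n * x (Suc n)))"
    using s1' s2 by (simp only: suminf_mult[symmetric] suminf_diff summable_mult)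
  also have "(\<lambda>n. (1 + s) * (a (Suc n) * x (Suc n)) - (1 - s) * (a n * x (Suc n))) =
      (\<lambda>n. (- 2 * s) * (a n * u n))"
  proof
    fix n
    define X where "X = p ^ Suc n"
    have X: "1 + X \<noteq> 0" using p_power_le(3)[of "Suc n"] unfolding X_def by linarith
    have sX: "1 - s * X \<noteq> 0" using n[of "Suc n"] by (simp only: X_def not_False_eq_True)
    have "a (Suc n) * (1 + X) = - a n * (1 - X)" using P_Suc[of n] unfolding a_def X_def by simp
    then have aS: "a (Suc n) = - a n * (1 - X) / (1 + X)" using X by (simp add: field_simps)
    have e: "x (Suc n) = s * X / (1 - s * X)" "u n = X / (1 + X)" by (simp_all only: x_def u_def X_def)
    show "(1 + s) * (a (Suc n) * x (Suc n)) - (1 - s) * (a n * x (Suc n)) = (- 2 * s) * (a n * u n)"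
      unfolding aS e using X sX by (simp add: divide_simps) algebra
  qed
  also have "(\<Sum>n. (- 2 * s) * (a n * u n)) = (- 2 * s) * (\<Sum>n. a n * u n)"
    by (rule suminf_mult[OF s3])
  finally have main: "(1 + s) * (\<Sum>n. a n * x n) - (1 - s) * (\<Sum>n. a n * x (Suc n)) =
      (1 + s) * (a 0 * x 0) + (- 2 * s) * (\<Sum>n. a n * u n)" .
  have "Psi s = Psi0 + 2 * (\<Sum>n. a n * x n)" by (simp add: Psi_def a_def x_def)
  moreover have "Psi (s * p) = Psi0 + 2 * (\<Sum>n. a n * x (Suc n))" by (simp add: Psi_def a_def x_def ac_simps)
  moreover have "Psi0 = 1 + 2 * (\<Sum>n. a n * u n)" by (simp add: Psi0_def a_def u_def)
  moreover have "a 0 * x 0 = s / (1 - s)" by (simp add: a_def x_def P_def)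
  ultimately have "(1 + s) * Psi s - (1 - s) * Psi (s * p) = 2 * s + 2 * (1 + s) * (s / (1 - s))"
    using main by algebra
  also have "\<dots> = 4 * s / (1 - s)" using n[of 0] by (simp add: field_simps)
  finally show ?thesis .
qed

text \<open>The inhomogeneous part \<open>4 * s / (1 - s)\<close> of \<open>Psi_feq\<close>,
  multiplied by \<open>(1 - s) * U (s * p)\<close>, is the right-hand side of \<open>L_feq\<close>.
  Hence the difference solves the homogeneous equation.\<close>

lemma L_eq: "0 \<le> s \<Longrightarrow> s \<le> 1/4 \<Longrightarrow> L s = U s * Psi s"
proof -
  assume s: "0 \<le> s" "s \<le> 1/4"
  have "L s - U s * Psi s = 0"
  proof (rule unique_solution[where D = "\<lambda>s. L s - U s * Psi s", OF _ _ _ s])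
    show "continuous_on dom (\<lambda>s. L s - U s * Psi s)"
      by (intro continuous_intros continuous_on_U continuous_on_L continuous_on_Psi)
    show "L (- p) - U (- p) * Psi (- p) = 0" by (simp add: UVL_minus_p Psi_minus_p)
    fix s assume s: "s \<in> dom"
    have "(1 - s) * (4 * s / (1 - s)) = 4 * s" using s by auto
    then show "(1 + s)\<^sup>2 * (L s - U s * Psi s) = (1 - s)\<^sup>2 * (L (s * p) - U (s * p) * Psi (s * p))"
      using U_feq[OF s] L_feq[OF s] Psi_feq[OF s] by algebra
  qed
  then show ?thesis by simp
qed

section \<open>The special arguments 0, \<open>p\<close> and the square root of
  \<open>p\<close>\<close>

lemma w_0: "w r 0 = p ^ (Suc r choose 2)"
  by (induction r) (simp_all add: w_def choose2_Suc[of "Suc _"] power_add del: binomial_Suc_Suc add: choose2_1)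

lemma w_p: "w (Suc r) p = 2 * p ^ Suc r / (1 + p ^ Suc r)"
proof (induction r)
  case 0 show ?case by (simp add: w_def)
next
  case (Suc r)
  have "w (Suc (Suc r)) p = w (Suc r) p * ((p + p ^ Suc (Suc r)) / (1 + p * p ^ Suc r))"
    by (simp add: w_def)
  also have "\<dots> = 2 * p ^ Suc r / (1 + p ^ Suc r) * (p * (1 + p ^ Suc r) / (1 + p ^ Suc (Suc r)))"
    unfolding Suc by (simp add: algebra_simps)
  also have "\<dots> = 2 * p ^ Suc (Suc r) / (1 + p ^ Suc (Suc r))"
    using p_power_le(3)[of "Suc r"] by (simp add: add_pos_pos[THEN less_imp_neq, THEN not_sym])
  finally show ?case .
qed

text \<open>Each factor of the product equals \<open>s\<close>. This is applied to base
  \<open>p^2\<close> with \<open>s = p\<close>.\<close>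

lemma w_sqrt: "s\<^sup>2 = p \<Longrightarrow> 0 < s \<Longrightarrow> w r s = s ^ r"
proof (induction r)
  case (Suc r)
  have "s + p ^ Suc r = s * (1 + s * p ^ r)" using Suc.prems by (simp add: power2_eq_square algebra_simps)
  moreover have "0 < 1 + s * p ^ r" using Suc.prems by (simp add: add_pos_pos)
  ultimately have "(s + p ^ Suc r) / (1 + s * p ^ r) = s" by simp
  then show ?case using Suc by (simp add: w_def)
qed (simp add: w_def)

end

section \<open>Two-sided series and theta functions\<close>

lemma summable_on_int_geometric:
  fixes c :: real
  assumes "0 \<le> c" "c < 1"
  shows "(\<lambda>k::int. c ^ nat \<bar>k\<bar>) summable_on UNIV"
proof -
  have s: "(\<lambda>n. c ^ n) summable_on UNIV"
    using assms by (intro summable_nonneg_imp_summable_on summable_geometric) auto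
  have "(\<lambda>k::int. c ^ nat \<bar>k\<bar>) summable_on range int"
    using s by (subst summable_on_reindex) (auto simp: o_def)
  moreover have "(\<lambda>k::int. c ^ nat \<bar>k\<bar>) summable_on range (\<lambda>n. - int n)"
    using s by (subst summable_on_reindex) (auto simp: o_def inj_on_def)
  ultimately have "(\<lambda>k::int. c ^ nat \<bar>k\<bar>) summable_on (range int \<union> range (\<lambda>n. - int n))"
    by (rule summable_on_union)
  moreover have "range int \<union> range (\<lambda>n. - int n) = UNIV"
  proof (intro equalityI subsetI UNIV_I)
    fix k :: int
    show "k \<in> range int \<union> range (\<lambda>n. - int n)" by (cases k rule: int_cases2) auto
  qed
  ultimately show ?thesis by simp
qed

lemma summable_on_bound:
  fixes f g :: "'a \<Rightarrow> real"
  assumes "g summable_on A" "\<And>x. x \<in> A \<Longrightarrow> \<bar>f x\<bar> \<le> g x"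
  shows "f summable_on A"
proof -
  have "(\<lambda>x. norm (f x)) summable_on A"
    by (rule summable_on_comparison_test[OF assms(1)]) (use assms(2) in auto)
  then show ?thesis by (rule abs_summable_summable)
qed

lemma summable_on_abs: "f summable_on A \<Longrightarrow> (\<lambda>x. \<bar>f x :: real\<bar>) summable_on A"
  using summable_on_iff_abs_summable_on_real[of f A] unfolding real_norm_def by (rule iffD1)

lemma summable_on_mult_bounded:
  fixes f g :: "'a \<Rightarrow> real"
  assumes "f summable_on A" "\<And>x. x \<in> A \<Longrightarrow> \<bar>g x\<bar> \<le> C"
  shows "(\<lambda>x. g x * f x) summable_on A"
proof (rule summable_on_bound)
  show "(\<lambda>x. C * \<bar>f x\<bar>) summable_on A"
    using assms(1) by (intro summable_on_cmult_right summable_on_abs)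
qed (auto simp: abs_mult intro!: mult_right_mono assms(2))

lemma summable_on_Times:
  fixes f :: "'a \<Rightarrow> real" and g :: "'b \<Rightarrow> real"
  assumes "f summable_on A" "g summable_on B"
  shows "(\<lambda>(x, y). f x * g y) summable_on A \<times> B"
proof -
  have a: "(\<lambda>x. \<bar>f x\<bar>) summable_on A" and b: "(\<lambda>x. \<bar>g x\<bar>) summable_on B"
    using assms by (auto intro: summable_on_abs)
  have "norm (\<Sum>\<^sub>\<infinity>y\<in>B. norm (f x * g y)) = \<bar>f x\<bar> * (\<Sum>\<^sub>\<infinity>y\<in>B. \<bar>g y\<bar>)" for x
    by (simp add: abs_mult infsum_cmult_right' infsum_nonneg)
  then have "(\<lambda>x. \<Sum>\<^sub>\<infinity>y\<in>B. norm (f x * g y)) abs_summable_on A"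
    using summable_on_cmult_left[OF a] by simp
  moreover have "(\<lambda>y. f x * g y) abs_summable_on B" for x
    using summable_on_cmult_right[OF b] by (simp add: abs_mult)
  ultimately have "(\<lambda>(x, y). f x * g y) abs_summable_on A \<times> B"
    unfolding abs_summable_on_Sigma_iff by simp
  then show ?thesis by (rule abs_summable_summable)
qed

lemma abs_minus_one_powi [simp]: "\<bar>(-1 :: real) powi k\<bar> = 1"
  by (subst power_int_abs) simp

lemma summable_on_diff_real:
  fixes f g :: "'a \<Rightarrow> real"
  assumes "f summable_on A" "g summable_on A"
  shows "(\<lambda>x. f x - g x) summable_on A"
  using summable_on_add[OF assms(1) summable_on_uminus[THEN iffD2, OF assms(2)]] by simp

lemma infsum_diff_real:
  fixes f g :: "'a \<Rightarrow> real"
  assumes "f summable_on A" "g summable_on A"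
  shows "(\<Sum>\<^sub>\<infinity>x\<in>A. f x - g x) = infsum f A - infsum g A"
  using infsum_add[OF assms(1) summable_on_uminus[THEN iffD2, OF assms(2)]] by (simp add: infsum_uminus)

context base
begin

lemma p_nz [simp]: "p \<noteq> 0" using p_pos by simp

lemma p_lt_1 [simp]: "p < 1" using p_le by simp

lemma powi_pos [simp]: "0 < p powi k" using p_pos by simp

definition th :: "int \<Rightarrow> real" where "th M = (-1) powi M * p powi (M * M)"

definition theta :: real where "theta = (\<Sum>\<^sub>\<infinity>M. th M)"

text \<open>With \<open>c = - ln p / 2\<close>, \<open>kap 1 u\<close> is \<open>coth (c u)\<close>
  and \<open>kap (-1) u\<close> is \<open>tanh (c u)\<close>. The quotient \<open>kap 1 0\<close>
  has denominator 0 and takes the value 0, which keeps oddness true at \<open>u = 0\<close>.\<close>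

definition kap :: "real \<Rightarrow> int \<Rightarrow> real" where "kap e u = (1 + e * p powi u) / (1 - e * p powi u)"
abbreviation t :: "int \<Rightarrow> real" where "t \<equiv> kap (-1)"

lemma powi_sq_le: "p powi (M * M) \<le> p ^ nat \<bar>M\<bar>"
proof -
  have "\<bar>M\<bar> * 1 \<le> \<bar>M\<bar> * \<bar>M\<bar>" by (cases "M = 0") (simp, intro mult_left_mono, auto)
  then have "\<bar>M\<bar> \<le> M * M" by simp
  then have "p powi (M * M) \<le> p powi \<bar>M\<bar>" using p_pos p_le by (intro power_int_decreasing) auto
  then show ?thesis by (simp add: power_int_nonneg_exp)
qed

lemma summable_p_int: "(\<lambda>k::int. p ^ nat \<bar>k\<bar>) summable_on A"
  by (rule summable_on_subset_banach[OF summable_on_int_geometric]) (use p_pos in auto)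

lemma th_bound: "\<bar>th M\<bar> \<le> p ^ nat \<bar>M\<bar>"
  using powi_sq_le[of M] powi_pos[of "M * M"] by (simp only: th_def abs_mult abs_minus_one_powi abs_of_pos mult_1)

lemma th_summable: "th summable_on A"
  by (rule summable_on_bound[OF summable_p_int]) (rule th_bound)

lemma th_minus [simp]: "th (- M) = th M"
  by (simp add: th_def power_int_minus_one_minus)

lemma t_bound: "\<bar>t u\<bar> \<le> 1"
proof -
  have "\<bar>1 - p powi u\<bar> \<le> 1 + p powi u" using powi_pos[of u] by linarith
  then show ?thesis using powi_pos[of u] unfolding kap_def
    by (simp add: abs_divide divide_le_eq_1 add_pos_pos)
qed

lemma kap_minus: "e * e = 1 \<Longrightarrow> kap e (- u) = - kap e u"
proof -
  assume e: "e * e = 1"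
  define X where "X = p powi u"
  have "X \<noteq> 0" using powi_pos[of u] by (simp add: X_def)
  have "kap e (- u) = (1 + e * (1 / X)) / (1 - e * (1 / X))" by (simp add: kap_def X_def power_int_minus_divide)
  also have "\<dots> = ((X + e) / X) / ((X - e) / X)"
    using \<open>X \<noteq> 0\<close> by (simp add: add_divide_distrib diff_divide_distrib)
  also have "\<dots> = (X + e) / (X - e)" using \<open>X \<noteq> 0\<close> by simp
  also have "\<dots> = (e * (X + e)) / (e * (X - e))" using e by auto
  also have "\<dots> = (1 + e * X) / (- (1 - e * X))" using e by (simp add: algebra_simps)
  also have "\<dots> = - kap e u" by (simp only: kap_def X_def divide_minus_right)
  finally show ?thesis .
qed

lemma t_minus [simp]: "t (- u) = - t u" by (simp add: kap_minus)

lemma t_0 [simp]: "t 0 = 0" by (simp add: kap_def)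

lemma kap_den: "e = 1 \<or> e = -1 \<Longrightarrow> u \<noteq> 0 \<or> e = -1 \<Longrightarrow> 1 - e * p powi u \<noteq> 0"
proof -
  assume "e = 1 \<or> e = -1" "u \<noteq> 0 \<or> e = -1"
  moreover have "p powi u \<noteq> 1" if "u \<noteq> 0"
    using power_int_strict_decreasing[of u 0 p] power_int_strict_decreasing[of 0 u p] that p_pos
    by (cases u "0::int" rule: linorder_cases) auto
  moreover have "1 + p powi u \<noteq> 0" using powi_pos[of u] by linarith
  ultimately show ?thesis by auto
qed

text \<open>After rescaling the arguments, both sides are
  \<open>sinh (x + y) / (sinh x cosh y)\<close> for \<open>e = 1\<close> and
  \<open>cosh (x + y) / (cosh x cosh y)\<close> for \<open>e = -1\<close>. On the right the
  dependence on \<open>x\<close> and on \<open>y\<close> is additive apart from a factor in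
  \<open>x + y\<close>.\<close>

lemma kap_add:
  assumes "e = 1 \<or> e = -1" "x \<noteq> 0 \<or> e = -1" "x + y \<noteq> 0 \<or> e = 1"
  shows "1 + kap e x * t y = kap (- e) (x + y) * (kap e x + t y)"
proof -
  define X Y where "X = p powi x" and "Y = p powi y"
  have XY: "p powi (x + y) = X * Y" by (simp add: X_def Y_def power_int_add)
  have n: "1 - e * X \<noteq> 0" "1 + Y \<noteq> 0" "1 + e * (X * Y) \<noteq> 0"
    using kap_den[of e x] kap_den[of "-1" y] kap_den[of "- e" "x + y"] assms
    unfolding XY by (auto simp: X_def Y_def)
  have "1 + (1 + e * X) / (1 - e * X) * ((1 - Y) / (1 + Y)) =
      ((1 - e * X) * (1 + Y) + (1 + e * X) * (1 - Y)) / ((1 - e * X) * (1 + Y))"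
  proof -
    have "1 + a / b * (c / d) = (b * d + a * c) / (b * d)" if "b \<noteq> 0" "d \<noteq> 0" for a b c d :: real
      using that by (simp add: field_simps)
    then show ?thesis using n by blast
  qed
  also have "(1 - e * X) * (1 + Y) + (1 + e * X) * (1 - Y) = 2 * (1 - e * (X * Y))"
    by (simp add: algebra_simps)
  also have "\<dots> = (1 - e * (X * Y)) / (1 + e * (X * Y)) * ((1 + e * X) * (1 + Y) + (1 - Y) * (1 - e * X))"
  proof -
    have *: "(1 + e * X) * (1 + Y) + (1 - Y) * (1 - e * X) = 2 * (1 + e * (X * Y))" by (simp add: algebra_simps)
    have "2 * a = a / b * (2 * b)" if "b \<noteq> 0" for a b :: real using that by simp
    then show ?thesis unfolding * using n(3) by blast
  qed
  also have "\<dots> / ((1 - e * X) * (1 + Y)) =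
      (1 - e * (X * Y)) / (1 + e * (X * Y)) * ((1 + e * X) / (1 - e * X) + (1 - Y) / (1 + Y))"
    using n by (simp add: add_frac_eq)
  finally have "1 + (1 + e * X) / (1 - e * X) * ((1 - Y) / (1 + Y)) =
      (1 - e * (X * Y)) / (1 + e * (X * Y)) * ((1 + e * X) / (1 - e * X) + (1 - Y) / (1 + Y))" .
  then show ?thesis unfolding kap_def XY by (simp add: X_def Y_def)
qed

text \<open>Multiplying a geometric progression by theta and summing gives an Appell-Lerch series; since
  shifting \<^term>\<open>M\<close> by one turns \<open>A s\<close> into \<open>A (s + 2)\<close>, this is proved by recursion in \<open>s\<close>.\<close>

definition A :: "int \<Rightarrow> real" where "A s = (\<Sum>\<^sub>\<infinity>M. th M * t (2 * M - s))"

lemma th_t_summable: "(\<lambda>M. th M * t (2 * M - s)) summable_on B"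
  using summable_on_mult_bounded[OF th_summable, of B "\<lambda>M. t (2 * M - s)" 1] t_bound
  by (simp add: mult.commute)

lemma th_Suc: "th (M + 1) = - (p powi (2 * M + 1) * th M)"
proof -
  have "(M + 1) * (M + 1) = (2 * M + 1) + M * M" by (simp add: algebra_simps)
  then have "p powi ((M + 1) * (M + 1)) = p powi (2 * M + 1) * p powi (M * M)"
    by (simp only: power_int_add p_nz not_False_eq_True simp_thms)
  moreover have "(-1 :: real) powi (M + 1) = - ((-1) powi M)" by (simp add: power_int_add)
  ultimately show ?thesis unfolding th_def by simp
qed

lemma infsum_int_shift: "(\<Sum>\<^sub>\<infinity>M::int. f (M + c)) = (\<Sum>\<^sub>\<infinity>M. f M)"
  by (rule infsum_reindex_bij_witness[of _ "\<lambda>M. M - c" "\<lambda>M. M + c"]) auto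

lemma infsum_int_reflect: "(\<Sum>\<^sub>\<infinity>M::int. f (- M)) = (\<Sum>\<^sub>\<infinity>M. f M)"
  by (rule infsum_reindex_bij_witness[of _ uminus uminus]) auto

lemma A_minus: "A (- s) = - A s"
proof -
  have "A (- s) = (\<Sum>\<^sub>\<infinity>M. th (- M) * t (2 * (- M) - (- s)))"
    unfolding A_def by (rule infsum_int_reflect[symmetric])
  also have "\<dots> = (\<Sum>\<^sub>\<infinity>M. - (th M * t (2 * M - s)))"
    using t_minus[of "2 * _ - s"] by (intro infsum_cong) (simp del: t_minus)
  finally show ?thesis by (simp add: A_def infsum_uminus)
qed

lemma A_rec: "A (s + 2) = p powi (s + 1) * (A s - theta) - theta"
proof -
  have term_eq: "th (M + 1) * t (2 * (M + 1) - (s + 2)) =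
      p powi (s + 1) * (th M * t (2 * M - s) - th M) - th (M + 1)" for M
  proof -
    define u where "u = 2 * M - s"
    have "p powi (2 * M + 1) = p powi ((s + 1) + u)"
      by (rule arg_cong[where f = "power_int p"]) (simp add: u_def)
    also have "\<dots> = p powi (s + 1) * p powi u" by (simp only: power_int_add p_nz not_False_eq_True simp_thms)
    finally have e: "th (M + 1) = - (p powi (s + 1) * p powi u * th M)" unfolding th_Suc by simp
    \<comment> \<open>The shift of \<open>M\<close> produces a factor \<open>p powi u\<close>, and
      clearing the denominator of \<open>t u\<close> absorbs it; so only \<open>A s\<close> and
      theta remain.\<close>
    have "t u * (1 + p powi u) = 1 - p powi u" using kap_den[of "-1" u] by (simp add: kap_def)
    moreover have "2 * (M + 1) - (s + 2) = u" by (simp add: u_def)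
    moreover have "- (a * b * c) * T = a * (c * T - c) - - (a * b * c)" if "T * (1 + b) = 1 - b" for a b c T :: real
      using that by algebra
    ultimately show ?thesis unfolding e u_def[symmetric] by metis
  qed
  have "A (s + 2) = (\<Sum>\<^sub>\<infinity>M. th (M + 1) * t (2 * (M + 1) - (s + 2)))"
    unfolding A_def by (rule infsum_int_shift[symmetric])
  also have "\<dots> = (\<Sum>\<^sub>\<infinity>M. p powi (s + 1) * (th M * t (2 * M - s) - th M) - th (M + 1))"
    unfolding term_eq ..
  also have "\<dots> = p powi (s + 1) * (A s - theta) - (\<Sum>\<^sub>\<infinity>M. th (M + 1))"
  proof -
    have s1: "(\<lambda>M. th (M + 1)) summable_on UNIV"
      by (rule summable_on_reindex_bij_witness[of UNIV "\<lambda>M. M - 1" "\<lambda>M. M + 1" UNIV th, THEN iffD2])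
        (auto intro: th_summable)
    have s2: "(\<lambda>M. th M * t (2 * M - s) - th M) summable_on UNIV"
      by (intro summable_on_diff_real th_t_summable th_summable)
    have "(\<Sum>\<^sub>\<infinity>M. p powi (s + 1) * (th M * t (2 * M - s) - th M) - th (M + 1)) =
        p powi (s + 1) * (\<Sum>\<^sub>\<infinity>M. th M * t (2 * M - s) - th M) - (\<Sum>\<^sub>\<infinity>M. th (M + 1))"
      by (subst infsum_diff_real) (auto intro!: summable_on_cmult_right s1 s2 simp: infsum_cmult_right')
    also have "(\<Sum>\<^sub>\<infinity>M. th M * t (2 * M - s) - th M) = A s - theta"
      unfolding A_def theta_def by (rule infsum_diff_real[OF th_t_summable th_summable])
    finally show ?thesis .
  qed
  also have "(\<Sum>\<^sub>\<infinity>M. th (M + 1)) = theta" unfolding theta_def by (rule infsum_int_shift)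
  finally show ?thesis .
qed

text \<open>The 1 stands for one of the two degenerate decompositions \<open>n = 0 + n\<close> and
  \<open>n = n + 0\<close>; equivalently, each of them counts one half.\<close>

definition S :: "nat \<Rightarrow> real" where "S n = 1 + (\<Sum>x = 1..<n. p ^ (x * (n - x)))"

lemma S_rec: "0 < n \<Longrightarrow> S (n + 2) = 1 + p ^ Suc n * (S n + 1)"
proof -
  assume n: "0 < n"
  have "(\<Sum>x = 1..<n + 2. p ^ (x * (n + 2 - x))) = (\<Sum>x = 0..<Suc n. p ^ (Suc x * (n + 2 - Suc x)))"
    using sum.shift_bounds_Suc_ivl[of "\<lambda>x. p ^ (x * (n + 2 - x))" 0 "Suc n"] by simp
  also have "\<dots> = (\<Sum>x = 0..<Suc n. p ^ Suc n * p ^ (x * (n - x)))"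
  proof (rule sum.cong[OF refl])
    fix x assume "x \<in> {0..<Suc n}"
    then obtain d where d: "n = x + d" using le_Suc_ex[of x n] by auto
    show "p ^ (Suc x * (n + 2 - Suc x)) = p ^ Suc n * p ^ (x * (n - x))"
      unfolding power_add[symmetric] d by (intro arg_cong[where f = "power p"]) simp
  qed
  also have "\<dots> = p ^ Suc n * (\<Sum>x = 0..<Suc n. p ^ (x * (n - x)))" by (rule sum_distrib_left[symmetric])
  also have "(\<Sum>x = 0..<Suc n. p ^ (x * (n - x))) = S n + 1"
    using n by (simp add: S_def sum.atLeast_Suc_lessThan)
  finally show ?thesis by (simp add: S_def)
qed

lemma theta_S: "0 < n \<Longrightarrow> theta * S n = - A (int n)"
proof (induction n rule: less_induct)
  case (less n)
  have A0: "A 0 = 0" using A_minus[of 0] by simp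
  \<comment> \<open>The recursion goes in steps of two, so two starting values are needed.
    \<open>S_rec\<close> cannot supply \<open>n = 2\<close>: for \<open>n = 0\<close> the end terms
    \<open>x = 0\<close> and \<open>x = n\<close> coincide.\<close>
  consider "n = 1" | "n = 2" | m where "n = m + 2" "0 < m"
  proof (cases "n \<le> 2")
    case True
    then show thesis using less.prems that(1,2) by linarith
  next
    case False
    then have "n = (n - 2) + 2" "0 < n - 2" by auto
    then show thesis by (rule that(3))
  qed
  then show ?case
  proof cases
    case 1
    \<comment> \<open>At \<open>s = -1\<close> the recursion relates \<open>A 1\<close> to
      \<open>A (-1) = - A 1\<close> and thereby determines it.\<close>
    have "A 1 = - A 1 - 2 * theta" using A_rec[of "-1"] A_minus[of 1] by simp
    with 1 show ?thesis by (simp add: S_def)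
  next
    case 2
    then show ?thesis using A_rec[of 0] A0 by (simp add: S_def algebra_simps numeral_2_eq_2)
  next
    case 3
    have "A (int n) = p powi (int m + 1) * (A (int m) - theta) - theta"
      using A_rec[of "int m"] 3(1) by (simp add: add.commute)
    also have "A (int m) = - (theta * S m)" using less.IH[of m] 3 by simp
    also have "p powi (int m + 1) = p ^ Suc m" using power_int_of_nat[of p "Suc m"] by (simp add: add.commute)
    finally show ?thesis using S_rec[OF 3(2)] 3(1) by (simp add: algebra_simps)
  qed
qed

text \<open>As \<open>s\<close> tends to either infinity, \<open>kap e s * t (2 * M - s)\<close>
  tends to \<open>-1\<close>. The summand 1 cancels this limit, which makes summation over
  \<open>s\<close> possible.\<close>

definition h :: "real \<Rightarrow> real \<Rightarrow> int \<times> int \<Rightarrow> real" where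
  "h e n = (\<lambda>(s, M). n powi s * (th M * (1 + kap e s * t (2 * M - s))))"

text \<open>With \<open>X = p powi s\<close> and \<open>Y = p powi (2 * M - s)\<close> the bracket
  is \<open>2 (1 - e X Y) / ((1 - e X) (1 + Y))\<close>. The product
  \<open>X Y = p powi (2 * M)\<close> does not involve \<open>s\<close>, and
  \<open>1 / Y = X * p powi (- 2 * M)\<close> supplies the decay in \<open>s\<close>; the loss
  \<open>p powi (- 2 * M)\<close> is made up for by \<open>th M\<close>.\<close>

lemma h_bound:
  assumes e: "e = 1 \<or> e = -1" and n: "n = 1 \<or> n = -1" and s: "1 \<le> s"
  shows "\<bar>h e n (s, M)\<bar> \<le> (8 / 3 * (p powi (-2) + 1)) * (p ^ nat \<bar>s\<bar> * p ^ nat \<bar>M\<bar>)"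
proof -
  define u where "u = 2 * M - s"
  define X where "X = p powi s"
  define Y where "Y = p powi u"
  have XY: "X * Y = p powi (2 * M)" by (simp add: X_def Y_def u_def power_int_add[symmetric])
  have X0: "0 < X" "0 < Y" by (simp_all add: X_def Y_def)
  have "X \<le> p powi 1" unfolding X_def using s p_pos p_le by (intro power_int_decreasing) auto
  then have X1: "X \<le> 1/4" using p_le by simp
  have d: "3/4 \<le> \<bar>1 - e * X\<bar>" using e X0 X1 by auto
  have n0: "1 - e * X \<noteq> 0" "1 + Y \<noteq> 0" using d X0 by auto
  have "1 + a / b * (c / d) = (b * d + a * c) / (b * d)" if "b \<noteq> 0" "d \<noteq> 0" for a b c d :: real
    using that by (simp add: field_simps)
  then have "1 + kap e s * t u = ((1 - e * X) * (1 + Y) + (1 + e * X) * (1 - Y)) / ((1 - e * X) * (1 + Y))"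
    unfolding kap_def X_def[symmetric] Y_def[symmetric] using n0 by simp
  also have "(1 - e * X) * (1 + Y) + (1 + e * X) * (1 - Y) = 2 * (1 - e * (X * Y))"
    by (simp add: algebra_simps)
  finally have k: "1 + kap e s * t u = 2 * (1 - e * (X * Y)) / ((1 - e * X) * (1 + Y))" .
  have "\<bar>1 + kap e s * t u\<bar> \<le> 2 * (1 + X * Y) / (3/4 * Y)"
    unfolding k abs_divide
  proof (rule frac_le)
    show "\<bar>2 * (1 - e * (X * Y))\<bar> \<le> 2 * (1 + X * Y)" using e X0 by (auto simp: abs_le_iff)
    show "3/4 * Y \<le> \<bar>(1 - e * X) * (1 + Y)\<bar>" unfolding abs_mult
      using d X0 by (intro mult_mono) auto
  qed (use X0 in auto)
  also have "\<dots> = 8/3 * (X * (p powi (- 2 * M) + 1))"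
  proof -
    have "X * (p powi (- 2 * M) * (X * Y) + X * Y) = X * (1 + X * Y)"
      unfolding XY by (simp add: power_int_minus distrib_left)
    then have "X * X * Y * (p powi (- 2 * M) + 1) = X * (1 + X * Y)" by (simp add: algebra_simps)
    then have "(1 + X * Y) = Y * (X * (p powi (- 2 * M) + 1))" using X0 by (simp add: algebra_simps)
    then show ?thesis using X0 by simp
  qed
  finally have "\<bar>1 + kap e s * t u\<bar> \<le> 8/3 * (X * (p powi (- 2 * M) + 1))" .
  then have "\<bar>h e n (s, M)\<bar> \<le> p powi (M * M) * (8/3 * (X * (p powi (- 2 * M) + 1)))"
    using n unfolding h_def th_def u_def
    by (auto simp: abs_mult abs_of_pos[OF powi_pos] simp del: abs_power_int_minus intro!: mult_left_mono)
  also have "\<dots> = 8/3 * (X * (p powi (M * M - 2 * M) + p powi (M * M)))"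
    by (simp add: power_int_diff power_int_minus divide_simps) (simp add: algebra_simps)
  also have "\<dots> \<le> 8/3 * (X * ((p powi (-2) + 1) * p ^ nat \<bar>M\<bar>))"
  proof -
    \<comment> \<open>Completing the square reduces this to
      \<open>\<bar>M - 1\<bar> \<le> (M - 1)^2\<close>; the shift by 2 is the source of
      \<open>p powi (-2)\<close> in the bound.\<close>
    have "\<bar>M\<bar> - 2 \<le> M * M - 2 * M"
    proof -
      have "\<bar>M - 1\<bar> * 1 \<le> \<bar>M - 1\<bar> * \<bar>M - 1\<bar>" by (cases "M = 1") (simp, intro mult_left_mono, auto)
      then have "\<bar>M - 1\<bar> \<le> (M - 1) * (M - 1)" by simp
      then show ?thesis by (simp add: algebra_simps)
    qed
    then have "p powi (M * M - 2 * M) \<le> p powi (\<bar>M\<bar> + (-2))"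
      using p_pos p_le by (intro power_int_decreasing) auto
    also have "\<dots> = p powi (-2) * p ^ nat \<bar>M\<bar>" 
      by (simp only: power_int_add p_nz not_False_eq_True simp_thms) (simp add: power_int_nonneg_exp)
    finally show ?thesis using powi_sq_le[of M] X0 by (simp add: distrib_right)
  qed
  also have "X = p ^ nat \<bar>s\<bar>" using s by (simp add: X_def power_int_nonneg_exp)
  finally show ?thesis by (simp only: ac_simps)
qed

lemma h_summable_pos:
  assumes "e = 1 \<or> e = -1" "n = 1 \<or> n = -1"
  shows "h e n summable_on {1..} \<times> UNIV"
proof (rule summable_on_bound)
  show "(\<lambda>x. (8 / 3 * (p powi (-2) + 1)) * (case x of (s, M) \<Rightarrow> p ^ nat \<bar>s\<bar> * p ^ nat \<bar>M\<bar>)) summable_on {1..} \<times> UNIV"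
    by (intro summable_on_cmult_right summable_on_Times summable_p_int)
qed (use h_bound[OF assms] in auto)

lemma h_uminus:
  assumes "e = 1 \<or> e = -1" "n = 1 \<or> n = -1"
  shows "h e n (- s, - M) = h e n (s, M)"
proof -
  have "kap e (- s) = - kap e s" using assms(1) by (intro kap_minus) auto
  moreover have "t (2 * (- M) - (- s)) = - t (2 * M - s)" using t_minus[of "2 * M - s"] by (simp del: t_minus)
  moreover have "n powi (- s) = n powi s" using assms(2) by (auto simp: power_int_minus_one_minus)
  ultimately show ?thesis by (simp add: h_def)
qed

text \<open>The reflection \<open>(s, M) \<mapsto> (- s, - M)\<close> fixes \<open>h\<close>, so the
  sum over \<open>s \<ge> 1\<close> is half of the sum over \<open>s \<noteq> 0\<close>. The
  two-sided inner sum is the one that can be evaluated in closed form.\<close>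

lemma h_sum_symmetric:
  assumes e: "e = 1 \<or> e = -1" and n: "n = 1 \<or> n = -1"
  shows "2 * infsum (h e n) ({1..} \<times> UNIV) = (\<Sum>\<^sub>\<infinity>M. \<Sum>\<^sub>\<infinity>s\<in>-{0}. h e n (s, M))"
    and "(\<lambda>M. \<Sum>\<^sub>\<infinity>s\<in>-{0}. h e n (s, M)) summable_on UNIV"
proof -
  have refl: "infsum (h e n) ({1..} \<times> UNIV) = infsum (h e n) ({..-1} \<times> UNIV)"
    by (rule infsum_reindex_bij_witness[of _ "\<lambda>(s, M). (- s, - M)" "\<lambda>(s, M). (- s, - M)"])
      (auto simp: h_uminus[OF e n])
  have sneg: "h e n summable_on {..-1} \<times> UNIV"
    by (rule summable_on_reindex_bij_witness[of _ "\<lambda>(s, M). (- s, - M)" "\<lambda>(s, M). (- s, - M)" "{1..} \<times> UNIV" "h e n", THEN iffD2])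
      (auto simp: h_uminus[OF e n] intro: h_summable_pos[OF e n])
  have un: "({1..} \<times> UNIV) \<union> ({..-1} \<times> UNIV) = (- {0::int}) \<times> (UNIV :: int set)" by auto
  have all: "h e n summable_on (- {0}) \<times> UNIV"
    using summable_on_union[OF h_summable_pos[OF e n] sneg] unfolding un .
  have swapped: "(\<lambda>(M, s). h e n (s, M)) summable_on UNIV \<times> (- {0})"
    by (rule summable_on_reindex_bij_witness[of _ prod.swap prod.swap "(- {0}) \<times> UNIV" "h e n", THEN iffD2])
      (auto intro: all)
  have "2 * infsum (h e n) ({1..} \<times> UNIV) = infsum (h e n) ((- {0}) \<times> UNIV)"
    using infsum_Un_disjoint[OF h_summable_pos[OF e n] sneg] refl unfolding un by force
  also have "\<dots> = (\<Sum>\<^sub>\<infinity>(M, s)\<in>UNIV \<times> (- {0}). h e n (s, M))"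
    by (rule infsum_reindex_bij_witness[of _ prod.swap prod.swap]) auto
  also have "\<dots> = (\<Sum>\<^sub>\<infinity>M. \<Sum>\<^sub>\<infinity>s\<in>-{0}. h e n (s, M))"
    by (rule infsum_Sigma'_banach[symmetric, OF swapped])
  finally show "2 * infsum (h e n) ({1..} \<times> UNIV) = (\<Sum>\<^sub>\<infinity>M. \<Sum>\<^sub>\<infinity>s\<in>-{0}. h e n (s, M))" .
  show "(\<lambda>M. \<Sum>\<^sub>\<infinity>s\<in>-{0}. h e n (s, M)) summable_on UNIV"
    by (rule summable_on_Sigma_banach[OF swapped])
qed

text \<open>Expanding \<open>kap e s = 1 + 2 * (\<Sum>z. e^z p^(s z))\<close> over
  \<open>z \<ge> 1\<close> and \<open>S\<close> over \<open>s = x + y\<close> gives the exponents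
  \<open>xy + yz + zx\<close>. The first argument \<open>e\<close> is the sign attached to
  \<open>z\<close>, the second, \<open>n\<close>, the one attached to \<open>x + y\<close>.\<close>

definition X :: "real \<Rightarrow> real \<Rightarrow> real" where
  "X e n = 1 - 2 * (\<Sum>\<^sub>\<infinity>s\<in>{1..}. n powi s * (kap e s * S (nat s) - 1))"

definition Z :: "real \<Rightarrow> real \<Rightarrow> int \<Rightarrow> real" where
  "Z e n M = (\<Sum>\<^sub>\<infinity>s\<in>-{0}. n powi s * (1 + kap e s * t (2 * M - s)))"

text \<open>\<open>theta_S\<close> replaces \<open>theta * S\<close> by \<open>- A\<close>, and
  theta times the \<open>- 1\<close> in \<open>X\<close> supplies the summand 1 of \<open>h\<close>.
  After the exchange of sums, \<open>th M\<close> factors out of the sum over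
  \<open>s\<close>.\<close>

lemma theta_X:
  assumes e: "e = 1 \<or> e = -1" and n: "n = 1 \<or> n = -1"
  shows "theta * X e n = (\<Sum>\<^sub>\<infinity>M. th M * (1 + Z e n M))"
proof -
  have "(\<Sum>\<^sub>\<infinity>M. h e n (s, M)) = - (theta * (n powi s * (kap e s * S (nat s) - 1)))" if s: "1 \<le> s" for s
  proof -
    have "(\<Sum>\<^sub>\<infinity>M. h e n (s, M)) = (\<Sum>\<^sub>\<infinity>M. n powi s * (th M + kap e s * (th M * t (2 * M - s))))"
      by (intro infsum_cong) (simp add: h_def algebra_simps)
    also have "\<dots> = n powi s * (\<Sum>\<^sub>\<infinity>M. th M + kap e s * (th M * t (2 * M - s)))"
      by (rule infsum_cmult_right')
    also have "(\<Sum>\<^sub>\<infinity>M. th M + kap e s * (th M * t (2 * M - s))) = theta + kap e s * A s"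
      unfolding theta_def A_def
      by (subst infsum_add) (auto intro!: th_summable summable_on_cmult_right th_t_summable simp: infsum_cmult_right')
    also have "A s = - (theta * S (nat s))" using theta_S[of "nat s"] s by simp
    finally show ?thesis by (simp add: algebra_simps)
  qed
  then have "(\<Sum>\<^sub>\<infinity>s\<in>{1..}. \<Sum>\<^sub>\<infinity>M. h e n (s, M)) = (\<Sum>\<^sub>\<infinity>s\<in>{1..}. (- theta) * (n powi s * (kap e s * S (nat s) - 1)))"
    by (intro infsum_cong) auto
  also have "\<dots> = (- theta) * (\<Sum>\<^sub>\<infinity>s\<in>{1..}. n powi s * (kap e s * S (nat s) - 1))"
    by (rule infsum_cmult_right')
  finally have "theta * X e n = theta + 2 * (\<Sum>\<^sub>\<infinity>s\<in>{1..}. \<Sum>\<^sub>\<infinity>M. h e n (s, M))"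
    by (simp add: X_def algebra_simps)
  also have "(\<Sum>\<^sub>\<infinity>s\<in>{1..}. \<Sum>\<^sub>\<infinity>M. h e n (s, M)) = infsum (h e n) ({1..} \<times> UNIV)"
    by (rule infsum_Sigma_banach[OF h_summable_pos[OF e n]])
  also have "2 * \<dots> = (\<Sum>\<^sub>\<infinity>M. \<Sum>\<^sub>\<infinity>s\<in>-{0}. h e n (s, M))" by (rule h_sum_symmetric[OF e n])
  also have "theta + \<dots> = (\<Sum>\<^sub>\<infinity>M. th M + (\<Sum>\<^sub>\<infinity>s\<in>-{0}. h e n (s, M)))"
    unfolding theta_def by (rule infsum_add[symmetric, OF th_summable h_sum_symmetric(2)[OF e n]])
  also have "\<dots> = (\<Sum>\<^sub>\<infinity>M. th M * (1 + Z e n M))"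
  proof (rule infsum_cong)
    fix M
    have "(\<Sum>\<^sub>\<infinity>s\<in>-{0}. h e n (s, M)) = (\<Sum>\<^sub>\<infinity>s\<in>-{0}. th M * (n powi s * (1 + kap e s * t (2 * M - s))))"
      by (intro infsum_cong) (simp add: h_def)
    also have "\<dots> = th M * Z e n M" unfolding Z_def by (rule infsum_cmult_right')
    finally show "th M + (\<Sum>\<^sub>\<infinity>s\<in>-{0}. h e n (s, M)) = th M * (1 + Z e n M)" by (simp add: algebra_simps)
  qed
  finally show ?thesis .
qed

end

section \<open>Lambert series for the cube of theta and the two generating functions\<close>

context base
begin

text \<open>\<open>t\<close> tends to 1 and \<open>-1\<close> at the two ends and is not summable,
  but its one-step differences decay geometrically in both directions. A shift by \<open>k\<close>
  is a sum of such steps.\<close>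

lemma t_diff_summable: "(\<lambda>s. t s - t (s - k)) summable_on UNIV"
proof -
  have bound: "\<bar>t s - t (s - 1)\<bar> \<le> 2 / p * p ^ nat \<bar>s - 1\<bar>" for s
  proof -
    define Y where "Y = p powi (s - 1)"
    have Y0: "0 < Y" by (simp add: Y_def)
    have "p powi s = p powi (1 + (s - 1))" by simp
    also have "\<dots> = p * Y" unfolding Y_def by (subst power_int_add) auto
    finally have e: "t s - t (s - 1) = (1 - p * Y) / (1 + p * Y) - (1 - Y) / (1 + Y)"
      by (simp add: kap_def Y_def)
    also have "\<dots> = 2 * Y * (1 - p) / ((1 + p * Y) * (1 + Y))"
    proof -
      have "1 + p * Y \<noteq> 0" "1 + Y \<noteq> 0" using Y0 p_pos by (simp_all add: add_pos_pos order.strict_implies_not_eq[symmetric])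
      then have "(1 - p * Y) / (1 + p * Y) - (1 - Y) / (1 + Y) = ((1 - p * Y) * (1 + Y) - (1 - Y) * (1 + p * Y)) / ((1 + p * Y) * (1 + Y))"
        by (rule diff_frac_eq)
      then show ?thesis by (simp add: algebra_simps)
    qed
    finally have eq: "t s - t (s - 1) = 2 * Y * (1 - p) / ((1 + p * Y) * (1 + Y))" .
    have abs: "\<bar>t s - t (s - 1)\<bar> = 2 * Y * (1 - p) / ((1 + p * Y) * (1 + Y))"
      unfolding eq using Y0 p_pos p_le by (intro abs_of_nonneg divide_nonneg_nonneg mult_nonneg_nonneg) auto
    have num: "2 * Y * (1 - p) \<le> 2 * Y" using Y0 p_pos by (simp add: mult_le_cancel_left1)
    show ?thesis
    proof (cases "1 \<le> s")
      case True
      have "1 * 1 \<le> (1 + p * Y) * (1 + Y)" using Y0 p_pos by (intro mult_mono) auto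
      then have "\<bar>t s - t (s - 1)\<bar> \<le> 2 * Y / 1" unfolding abs using num Y0 by (intro frac_le) auto
      also have "\<dots> \<le> 2 / p * Y" using Y0 p_pos p_le by (simp add: divide_simps)
      also have "Y = p ^ nat \<bar>s - 1\<bar>" using True by (simp add: Y_def power_int_nonneg_exp)
      finally show ?thesis .
    next
      case False
      have "p * Y * Y \<le> (1 + p * Y) * (1 + Y)" using Y0 p_pos by (intro mult_mono) auto
      then have "\<bar>t s - t (s - 1)\<bar> \<le> 2 * Y / (p * Y * Y)" unfolding abs using num Y0 p_pos by (intro frac_le) auto
      also have "\<dots> = 2 / p * (1 / Y)" using Y0 by (simp add: divide_simps)
      also have "1 / Y = p powi (- (s - 1))" unfolding Y_def by (simp only: power_int_minus_divide)
      also have "\<dots> = p ^ nat \<bar>s - 1\<bar>" using False by (subst power_int_nonneg_exp) auto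
      finally show ?thesis .
    qed
  qed
  have step: "(\<lambda>s. t s - t (s - 1)) summable_on UNIV"
  proof (rule summable_on_bound[OF _ bound])
    have "(\<lambda>s. p ^ nat \<bar>s - 1\<bar>) summable_on UNIV"
      by (rule summable_on_reindex_bij_witness[of UNIV "\<lambda>s. s + 1" "\<lambda>s. s - 1" UNIV "\<lambda>k. p ^ nat \<bar>k\<bar>", THEN iffD2])
        (auto intro: summable_p_int)
    then show "(\<lambda>s. 2 / p * p ^ nat \<bar>s - 1\<bar>) summable_on UNIV" by (rule summable_on_cmult_right)
  qed
  have shifted: "(\<lambda>s. t (s - j) - t (s - j - 1)) summable_on UNIV" for j
    by (rule summable_on_reindex_bij_witness[of UNIV "\<lambda>s. s + j" "\<lambda>s. s - j" UNIV "\<lambda>s. t s - t (s - 1)", THEN iffD2])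
      (use step in auto)
  show ?thesis
  proof (induction k rule: int_induct[where k = 0])
    case base show ?case by simp
  next
    case (step1 i)
    show ?case using summable_on_add[OF step1(2) shifted[of i]] by (simp add: algebra_simps)
  next
    case (step2 i)
    show ?case using summable_on_diff_real[OF step2(2) shifted[of "i - 1"]] by (simp add: algebra_simps)
  qed
qed

lemma sign_summable:
  assumes "n = 1 \<or> n = (-1::real)" "f summable_on B"
  shows "(\<lambda>s. n powi s * f s) summable_on B"
  by (rule summable_on_mult_bounded[OF assms(2), where C = 1]) (use assms(1) in auto)

definition G :: "real \<Rightarrow> int \<Rightarrow> real" where
  "G n M = (\<Sum>\<^sub>\<infinity>s. n powi s * (t s - t (s - 2 * M)))"

text \<open>A shift of \<open>s\<close> by \<open>2 * M\<close> is even and leaves the sign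
  \<open>n powi s\<close> unchanged, so \<open>G n\<close> is additive in \<open>M\<close>.\<close>

lemma G_Suc:
  assumes n: "n = 1 \<or> n = (-1::real)"
  shows "G n (M + 1) = G n M + G n 1"
proof -
  have "G n 1 = (\<Sum>\<^sub>\<infinity>s. n powi (s + (- 2 * M)) * (t (s + (- 2 * M)) - t (s + (- 2 * M) - 2)))"
    unfolding G_def by (subst infsum_int_shift[of _ "- 2 * M", symmetric]) simp
  also have "\<dots> = (\<Sum>\<^sub>\<infinity>s. n powi s * (t (s - 2 * M) - t (s - 2 * (M + 1))))"
  proof (rule infsum_cong)
    fix s
    have "n powi (- 2 * M) = 1" using n by auto
    then have "n powi (s + (- 2 * M)) = n powi s" using n by (subst power_int_add) auto
    moreover have "s + (- 2 * M) = s - 2 * M" "s + (- 2 * M) - 2 = s - 2 * (M + 1)" by simp_all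
    ultimately show "n powi (s + (- 2 * M)) * (t (s + (- 2 * M)) - t (s + (- 2 * M) - 2)) = n powi s * (t (s - 2 * M) - t (s - 2 * (M + 1)))"
      by (simp only:)
  qed
  finally have G1: "G n 1 = (\<Sum>\<^sub>\<infinity>s. n powi s * (t (s - 2 * M) - t (s - 2 * (M + 1))))" .
  have "(\<lambda>s. n powi s * ((t s - t (s - 2 * (M + 1))) - (t s - t (s - 2 * M)))) summable_on UNIV"
    by (intro sign_summable n summable_on_diff_real t_diff_summable)
  then have sm: "(\<lambda>s. n powi s * (t (s - 2 * M) - t (s - 2 * (M + 1)))) summable_on UNIV" by simp
  have "G n M + G n 1 = (\<Sum>\<^sub>\<infinity>s. n powi s * (t s - t (s - 2 * M)) + n powi s * (t (s - 2 * M) - t (s - 2 * (M + 1))))"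
    unfolding G1 unfolding G_def
    by (rule infsum_add[symmetric]) (intro sign_summable n t_diff_summable sm)+
  then show ?thesis unfolding G_def by (simp add: algebra_simps)
qed

lemma t_lim: "(\<lambda>n. t (int n)) \<longlonglongrightarrow> 1"
proof -
  have "(\<lambda>n. p ^ n) \<longlonglongrightarrow> 0" using p_pos by (intro LIMSEQ_power_zero) auto
  then have "(\<lambda>n. (1 - p ^ n) / (1 + p ^ n)) \<longlonglongrightarrow> (1 - 0) / (1 + 0)" by (intro tendsto_intros) auto
  then show ?thesis by (simp add: kap_def)
qed

lemma infsum_nat_eq_suminf:
  fixes f :: "nat \<Rightarrow> real"
  assumes "f summable_on UNIV"
  shows "infsum f UNIV = suminf f"
  using has_sum_imp_sums[OF has_sum_infsum[OF assms]] by (simp add: sums_iff)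

text \<open>The half \<open>s \<ge> 1\<close> telescopes from \<open>t 0 = 0\<close> to the limit 1,
  and \<open>s \<mapsto> 1 - s\<close> maps it to the other half.\<close>

lemma t_diff_sum: "(\<Sum>\<^sub>\<infinity>s. t s - t (s - 1)) = 2"
proof -
  let ?a = "\<lambda>s. t s - t (s - 1)"
  have sm: "?a summable_on B" for B using t_diff_summable[of 1] by (rule summable_on_subset_banach) simp
  have "infsum ?a {1..} = (\<Sum>\<^sub>\<infinity>n. ?a (int (Suc n)))"
    by (rule infsum_reindex_bij_witness[of _ "\<lambda>n. int (Suc n)" "\<lambda>s. nat (s - 1)"]) auto
  also have "\<dots> = (\<Sum>n. ?a (int (Suc n)))"
  proof (rule infsum_nat_eq_suminf)
    show "(\<lambda>n. ?a (int (Suc n))) summable_on UNIV"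
      by (rule summable_on_reindex_bij_witness[of UNIV "\<lambda>s. nat (s - 1)" "\<lambda>n. int (Suc n)" "{1..}" ?a, THEN iffD2])
        (use sm in auto)
  qed
  also have "\<dots> = (\<Sum>n. t (int (Suc n)) - t (int n))" by simp
  also have "\<dots> = 1" using telescope_sums[OF t_lim] by (simp add: sums_iff)
  finally have pos: "infsum ?a {1..} = 1" .
  have "infsum ?a {1..} = infsum ?a {..0}"
  proof (rule infsum_reindex_bij_witness[of _ "\<lambda>s. 1 - s" "\<lambda>s. 1 - s"])
    fix s show "t (1 - s) - t (1 - s - 1) = t s - t (s - 1)" using t_minus[of "s - 1"] by simp
  qed auto
  moreover have "infsum ?a ({1..} \<union> {..0}) = infsum ?a {1..} + infsum ?a {..0}"
    by (rule infsum_Un_disjoint) (auto intro: sm)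
  moreover have "{1..} \<union> {..0} = (UNIV :: int set)" by auto
  ultimately show ?thesis using pos by simp
qed

text \<open>\<open>t s - t (s - 2)\<close> consists of two consecutive one-step differences. Their
  signed sums differ by the factor \<open>n\<close>, so they cancel for \<open>n = -1\<close> and
  give twice the total increase 2 of \<open>t\<close> for \<open>n = 1\<close>.\<close>

lemma G_eq:
  assumes n: "n = 1 \<or> n = (-1::real)"
  shows "G n M = (2 + 2 * n) * M"
proof -
  let ?a = "\<lambda>s. t s - t (s - 1)"
  have sm: "(\<lambda>s. n powi s * ?a s) summable_on UNIV" by (intro sign_summable n t_diff_summable)
  have "(\<lambda>s. n powi s * ((t s - t (s - 2)) - ?a s)) summable_on UNIV"
    by (intro sign_summable n t_diff_summable summable_on_diff_real)
  then have sm': "(\<lambda>s. n powi s * ?a (s - 1)) summable_on UNIV" by (simp add: diff_diff_eq)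
  have "G n 1 = (\<Sum>\<^sub>\<infinity>s. n powi s * ?a s + n powi s * ?a (s - 1))"
    unfolding G_def by (intro infsum_cong) (simp add: algebra_simps)
  also have "\<dots> = (\<Sum>\<^sub>\<infinity>s. n powi s * ?a s) + (\<Sum>\<^sub>\<infinity>s. n powi s * ?a (s - 1))"
    by (rule infsum_add[OF sm sm'])
  also have "(\<Sum>\<^sub>\<infinity>s. n powi s * ?a (s - 1)) = (\<Sum>\<^sub>\<infinity>s. n powi (s + 1) * ?a s)"
    by (subst infsum_int_shift[of _ 1, symmetric]) simp
  also have "\<dots> = (\<Sum>\<^sub>\<infinity>s. n * (n powi s * ?a s))"
    using n by (intro infsum_cong) (auto simp: power_int_add)
  also have "\<dots> = n * (\<Sum>\<^sub>\<infinity>s. n powi s * ?a s)" by (rule infsum_cmult_right')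
  finally have "G n 1 = (1 + n) * (\<Sum>\<^sub>\<infinity>s. n powi s * ?a s)" by (simp add: algebra_simps)
  then have G1: "G n 1 = 2 + 2 * n" using n t_diff_sum by auto
  show ?thesis
  proof (induction M rule: int_induct[where k = 0])
    case base show ?case by (simp add: G_def)
  next
    case (step1 i) then show ?case using G_Suc[OF n, of i] G1 by (simp add: algebra_simps)
  next
    case (step2 i) then show ?case using G_Suc[OF n, of "i - 1"] G1 by (simp add: algebra_simps)
  qed
qed

section \<open>Evaluation of the inner sums over \<open>s\<close>\<close>

definition sech2 :: "int \<Rightarrow> real" where "sech2 u = 4 * p powi u / (1 + p powi u)\<^sup>2"

lemma one_minus_t_sq: "1 - (t u)\<^sup>2 = sech2 u"
proof -
  have "1 + p powi u \<noteq> 0" using kap_den[of "-1" u] by simp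
  then show ?thesis unfolding kap_def sech2_def
    by (simp add: power_divide divide_simps) (simp add: power2_eq_square algebra_simps)
qed

lemma sech2_0 [simp]: "sech2 0 = 1" by (simp add: sech2_def)

lemma sech2_minus [simp]: "sech2 (- u) = sech2 u" by (simp add: one_minus_t_sq[symmetric])

lemma powi_nonneg [simp]: "0 \<le> p powi u"
  using powi_pos[of u] by linarith

lemma sech2_nonneg: "0 \<le> sech2 u" by (simp add: sech2_def)

lemma sech2_abs_le_1: "\<bar>sech2 u\<bar> \<le> 1"
proof -
  have "0 \<le> (t u)\<^sup>2" by simp
  then show ?thesis using one_minus_t_sq[of u] sech2_nonneg[of u] by linarith
qed

lemma sech2_bound: "sech2 u \<le> 4 * p ^ nat \<bar>u\<bar>"
proof -
  have pos: "sech2 u \<le> 4 * p ^ nat \<bar>u\<bar>" if "0 \<le> u" for u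
  proof -
    have "1 \<le> (1 + p powi u)\<^sup>2" using powi_pos[of u] by (intro one_le_power) simp
    then have "sech2 u \<le> 4 * p powi u / 1" unfolding sech2_def using powi_pos[of u] by (intro frac_le) auto
    then show ?thesis using that by (simp add: power_int_nonneg_exp)
  qed
  show ?thesis using pos[of u] pos[of "- u"] by (cases "0 \<le> u") auto
qed

lemma sech2_summable: "sech2 summable_on B"
  by (rule summable_on_bound[of "\<lambda>u. 4 * p ^ nat \<bar>u\<bar>"])
    (use sech2_bound sech2_nonneg in \<open>auto intro!: summable_on_cmult_right summable_p_int\<close>)

text \<open>For \<open>e = -1\<close> the term at \<open>s = 0\<close> is 1, so \<open>1 + Z\<close>
  is the sum over all \<open>s\<close>. If \<open>M \<noteq> 0\<close>, \<open>kap_add\<close> with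
  \<open>x + y = 2 * M\<close> extracts a cotangent and leaves \<open>G\<close>; at the pole
  \<open>M = 0\<close> the summand is \<open>1 - (t s)^2\<close> instead.\<close>

lemma Z_minus:
  assumes n: "n = 1 \<or> n = (-1::real)"
  shows "1 + Z (-1) n M = (if M = 0 then \<Sum>\<^sub>\<infinity>s. n powi s * sech2 s else kap 1 (2 * M) * ((2 + 2 * n) * M))"
proof -
  let ?f = "\<lambda>s. n powi s * (1 + t s * t (2 * M - s))"
  have f0: "M = 0 \<Longrightarrow> ?f s = n powi s * sech2 s" for s
    using one_minus_t_sq[of s] by (simp add: power2_eq_square)
  have f1: "?f s = kap 1 (2 * M) * (n powi s * (t s - t (s - 2 * M)))" if "M \<noteq> 0" for s
    using kap_add[of "-1" s "2 * M - s"] t_minus[of "s - 2 * M"] that by simp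
  have "?f summable_on UNIV"
  proof (cases "M = 0")
    case True
    show ?thesis unfolding f0[OF True] by (intro sign_summable n sech2_summable)
  next
    case False
    show ?thesis unfolding f1[OF False] by (intro summable_on_cmult_right sign_summable n t_diff_summable)
  qed
  then have "?f summable_on - {0}" by (rule summable_on_subset_banach) simp
  then have "infsum ?f (insert 0 (- {0})) = ?f 0 + infsum ?f (- {0})" by (rule infsum_insert) simp
  moreover have "insert 0 (- {0}) = (UNIV :: int set)" by auto
  ultimately have "1 + Z (-1) n M = infsum ?f UNIV" by (simp add: Z_def)
  also have "\<dots> = (if M = 0 then \<Sum>\<^sub>\<infinity>s. n powi s * sech2 s else kap 1 (2 * M) * ((2 + 2 * n) * M))"
  proof (cases "M = 0")
    case True
    show ?thesis unfolding f0[OF True] using True by simp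
  next
    case False
    have "infsum ?f UNIV = kap 1 (2 * M) * G n M"
      unfolding f1[OF False] G_def by (rule infsum_cmult_right')
    then show ?thesis using False G_eq[OF n] by simp
  qed
  finally show ?thesis .
qed

text \<open>Here \<open>kap_add\<close> leaves \<open>kap 1 s - t (s - 2 * M)\<close>, which is
  split at \<open>t s\<close>. The part \<open>kap 1 s - t s\<close> is odd and sums to 0. The other
  part is \<open>G (-1) M = 0\<close> without its term \<open>t (2 * M)\<close> at
  \<open>s = 0\<close>. Thus \<open>Z\<close> is \<open>- (t (2 * M))^2\<close>.\<close>

lemma Z_plus: "1 + Z 1 (-1) M = sech2 (2 * M)"
proof -
  let ?sg = "\<lambda>s. (-1 :: real) powi s"
  have f: "?sg s * (1 + kap 1 s * t (2 * M - s)) =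
      t (2 * M) * (?sg s * (kap 1 s - t s) + ?sg s * (t s - t (s - 2 * M)))" if "s \<in> - {0}" for s
  proof -
    have "1 + kap 1 s * t (2 * M - s) = t (2 * M) * (kap 1 s + t (2 * M - s))"
      using kap_add[of 1 s "2 * M - s"] that by simp
    also have "t (2 * M - s) = - t (s - 2 * M)" using t_minus[of "s - 2 * M"] by simp
    finally show ?thesis using t_minus[of "s - 2 * M"] by (simp add: right_diff_distrib)
  qed
  have odd: "kap 1 (- s) - t (- s) = - (kap 1 s - t s)" for s by (simp add: kap_minus)
  have pos: "\<bar>kap 1 s - t s\<bar> \<le> 8 * p ^ nat \<bar>s\<bar>" if "1 \<le> s" for s
  proof -
    define Y where "Y = p powi s"
    have "Y \<le> p powi 1" unfolding Y_def using that p_pos p_le by (intro power_int_decreasing) auto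
    then have Y: "0 < Y" "Y \<le> 1/4" using p_le by (auto simp: Y_def)
    have "(1 + Y) / (1 - Y) - (1 - Y) / (1 + Y) = 4 * Y / ((1 - Y) * (1 + Y))"
      using Y by (subst diff_frac_eq) (auto simp: algebra_simps)
    then have "kap 1 s - t s = 4 * Y / ((1 - Y) * (1 + Y))" by (simp add: kap_def Y_def)
    also have "\<bar>\<dots>\<bar> \<le> 4 * Y / (1/2 * 1)"
    proof -
      have "1/2 * 1 \<le> (1 - Y) * (1 + Y)" by (intro mult_mono) (use Y in auto)
      then show ?thesis unfolding abs_divide using Y by (intro frac_le) auto
    qed
    finally show ?thesis using that by (simp add: Y_def power_int_nonneg_exp)
  qed
  have bound: "\<bar>kap 1 s - t s\<bar> \<le> 8 * p ^ nat \<bar>s\<bar>" if "s \<in> - {0}" for s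
    using pos[of s] pos[of "- s"] odd[of s] that by (cases "1 \<le> s") auto
  have s1: "(\<lambda>s. ?sg s * (kap 1 s - t s)) summable_on - {0}"
    by (intro sign_summable summable_on_bound[OF _ bound] summable_on_cmult_right summable_p_int) auto
  have s2: "(\<lambda>s. ?sg s * (t s - t (s - 2 * M))) summable_on - {0}"
    by (intro sign_summable summable_on_subset_banach[OF t_diff_summable]) auto
  have "(\<Sum>\<^sub>\<infinity>s\<in>-{0}. ?sg s * (kap 1 s - t s)) = (\<Sum>\<^sub>\<infinity>s\<in>-{0}. - (?sg s * (kap 1 s - t s)))"
    by (rule infsum_reindex_bij_witness[of _ uminus uminus])
      (auto simp: power_int_minus_one_minus kap_minus algebra_simps)
  then have z: "(\<Sum>\<^sub>\<infinity>s\<in>-{0}. ?sg s * (kap 1 s - t s)) = 0" by (simp add: infsum_uminus)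
  have "insert 0 (- {0}) = (UNIV :: int set)" by auto
  then have "G (-1) M = t (2 * M) + (\<Sum>\<^sub>\<infinity>s\<in>-{0}. ?sg s * (t s - t (s - 2 * M)))"
    unfolding G_def using infsum_insert[OF s2, of 0] by simp
  then have z2: "(\<Sum>\<^sub>\<infinity>s\<in>-{0}. ?sg s * (t s - t (s - 2 * M))) = - t (2 * M)" using G_eq[of "-1"] by simp
  have "Z 1 (-1) M = (\<Sum>\<^sub>\<infinity>s\<in>-{0}. t (2 * M) * (?sg s * (kap 1 s - t s) + ?sg s * (t s - t (s - 2 * M))))"
    unfolding Z_def by (rule infsum_cong) (rule f)
  also have "\<dots> = t (2 * M) * (\<Sum>\<^sub>\<infinity>s\<in>-{0}. ?sg s * (kap 1 s - t s) + ?sg s * (t s - t (s - 2 * M)))"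
    by (rule infsum_cmult_right')
  also have "\<dots> = t (2 * M) * - t (2 * M)" by (simp only: infsum_add[OF s1 s2] z z2) simp
  finally show ?thesis using one_minus_t_sq[of "2 * M"] by (simp add: power2_eq_square)
qed

lemma infsum_int_even:
  fixes f :: "int \<Rightarrow> real"
  assumes sm: "f summable_on UNIV" and ev: "\<And>k. f (- k) = f k"
  shows "infsum f UNIV = f 0 + 2 * (\<Sum>r. f (int (Suc r)))" "summable (\<lambda>r. f (int (Suc r)))"
proof -
  have sB: "f summable_on B" for B using sm by (rule summable_on_subset_banach) simp
  have pos: "(\<lambda>r. f (int (Suc r))) summable_on UNIV"
    by (rule summable_on_reindex_bij_witness[of UNIV "\<lambda>s. nat (s - 1)" "\<lambda>n. int (Suc n)" "{1..}" f, THEN iffD2])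
      (use sB in auto)
  then show "summable (\<lambda>r. f (int (Suc r)))" by (rule summable_on_imp_summable)
  have "infsum f {1..} = (\<Sum>\<^sub>\<infinity>r. f (int (Suc r)))"
    by (rule infsum_reindex_bij_witness[of _ "\<lambda>n. int (Suc n)" "\<lambda>s. nat (s - 1)"]) auto
  also have "\<dots> = (\<Sum>r. f (int (Suc r)))" by (rule infsum_nat_eq_suminf[OF pos])
  finally have 1: "infsum f {1..} = (\<Sum>r. f (int (Suc r)))" .
  have 2: "infsum f {..-1} = infsum f {1..}"
    by (rule infsum_reindex_bij_witness[of _ uminus uminus]) (auto simp: ev)
  have "infsum f ({1..} \<union> {..-1}) = infsum f {1..} + infsum f {..-1}"
    by (rule infsum_Un_disjoint) (auto intro: sB)
  moreover have "infsum f (insert 0 ({1..} \<union> {..-1})) = f 0 + infsum f ({1..} \<union> {..-1})"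
    by (rule infsum_insert[OF sB]) auto
  moreover have "insert 0 ({1..} \<union> {..-1}) = (UNIV :: int set)" by auto
  ultimately show "infsum f UNIV = f 0 + 2 * (\<Sum>r. f (int (Suc r)))" using 1 2 by simp
qed

section \<open>Identification with the values of \<open>V\<close>, \<open>L\<close> and
  \<open>Psi\<close>\<close>

lemma choose2_double: "2 * (Suc n choose 2) = n * Suc n"
proof (induction n)
  case 0 show ?case by (simp add: choose2_1)
next
  case (Suc n)
  show ?case unfolding choose2_Suc[of "Suc n"] distrib_left Suc by simp
qed

lemma th_Suc_nat: "th (int (Suc r)) = (-1) ^ Suc r * p ^ (Suc r * Suc r)"
  unfolding th_def of_nat_mult[symmetric] power_int_of_nat ..

lemma theta_eq_U0: "theta = U 0"
proof -
  have "theta = th 0 + 2 * (\<Sum>r. th (int (Suc r)))"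
    unfolding theta_def by (rule infsum_int_even(1)[OF th_summable th_minus])
  also have "(\<lambda>r. th (int (Suc r))) = (\<lambda>r. (-1) ^ Suc r * p ^ (Suc r choose 2) * w (Suc r) 0)"
  proof
    fix r
    have "Suc r * Suc r = (Suc r choose 2) + (Suc (Suc r) choose 2)"
      using choose2_double[of r] choose2_double[of "Suc r"] by simp
    then have "p ^ (Suc r * Suc r) = p ^ (Suc r choose 2) * p ^ (Suc (Suc r) choose 2)"
      by (simp only: power_add)
    then show "th (int (Suc r)) = (-1) ^ Suc r * p ^ (Suc r choose 2) * w (Suc r) 0"
      by (simp only: th_Suc_nat w_0 mult.assoc)
  qed
  finally show ?thesis by (simp add: th_def U_def)
qed

lemma theta_pos: "0 < theta"
proof -
  have "\<bar>theta - 1\<bar> = 2 * \<bar>\<Sum>r. th (int (Suc r))\<bar>"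
    using infsum_int_even(1)[OF th_summable th_minus] by (simp add: theta_def th_def)
  also have "\<bar>\<Sum>r. th (int (Suc r))\<bar> \<le> (\<Sum>r. 1/4 * (1/4) ^ r)"
  proof (rule norm_suminf_le[where 'a = real, unfolded real_norm_def])
    fix r
    have "\<bar>th (int (Suc r))\<bar> \<le> p ^ Suc r" using th_bound[of "int (Suc r)"] by (simp add: nat_add_distrib)
    also have "\<dots> \<le> (1/4) ^ Suc r" using p_pos p_le by (intro power_mono) auto
    finally show "\<bar>th (int (Suc r))\<bar> \<le> 1/4 * (1/4) ^ r" by simp
  qed (intro summable_mult summable_geometric, simp)
  also have "(\<Sum>r. 1/4 * (1/4 :: real) ^ r) = 1/3" by (subst suminf_mult) (simp_all add: suminf_geometric)
  finally show ?thesis by linarith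
qed

text \<open>The factor \<open>2 + 2 * n\<close> in \<open>Z_minus\<close> vanishes, so only
  \<open>M = 0\<close> survives. Its sum is the Lambert series \<open>V p\<close>, which is the
  fourth power of theta; one factor theta cancels.\<close>

theorem X_minus_minus: "X (-1) (-1) = theta ^ 3"
proof -
  have "theta * X (-1) (-1) = (\<Sum>\<^sub>\<infinity>M. th M * (1 + Z (-1) (-1) M))" by (rule theta_X) auto
  also have "\<dots> = (\<Sum>\<^sub>\<infinity>M\<in>{0}. th M * (1 + Z (-1) (-1) M))"
    by (rule infsum_cong_neutral) (auto simp: Z_minus)
  also have "\<dots> = (\<Sum>\<^sub>\<infinity>s. (-1) powi s * sech2 s)" by (simp add: Z_minus th_def)
  also have "\<dots> = (-1) powi 0 * sech2 0 + 2 * (\<Sum>r. (-1) powi (int (Suc r)) * sech2 (int (Suc r)))"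
    by (rule infsum_int_even(1)) (auto intro: sign_summable sech2_summable simp: power_int_minus_one_minus)
  also have "(\<lambda>r. (-1) powi (int (Suc r)) * sech2 (int (Suc r))) =
      (\<lambda>r. 2 * ((-1) ^ Suc r * w (Suc r) p / (1 + p ^ Suc r)))"
    unfolding w_p sech2_def power_int_of_nat by (simp add: power2_eq_square mult_ac del: power_Suc)
  also have "(\<Sum>r. 2 * ((-1) ^ Suc r * w (Suc r) p / (1 + p ^ Suc r))) = 2 * (\<Sum>r. (-1) ^ Suc r * w (Suc r) p / (1 + p ^ Suc r))"
  proof (rule suminf_mult)
    have "p \<in> dom" using p_pos p_le by auto
    then have "summable (\<lambda>r. ((-1) ^ Suc r * (1 / (1 + p ^ Suc r))) * w (Suc r) p)"
      by (intro summable_w_series V_coeff)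
    then show "summable (\<lambda>r. (-1) ^ Suc r * w (Suc r) p / (1 + p ^ Suc r))" by simp
  qed
  finally have "theta * X (-1) (-1) = V p" by (simp add: V_def)
  also have "\<dots> = theta * theta ^ 3"
    using V_eq[of p] p_pos p_le U_p theta_eq_U0 by (simp add: power2_eq_square power3_eq_cube)
  finally show ?thesis using theta_pos by simp
qed

lemma sq_base: "base (p\<^sup>2)"
proof
  show "0 < p\<^sup>2" using p_pos by simp
  have "p\<^sup>2 \<le> (1/4) ^ 2" using p_pos p_le by (intro power_mono) auto
  then show "p\<^sup>2 \<le> 1/4" by (simp add: power2_eq_square)
qed

text \<open>The exponent of the \<open>r\<close>-th Lambert term is
  \<open>r^2 + 2 r = 2 (r + 1 choose 2) + r\<close>, which is what \<open>L\<close> has in base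
  \<open>p^2\<close> at \<open>s = p\<close>. In the same way
  \<open>r^2 = 2 (r choose 2) + r\<close> makes \<open>U\<close> in base \<open>p^2\<close> at
  \<open>p\<close> equal to theta.\<close>

theorem X_plus_minus: "X 1 (-1) = base.Psi (p\<^sup>2) p"
proof -
  interpret sq: base "p\<^sup>2" by (rule sq_base)
  have w: "sq.w r p = p ^ r" for r using p_pos by (intro sq.w_sqrt) auto
  have pw: "(p\<^sup>2) ^ k = p ^ (2 * k)" for k by (simp add: power_mult)
  have "theta * X 1 (-1) = (\<Sum>\<^sub>\<infinity>M. th M * sech2 (2 * M))"
    by (subst theta_X) (auto simp: Z_plus)
  also have "\<dots> = th 0 * sech2 (2 * 0) + 2 * (\<Sum>r. th (int (Suc r)) * sech2 (2 * int (Suc r)))"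
  proof (rule infsum_int_even(1))
    have "(\<lambda>M. sech2 (2 * M) * th M) summable_on UNIV"
      by (rule summable_on_mult_bounded[OF th_summable, where C = 1])
        (rule sech2_abs_le_1)
    then show "(\<lambda>M. th M * sech2 (2 * M)) summable_on UNIV" by (simp add: mult.commute)
    show "th (- k) * sech2 (2 * - k) = th k * sech2 (2 * k)" for k
      using sech2_minus[of "2 * k"] by (simp del: sech2_minus)
  qed
  also have "(\<lambda>r. th (int (Suc r)) * sech2 (2 * int (Suc r))) =
    (\<lambda>r. 4 * (((-1) ^ Suc r * (p\<^sup>2) ^ (Suc (Suc r) choose 2) * (1 / (1 + (p\<^sup>2) ^ Suc r)\<^sup>2)) * sq.w (Suc r) p))"
  proof
    fix r
    have "2 * int (Suc r) = int (2 * Suc r)" by simp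
    then have s: "sech2 (2 * int (Suc r)) = 4 * p ^ (2 * Suc r) / (1 + p ^ (2 * Suc r))\<^sup>2"
      by (simp only: sech2_def power_int_of_nat)
    have "p ^ (Suc r * Suc r) * p ^ (2 * Suc r) = p ^ (2 * (Suc (Suc r) choose 2)) * p ^ Suc r"
      unfolding choose2_double power_add[symmetric] by (rule arg_cong) simp
    then show "th (int (Suc r)) * sech2 (2 * int (Suc r)) =
        4 * (((-1) ^ Suc r * (p\<^sup>2) ^ (Suc (Suc r) choose 2) * (1 / (1 + (p\<^sup>2) ^ Suc r)\<^sup>2)) * sq.w (Suc r) p)"
      unfolding s th_Suc_nat w pw by (simp del: power_Suc mult_Suc mult_Suc_right binomial_Suc_Suc)
  qed
  also have "(\<Sum>r. 4 * (((-1) ^ Suc r * (p\<^sup>2) ^ (Suc (Suc r) choose 2) * (1 / (1 + (p\<^sup>2) ^ Suc r)\<^sup>2)) * sq.w (Suc r) p)) =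
     4 * (\<Sum>r. ((-1) ^ Suc r * (p\<^sup>2) ^ (Suc (Suc r) choose 2) * (1 / (1 + (p\<^sup>2) ^ Suc r)\<^sup>2)) * sq.w (Suc r) p)"
    by (intro suminf_mult sq.summable_w_series sq.L_coeff) (use p_pos p_le in auto)
  finally have "theta * X 1 (-1) = sq.L p" by (simp add: sq.L_alt th_def)
  also have "\<dots> = sq.U p * sq.Psi p" using p_pos p_le by (intro sq.L_eq) auto
  also have "sq.U p = theta"
  proof -
    have "(-1) ^ Suc r * (p\<^sup>2) ^ (Suc r choose 2) * sq.w (Suc r) p = (-1) ^ Suc r * p ^ ((Suc (Suc r) choose 2) + (Suc r choose 2))" for r
    proof -
      have "p ^ (2 * (Suc r choose 2)) * p ^ Suc r = p ^ ((Suc (Suc r) choose 2) + (Suc r choose 2))"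
        unfolding choose2_Suc[of "Suc r"] power_add[symmetric] by (rule arg_cong) simp
      then show ?thesis unfolding w pw by (simp only: mult.assoc)
    qed
    then show ?thesis unfolding theta_eq_U0 sq.U_def U_def w_0
      by (simp only: power_add mult.assoc mult.commute[of "p ^ (Suc (Suc _) choose 2)"])
  qed
  finally show ?thesis using theta_pos by simp
qed

section \<open>A divisor identity and the case of the ordinary rank\<close>

lemma alternating_sums:
  assumes x: "0 < x" "x < (1::real)"
  shows "(\<lambda>k. (-1) ^ k * x ^ Suc k) sums (x / (1 + x))"
    and "(\<lambda>k. (-1) ^ k * real (Suc k) * x ^ Suc k) sums (x / (1 + x)\<^sup>2)"
proof -
  have "(\<lambda>k. x * (- x) ^ k) sums (x * (1 / (1 - - x)))"
    using x by (intro sums_mult geometric_sums) auto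
  moreover have "x * (- x) ^ k = (-1) ^ k * x ^ Suc k" for k by (simp add: power_minus[of x])
  ultimately show "(\<lambda>k. (-1) ^ k * x ^ Suc k) sums (x / (1 + x))" by simp
  have "(\<lambda>k. x * (real (Suc k) * (- x) ^ k)) sums (x * (1 / (1 - - x)\<^sup>2))"
    using x by (intro sums_mult geometric_deriv_sums) auto
  moreover have "(\<lambda>k. x * (real (Suc k) * (- x) ^ k)) = (\<lambda>k. (-1) ^ k * real (Suc k) * x ^ Suc k)"
    by (simp add: power_minus[of x] mult_ac)
  moreover have "x * (1 / (1 - - x)\<^sup>2) = x / (1 + x)\<^sup>2" by simp
  ultimately show "(\<lambda>k. (-1) ^ k * real (Suc k) * x ^ Suc k) sums (x / (1 + x)\<^sup>2)" by (simp only:)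
qed

text \<open>With \<open>D = Suc d\<close> and \<open>E = Suc e\<close> this is
  \<open>(-1)^(E - 1) E p^(D E)\<close>, whose sum over \<open>E\<close> is
  \<open>p^D / (1 + p^D)^2\<close>.\<close>

definition div_term :: "nat \<times> nat \<Rightarrow> real" where
  "div_term = (\<lambda>(d, e). (-1) ^ e * real (Suc e) * p ^ (Suc d * Suc e))"

lemma div_term_summable: "div_term summable_on B"
proof (rule summable_on_subset_banach[of _ UNIV])
  have "(\<lambda>d. p ^ d) summable_on UNIV"
    using p_pos by (intro summable_nonneg_imp_summable_on summable_geometric) auto
  moreover have "(\<lambda>e. real (Suc e) * p ^ e) summable_on UNIV"
    using geometric_deriv_sums[of p] p_pos
    by (intro summable_nonneg_imp_summable_on) (auto simp: sums_iff)
  ultimately have s: "(\<lambda>(d, e). p ^ d * (real (Suc e) * p ^ e)) summable_on UNIV \<times> UNIV"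
    by (rule summable_on_Times)
  have "\<bar>div_term x\<bar> \<le> (case x of (d, e) \<Rightarrow> p ^ d * (real (Suc e) * p ^ e))" for x
  proof (cases x)
    case (Pair d e)
    have "p ^ (Suc d * Suc e) \<le> p ^ (d + e)" using p_pos p_le by (intro power_decreasing) auto
    then have "real (Suc e) * p ^ (Suc d * Suc e) \<le> real (Suc e) * p ^ (d + e)" by (intro mult_left_mono) auto
    then show ?thesis unfolding Pair div_term_def by (simp add: abs_mult power_add ac_simps)
  qed
  then show "div_term summable_on UNIV"
    using s by (intro summable_on_bound[OF s[unfolded UNIV_Times_UNIV]])
qed simp

lemma infsum_sums:
  fixes f :: "nat \<Rightarrow> real"
  assumes "f summable_on UNIV" "f sums c"
  shows "infsum f UNIV = c"
  using infsum_nat_eq_suminf[OF assms(1)] assms(2) by (simp add: sums_iff)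

lemma p_Suc_bounds: "0 < p ^ Suc d" "p ^ Suc d < 1"
  using p_power_le(2,3)[of d] p_power_le(3)[of "Suc d"] by linarith+

text \<open>Splitting the sum over all pairs of divisors into \<open>d < e\<close>, \<open>d = e\<close> and \<open>d > e\<close>.\<close>

lemma divisor_split:
  "(\<lambda>d. (-1) ^ Suc d * p ^ (Suc d * Suc d) *
      (p ^ Suc d / (1 + p ^ Suc d)\<^sup>2 - real (Suc d) * kap 1 (2 * int (Suc d)))) sums
    (\<Sum>d. p ^ Suc d / (1 + p ^ Suc d)\<^sup>2)"
proof -
  have inner: "(\<lambda>e. div_term (d, e)) summable_on UNIV" for d
  proof -
    have "div_term summable_on {d} \<times> UNIV" by (rule div_term_summable)
    then show ?thesis
      by (rule summable_on_reindex_bij_witness[of UNIV snd "Pair d" "{d} \<times> UNIV" div_term, THEN iffD2, rotated -1]) auto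
  qed
  have row: "(\<Sum>\<^sub>\<infinity>e. div_term (d, e)) = p ^ Suc d / (1 + p ^ Suc d)\<^sup>2" for d
  proof (rule infsum_sums[OF inner])
    show "(\<lambda>e. div_term (d, e)) sums (p ^ Suc d / (1 + p ^ Suc d)\<^sup>2)"
      using alternating_sums(2)[OF p_Suc_bounds[of d]] by (simp only: div_term_def prod.case power_mult)
  qed
  have all: "div_term summable_on UNIV \<times> UNIV" by (rule div_term_summable)
  have total: "(\<Sum>\<^sub>\<infinity>d. p ^ Suc d / (1 + p ^ Suc d)\<^sup>2) = infsum div_term UNIV"
    using infsum_Sigma_banach[OF all] unfolding row by simp
  have total_s: "(\<lambda>d. p ^ Suc d / (1 + p ^ Suc d)\<^sup>2) summable_on UNIV"
    using summable_on_Sigma_banach[of "\<lambda>d e. div_term (d, e)" UNIV "\<lambda>_. UNIV"] all unfolding row by simp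
  \<comment> \<open>\<open>lo d\<close> collects \<open>e = d + Suc k\<close>, \<open>di d\<close>
    the diagonal and \<open>up e\<close> collects \<open>d = e + Suc k\<close>, each summed over
    \<open>k\<close>. The two terms in \<open>lo\<close> come from
    \<open>Suc e = Suc d + Suc k\<close>.\<close>
  define lo where "lo d = (-1) ^ Suc d * p ^ (Suc d * Suc d) *
      (real (Suc d) * (p ^ Suc d / (1 + p ^ Suc d)) + p ^ Suc d / (1 + p ^ Suc d)\<^sup>2)" for d
  define di where "di d = (-1) ^ d * real (Suc d) * p ^ (Suc d * Suc d)" for d
  define up where "up e = (-1) ^ e * real (Suc e) * p ^ (Suc e * Suc e) * (p ^ Suc e / (1 - p ^ Suc e))" for e
  let ?L = "\<lambda>(d, k). div_term (d, d + Suc k)" and ?U = "\<lambda>(e, k). div_term (e + Suc k, e)"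
  have L: "?L summable_on UNIV \<times> UNIV" "infsum ?L UNIV = infsum div_term {(d, e). d < e}"
    and U: "?U summable_on UNIV \<times> UNIV" "infsum ?U UNIV = infsum div_term {(d, e). e < d}"
  proof -
    show "?L summable_on UNIV \<times> UNIV"
      by (rule summable_on_reindex_bij_witness[of _ "\<lambda>(d, e). (d, e - Suc d)" "\<lambda>(d, k). (d, d + Suc k)" "{(d, e). d < e}" div_term, THEN iffD2])
        (auto intro: div_term_summable)
    show "?U summable_on UNIV \<times> UNIV"
      by (rule summable_on_reindex_bij_witness[of _ "\<lambda>(d, e). (e, d - Suc e)" "\<lambda>(e, k). (e + Suc k, e)" "{(d, e). e < d}" div_term, THEN iffD2])
        (auto intro: div_term_summable)
    show "infsum ?L UNIV = infsum div_term {(d, e). d < e}"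
      by (rule infsum_reindex_bij_witness[of _ "\<lambda>(d, e). (d, e - Suc d)" "\<lambda>(d, k). (d, d + Suc k)"]) auto
    show "infsum ?U UNIV = infsum div_term {(d, e). e < d}"
      by (rule infsum_reindex_bij_witness[of _ "\<lambda>(d, e). (e, d - Suc e)" "\<lambda>(e, k). (e + Suc k, e)"]) auto
  qed
  have Lrow: "(\<lambda>k. div_term (d, d + Suc k)) sums lo d" for d
  proof -
    have "(\<lambda>k. (-1) ^ Suc d * p ^ (Suc d * Suc d) * (real (Suc d) * ((-1) ^ k * (p ^ Suc d) ^ Suc k) + (-1) ^ k * real (Suc k) * (p ^ Suc d) ^ Suc k)) sums lo d"
      unfolding lo_def by (intro sums_mult sums_add alternating_sums p_Suc_bounds)
    moreover have "(-1) ^ Suc d * p ^ (Suc d * Suc d) * (real (Suc d) * ((-1) ^ k * (p ^ Suc d) ^ Suc k) + (-1) ^ k * real (Suc k) * (p ^ Suc d) ^ Suc k) = div_term (d, d + Suc k)" for k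
    proof -
      have "Suc d * Suc (d + Suc k) = Suc d * Suc d + Suc d * Suc k" by (simp add: distrib_left)
      then have "p ^ (Suc d * Suc (d + Suc k)) = p ^ (Suc d * Suc d) * (p ^ Suc d) ^ Suc k"
        by (simp only: power_add power_mult)
      moreover have "(-1 :: real) ^ (d + Suc k) = (-1) ^ Suc d * (-1) ^ k" by (simp add: power_add)
      moreover have "real (Suc (d + Suc k)) = real (Suc d) + real (Suc k)" by simp
      ultimately show ?thesis unfolding div_term_def by (simp only: prod.case) (simp only: ring_distribs ac_simps)
    qed
    ultimately show ?thesis by (simp only:)
  qed
  have Urow: "(\<lambda>k. div_term (e + Suc k, e)) sums up e" for e
  proof -
    have "(\<lambda>k. (-1) ^ e * real (Suc e) * p ^ (Suc e * Suc e) * (p ^ Suc e * (p ^ Suc e) ^ k)) sums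
        ((-1) ^ e * real (Suc e) * p ^ (Suc e * Suc e) * (p ^ Suc e * (1 / (1 - p ^ Suc e))))"
      using p_Suc_bounds[of e] by (intro sums_mult geometric_sums) (simp del: power_Suc)
    moreover have "(-1) ^ e * real (Suc e) * p ^ (Suc e * Suc e) * (p ^ Suc e * (p ^ Suc e) ^ k) = div_term (e + Suc k, e)" for k
    proof -
      have "Suc (e + Suc k) * Suc e = Suc e * Suc e + (Suc e + Suc e * k)" by (simp add: algebra_simps)
      then have "p ^ (Suc (e + Suc k) * Suc e) = p ^ (Suc e * Suc e) * (p ^ Suc e * (p ^ Suc e) ^ k)"
        by (simp only: power_add power_mult)
      then show ?thesis unfolding div_term_def by (simp only: prod.case mult.assoc)
    qed
    ultimately show ?thesis unfolding up_def by simp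
  qed
  have fib: "(\<lambda>k. f (d, k)) summable_on UNIV" if "f summable_on UNIV \<times> UNIV" for f :: "nat \<times> nat \<Rightarrow> real" and d
  proof -
    have "f summable_on {d} \<times> UNIV" using that by (rule summable_on_subset_banach) auto
    then show ?thesis
      by (rule summable_on_reindex_bij_witness[of UNIV snd "Pair d" "{d} \<times> UNIV" f, THEN iffD2, rotated -1]) auto
  qed
  have Lrow': "(\<Sum>\<^sub>\<infinity>k. div_term (d, d + Suc k)) = lo d" for d
    using fib[OF L(1)] Lrow by (intro infsum_sums) auto
  have Urow': "(\<Sum>\<^sub>\<infinity>k. div_term (e + Suc k, e)) = up e" for e
    using fib[OF U(1)] Urow by (intro infsum_sums) auto
  have Ls: "lo summable_on UNIV" "infsum lo UNIV = infsum div_term {(d, e). d < e}"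
    using summable_on_Sigma_banach[OF L(1)] infsum_Sigma'_banach[OF L(1)] L(2) unfolding Lrow' by simp_all
  have Us: "up summable_on UNIV" "infsum up UNIV = infsum div_term {(d, e). e < d}"
    using summable_on_Sigma_banach[OF U(1)] infsum_Sigma'_banach[OF U(1)] U(2) unfolding Urow' by simp_all
  have dd: "div_term (d, d) = di d" for d by (simp add: div_term_def di_def)
  have Ds: "di summable_on UNIV"
    by (rule summable_on_reindex_bij_witness[of _ fst "\<lambda>d. (d, d)" "{(d, e). d = e}" div_term, THEN iffD2])
      (auto intro: div_term_summable simp: dd)
  have Di: "infsum di UNIV = infsum div_term {(d, e). d = e}"
    by (rule infsum_reindex_bij_witness[of _ fst "\<lambda>d. (d, d)"]) (auto simp: dd)
  have "infsum div_term ({(d, e). d < e} \<union> ({(d, e). e < d} \<union> {(d, e). d = e})) =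
      infsum div_term {(d, e). d < e} + (infsum div_term {(d, e). e < d} + infsum div_term {(d, e). d = e})"
    by (subst infsum_Un_disjoint[OF div_term_summable div_term_summable], force,
        subst infsum_Un_disjoint[OF div_term_summable div_term_summable], auto)
  moreover have "{(d, e). d < e} \<union> ({(d, e). e < d} \<union> {(d, e). d = e}) = (UNIV :: (nat \<times> nat) set)"
    by auto
  ultimately have "infsum div_term UNIV = infsum lo UNIV + (infsum up UNIV + infsum di UNIV)"
    using Ls Us Di by simp
  also have "\<dots> = (\<Sum>\<^sub>\<infinity>d. lo d + (up d + di d))"
    by (simp only: infsum_add[OF Us(1) Ds] infsum_add[OF Ls(1) summable_on_add[OF Us(1) Ds]])
  finally have eq: "infsum div_term UNIV = (\<Sum>\<^sub>\<infinity>d. lo d + (up d + di d))" .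
  have comb: "lo d + (up d + di d) = (-1) ^ Suc d * p ^ (Suc d * Suc d) *
      (p ^ Suc d / (1 + p ^ Suc d)\<^sup>2 - real (Suc d) * kap 1 (2 * int (Suc d)))" for d
  proof -
    define x where "x = p ^ Suc d"
    have x: "1 + x \<noteq> 0" "1 - x \<noteq> 0" using p_Suc_bounds[of d] by (auto simp: x_def)
    have "2 * int (Suc d) = int (Suc d * 2)" by simp
    then have "p powi (2 * int (Suc d)) = x\<^sup>2" by (simp only: power_int_of_nat power_mult x_def)
    then have k: "kap 1 (2 * int (Suc d)) = (1 + x\<^sup>2) / (1 - x\<^sup>2)" by (simp add: kap_def)
    \<comment> \<open>The cotangent of the doubled argument is assembled from the diagonal (1),
      \<open>up\<close> and the first term of \<open>lo\<close>.\<close>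
    have "1 + x / (1 - x) - x / (1 + x) = (1 + x\<^sup>2) / (1 - x\<^sup>2)"
    proof -
      have "1 + x / (1 - x) = 1 / (1 - x)" using x by (simp add: field_simps)
      also have "1 / (1 - x) - x / (1 + x) = (1 * (1 + x) - x * (1 - x)) / ((1 - x) * (1 + x))"
        by (rule diff_frac_eq[OF x(2,1)])
      finally show ?thesis by (simp add: power2_eq_square algebra_simps)
    qed
    then have k': "kap 1 (2 * int (Suc d)) = 1 + x / (1 - x) - x / (1 + x)" using k by simp
    have "(- 1) * c * Q * (r * X2 + X3) + (c * r * Q * X1 + c * r * Q) = (- 1) * c * Q * (X3 - r * (1 + X1 - X2))"
      for c Q r X1 X2 X3 :: real by (simp add: algebra_simps)
    then show ?thesis unfolding k' lo_def up_def di_def x_def[symmetric] power_Suc[of "-1" d] by blast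
  qed
  have s: "(\<lambda>d. lo d + (up d + di d)) summable_on UNIV"
    by (intro summable_on_add Ls(1) Us(1) Ds)
  have "(\<lambda>d. lo d + (up d + di d)) sums (\<Sum>\<^sub>\<infinity>d. lo d + (up d + di d))"
    by (rule has_sum_imp_sums[OF has_sum_infsum[OF s]])
  moreover have "(\<Sum>\<^sub>\<infinity>d. lo d + (up d + di d)) = (\<Sum>d. p ^ Suc d / (1 + p ^ Suc d)\<^sup>2)"
    unfolding eq[symmetric] total[symmetric] by (rule infsum_nat_eq_suminf[OF total_s])
  ultimately show ?thesis unfolding comb by (simp only:)
qed

text \<open>For \<open>n = 1\<close> every \<open>M\<close> contributes, and the terms
  \<open>M * kap 1 (2 * M)\<close> do not have the form of those in \<open>L 0\<close>.
  \<open>divisor_split\<close> trades them, together with the sum of \<open>sech2\<close> from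
  \<open>M = 0\<close>, for terms with a squared denominator.\<close>

theorem X_minus_plus: "X (-1) 1 = Psi 0"
proof -
  let ?u = "\<Sum>\<^sub>\<infinity>s. 1 powi s * sech2 s"
  define g where "g M = (if M = 0 then ?u else th M * (kap 1 (2 * M) * (4 * real_of_int M)))" for M
  have g: "th M * (1 + Z (-1) 1 M) = g M" for M by (simp add: Z_minus g_def th_def)
  have gs: "g summable_on UNIV"
  proof -
    have "(\<lambda>M. th M + (\<Sum>\<^sub>\<infinity>s\<in>-{0}. h (-1) 1 (s, M))) summable_on UNIV"
      by (intro summable_on_add th_summable h_sum_symmetric(2)) auto
    moreover have "th M + (\<Sum>\<^sub>\<infinity>s\<in>-{0}. h (-1) 1 (s, M)) = th M * (1 + Z (-1) 1 M)" for M
    proof -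
      have "(\<Sum>\<^sub>\<infinity>s\<in>-{0}. h (-1) 1 (s, M)) = (\<Sum>\<^sub>\<infinity>s\<in>-{0}. th M * (1 powi s * (1 + kap (-1) s * t (2 * M - s))))"
        by (intro infsum_cong) (simp add: h_def)
      also have "\<dots> = th M * Z (-1) 1 M" unfolding Z_def by (rule infsum_cmult_right')
      finally show ?thesis by (simp add: algebra_simps)
    qed
    ultimately show ?thesis by (simp add: g)
  qed
  have "theta * X (-1) 1 = (\<Sum>\<^sub>\<infinity>M. g M)" by (subst theta_X) (auto simp: g)
  also have "\<dots> = g 0 + 2 * (\<Sum>r. g (int (Suc r)))"
  proof (rule infsum_int_even(1)[OF gs])
    show "g (- k) = g k" for k
      using kap_minus[of 1 "2 * k"] by (simp add: g_def)
  qed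
  also have "g 0 = 1 + 2 * (\<Sum>r. sech2 (int (Suc r)))"
    using infsum_int_even(1)[OF sech2_summable sech2_minus] by (simp add: g_def)
  also have "(\<lambda>r. sech2 (int (Suc r))) = (\<lambda>r. 4 * (p ^ Suc r / (1 + p ^ Suc r)\<^sup>2))"
    unfolding sech2_def power_int_of_nat by simp
  also have "(\<Sum>r. 4 * (p ^ Suc r / (1 + p ^ Suc r)\<^sup>2)) = 4 * (\<Sum>r. p ^ Suc r / (1 + p ^ Suc r)\<^sup>2)"
  proof (rule suminf_mult)
    have "summable (\<lambda>r. sech2 (int (Suc r)) / 4)"
      by (intro summable_divide infsum_int_even(2)[OF sech2_summable sech2_minus])
    then show "summable (\<lambda>r. p ^ Suc r / (1 + p ^ Suc r)\<^sup>2)"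
      unfolding sech2_def power_int_of_nat by simp
  qed
  finally have e1: "theta * X (-1) 1 = 1 + 8 * (\<Sum>r. p ^ Suc r / (1 + p ^ Suc r)\<^sup>2) + 2 * (\<Sum>r. g (int (Suc r)))"
    by simp
  let ?c = "\<lambda>d. (-1) ^ Suc d * p ^ (Suc d * Suc d)"
  have "(\<lambda>d. 8 * (?c d * (p ^ Suc d / (1 + p ^ Suc d)\<^sup>2 - real (Suc d) * kap 1 (2 * int (Suc d)))) + 2 * g (int (Suc d)))
      sums (8 * (\<Sum>r. p ^ Suc r / (1 + p ^ Suc r)\<^sup>2) + 2 * (\<Sum>r. g (int (Suc r))))"
    by (intro sums_add sums_mult divisor_split summable_sums infsum_int_even(2)[OF gs])
      (use kap_minus[of 1 "2 * _"] in \<open>simp add: g_def\<close>)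
  moreover have "8 * (?c d * (p ^ Suc d / (1 + p ^ Suc d)\<^sup>2 - real (Suc d) * kap 1 (2 * int (Suc d)))) + 2 * g (int (Suc d)) =
      8 * (((-1) ^ Suc d * p ^ (Suc (Suc d) choose 2) * (1 / (1 + p ^ Suc d)\<^sup>2)) * w (Suc d) 0)" for d
  proof -
    have "Suc d * Suc d + Suc d = (Suc (Suc d) choose 2) + (Suc (Suc d) choose 2)"
      using choose2_double[of "Suc d"] by simp
    then have pw: "p ^ (Suc d * Suc d) * p ^ Suc d = p ^ (Suc (Suc d) choose 2) * p ^ (Suc (Suc d) choose 2)"
      by (simp only: power_add[symmetric])
    have gd: "g (int (Suc d)) = ?c d * (kap 1 (2 * int (Suc d)) * (4 * real (Suc d)))"
      unfolding th_Suc_nat[symmetric] by (simp add: g_def)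
    have "8 * (?c d * (p ^ Suc d / (1 + p ^ Suc d)\<^sup>2 - real (Suc d) * kap 1 (2 * int (Suc d)))) + 2 * g (int (Suc d))
      = 8 * ((-1) ^ Suc d * ((p ^ (Suc d * Suc d) * p ^ Suc d) * (1 / (1 + p ^ Suc d)\<^sup>2)))"
      unfolding gd by (simp add: algebra_simps del: power_Suc mult_Suc mult_Suc_right of_nat_Suc)
    then show ?thesis unfolding pw w_0 by (simp only: ac_simps)
  qed
  ultimately have "8 * (\<Sum>r. p ^ Suc r / (1 + p ^ Suc r)\<^sup>2) + 2 * (\<Sum>r. g (int (Suc r))) =
      (\<Sum>d. 8 * (((-1) ^ Suc d * p ^ (Suc (Suc d) choose 2) * (1 / (1 + p ^ Suc d)\<^sup>2)) * w (Suc d) 0))"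
    by (simp only: sums_iff)
  also have "\<dots> = 8 * (\<Sum>d. ((-1) ^ Suc d * p ^ (Suc (Suc d) choose 2) * (1 / (1 + p ^ Suc d)\<^sup>2)) * w (Suc d) 0)"
    by (intro suminf_mult summable_w_series L_coeff) auto
  finally have "theta * X (-1) 1 = L 0" unfolding e1 L_alt by (simp only: add.assoc)
  also have "\<dots> = theta * Psi 0" using L_eq[of 0] theta_eq_U0 by simp
  finally show ?thesis using theta_pos by simp
qed

end

section \<open>Comparison of coefficients\<close>

lemma has_sum_fibres:
  fixes f :: "'a \<Rightarrow> real" and g :: "'a \<Rightarrow> nat"
  assumes sm: "(\<lambda>a. f a * q ^ g a) summable_on A" and fin: "\<And>m. finite {a \<in> A. g a = m}"
  shows "((\<lambda>m. (\<Sum>a | a \<in> A \<and> g a = m. f a) * q ^ m) has_sum (\<Sum>\<^sub>\<infinity>a\<in>A. f a * q ^ g a)) UNIV"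
proof -
  have "((\<lambda>(m, a). f a * q ^ g a) has_sum (\<Sum>\<^sub>\<infinity>a\<in>A. f a * q ^ g a)) (Sigma UNIV (\<lambda>m. {a \<in> A. g a = m}))"
    by (rule has_sum_reindex_bij_witness[of A snd "\<lambda>a. (g a, a)", THEN iffD1, OF _ _ _ _ _ refl])
      (auto intro: has_sum_infsum sm)
  then show ?thesis
  proof (rule has_sum_SigmaD)
    fix m :: nat
    have "((\<lambda>a. f a * q ^ g a) has_sum (\<Sum>a | a \<in> A \<and> g a = m. f a * q ^ g a)) {a \<in> A. g a = m}"
      by (rule has_sum_finite[OF fin])
    also have "(\<Sum>a | a \<in> A \<and> g a = m. f a * q ^ g a) = (\<Sum>a | a \<in> A \<and> g a = m. f a) * q ^ m"
      by (simp add: sum_distrib_right)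
    finally show "((\<lambda>y. case (m, y) of (m, a) \<Rightarrow> f a * q ^ g a) has_sum (\<Sum>a | a \<in> A \<and> g a = m. f a) * q ^ m) {a \<in> A. g a = m}"
      by simp
  qed
qed

text \<open>The values are given for positive \<open>q\<close> only. By induction the lower terms
  cancel; after division by \<open>q ^ m\<close> the one-sided limit at 0 isolates the coefficient
  of index \<open>m\<close>.\<close>

lemma power_series_eq_imp_coeff_eq:
  fixes a b :: "nat \<Rightarrow> real"
  assumes "0 < r"
    and a: "\<And>q. 0 < q \<Longrightarrow> q \<le> r \<Longrightarrow> ((\<lambda>m. a m * q ^ m) has_sum F q) UNIV"
    and b: "\<And>q. 0 < q \<Longrightarrow> q \<le> r \<Longrightarrow> ((\<lambda>m. b m * q ^ m) has_sum F q) UNIV"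
  shows "a m = b m"
proof (induction m rule: less_induct)
  case (less m)
  define d where "d k = a (k + m) - b (k + m)" for k
  have z: "(\<lambda>k. d k * q ^ k) sums 0" if q: "0 < q" "q \<le> r" for q
  proof -
    have "(\<lambda>k. a k * q ^ k - b k * q ^ k) sums (F q - F q)"
      by (intro sums_diff has_sum_imp_sums a b q)
    then have "(\<lambda>k. (a k - b k) * q ^ k) sums 0" by (simp add: left_diff_distrib)
    then have "(\<lambda>k. (a (k + m) - b (k + m)) * q ^ (k + m)) sums (0 - (\<Sum>k<m. (a k - b k) * q ^ k))"
      by (rule sums_split_initial_segment)
    then have "(\<lambda>k. inverse (q ^ m) * ((a (k + m) - b (k + m)) * q ^ (k + m))) sums (inverse (q ^ m) * 0)"
      using less by (intro sums_mult) simp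
    moreover have "inverse (q ^ m) * ((a (k + m) - b (k + m)) * q ^ (k + m)) = d k * q ^ k" for k
      using q by (simp add: d_def power_add)
    ultimately show ?thesis by simp
  qed
  have "(\<lambda>x. \<Sum>k. d k * x ^ k) \<midarrow>0\<rightarrow> d 0"
  proof (rule powser_limit_0_strong[OF \<open>0 < r\<close>])
    fix x :: real assume "x \<noteq> 0" "norm x < r"
    then have "summable (\<lambda>k. d k * x ^ k)"
      using powser_inside[of d r x] z[of r] \<open>0 < r\<close> by (auto simp: sums_iff)
    then show "(\<lambda>k. d k * x ^ k) sums (\<Sum>k. d k * x ^ k)" by (rule summable_sums)
  qed
  then have "((\<lambda>x. \<Sum>k. d k * x ^ k) \<longlongrightarrow> d 0) (at_right 0)" by (simp add: filterlim_at_split)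
  moreover have "eventually (\<lambda>x. (\<Sum>k. d k * x ^ k) = 0) (at_right 0)"
    using eventually_at_right_real[OF \<open>0 < r\<close>] by eventually_elim (use z in \<open>auto simp: sums_iff\<close>)
  ultimately have "((\<lambda>x. 0) \<longlongrightarrow> d 0) (at_right (0::real))" by (rule Lim_transform_eventually)
  then have "d 0 = 0" by (simp add: tendsto_const_iff)
  then show ?case by (simp add: d_def)
qed

section \<open>Coefficients as signed sums over triples and divisor pairs\<close>

definition Div :: "nat \<Rightarrow> (nat \<times> nat) set" where
  "Div m = {(x, y). x \<in> {1..} \<and> y \<in> {1..} \<and> x * y = m}"

definition Tri :: "nat \<Rightarrow> (nat \<times> nat \<times> nat) set" where
  "Tri m = {(x, y, z). x \<in> {1..} \<and> y \<in> {1..} \<and> z \<in> {1..} \<and> x * y + y * z + z * x = m}"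

lemma finite_Div: "finite (Div m)"
proof (rule finite_subset)
  show "Div m \<subseteq> {..m} \<times> {..m}" by (auto simp: Div_def)
qed simp

lemma Tri_le: "(x, y, z) \<in> Tri m \<Longrightarrow> x \<le> m \<and> y \<le> m \<and> z \<le> m"
proof -
  assume "(x, y, z) \<in> Tri m"
  then have m: "x * y + y * z + z * x = m" and pos: "1 \<le> x" "1 \<le> y" "1 \<le> z" by (auto simp: Tri_def)
  have "x \<le> x * y" "y \<le> y * z" "z \<le> z * x" using pos by auto
  with m show ?thesis by linarith
qed

lemma finite_Tri: "finite (Tri m)"
proof (rule finite_subset)
  show "Tri m \<subseteq> {..m} \<times> {..m} \<times> {..m}" using Tri_le by auto
qed simp

text \<open>This sums \<open>n^(x + y) e^z\<close> over nonnegative triples, where a triple with one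
  zero entry counts one half. The case \<open>z = 0\<close> gives the second sum;
  \<open>x = 0\<close> and \<open>y = 0\<close> contribute equally and combine to the third with
  weight 1.\<close>

definition cX :: "real \<Rightarrow> real \<Rightarrow> nat \<Rightarrow> real" where
  "cX e n m = (\<Sum>(x, y, z)\<in>Tri m. n ^ (x + y) * e ^ z) + (1/2) * (\<Sum>(x, y)\<in>Div m. n ^ (x + y)) +
    (\<Sum>(x, z)\<in>Div m. n ^ x * e ^ z)"

context base
begin

abbreviation (input) N :: "nat set" where "N \<equiv> {1..}"

lemma p_power_summable: "(\<lambda>k::nat. p ^ k) summable_on B"
proof (rule summable_on_subset_banach)
  show "(\<lambda>k::nat. p ^ k) summable_on UNIV"
    using p_pos by (intro summable_nonneg_imp_summable_on summable_geometric) auto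
qed simp

lemma Div_summable:
  assumes e: "\<bar>e\<bar> = 1" and n: "\<bar>n\<bar> = 1"
  shows "(\<lambda>(x, y). (n ^ x * e ^ y) * p ^ (x * y)) summable_on N \<times> N"
proof (rule summable_on_bound)
  show "(\<lambda>v. (1 / p) * (case v of (x, y) \<Rightarrow> p ^ x * p ^ y)) summable_on N \<times> N"
    by (intro summable_on_cmult_right summable_on_Times p_power_summable)
  fix v assume "v \<in> N \<times> N"
  then obtain x y where v: "v = (Suc x, Suc y)"
    by (auto simp: le_iff_add)
  have "p ^ (Suc x * Suc y) \<le> p ^ Suc (x + y)" using p_pos p_le by (intro power_decreasing) auto
  also have "\<dots> = (1 / p) * (p ^ Suc x * p ^ Suc y)" by (simp add: power_add)
  finally show "\<bar>case v of (x, y) \<Rightarrow> (n ^ x * e ^ y) * p ^ (x * y)\<bar> \<le> (1 / p) * (case v of (x, y) \<Rightarrow> p ^ x * p ^ y)"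
    unfolding v using e n by (simp add: abs_mult power_abs del: power_Suc mult_Suc mult_Suc_right)
qed

lemma Tri_summable:
  assumes e: "\<bar>e\<bar> = 1" and n: "\<bar>n\<bar> = 1"
  shows "(\<lambda>(x, y, z). (n ^ (x + y) * e ^ z) * p ^ (x * y + y * z + z * x)) summable_on N \<times> N \<times> N"
proof (rule summable_on_bound)
  have "(\<lambda>(x, v). p ^ x * (case v of (y, z) \<Rightarrow> p ^ y * p ^ z)) summable_on N \<times> N \<times> N"
    by (intro summable_on_Times p_power_summable)
  then show "(\<lambda>(x, y, z). p ^ x * (p ^ y * p ^ z)) summable_on N \<times> N \<times> N"
    by (simp add: case_prod_unfold)
  fix v assume "v \<in> N \<times> N \<times> N"
  then obtain x y z where v: "v = (x, y, z)" and pos: "1 \<le> x" "1 \<le> y" "1 \<le> z" by auto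
  have "x \<le> x * y" "y \<le> y * z" "z \<le> z * x" using pos by auto
  then have "x + y + z \<le> x * y + y * z + z * x" by linarith
  then have "p ^ (x * y + y * z + z * x) \<le> p ^ (x + y + z)" using p_pos p_le by (intro power_decreasing) auto
  then show "\<bar>case v of (x, y, z) \<Rightarrow> (n ^ (x + y) * e ^ z) * p ^ (x * y + y * z + z * x)\<bar> \<le>
      (case v of (x, y, z) \<Rightarrow> p ^ x * (p ^ y * p ^ z))"
    unfolding v using e n by (simp add: abs_mult power_abs power_add)
qed

lemma kap_expand:
  assumes e: "\<bar>e\<bar> = 1" and s: "1 \<le> s"
  shows "((\<lambda>z. e ^ z * p ^ (s * z)) has_sum ((kap e (int s) - 1) / 2)) N"
proof -
  define u where "u = e * p ^ s"
  have "\<bar>u\<bar> = p ^ s" using e by (simp add: u_def abs_mult)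
  moreover have "p ^ s \<le> p ^ 1" using s p_pos p_le by (intro power_decreasing) auto
  ultimately have u: "\<bar>u\<bar> < 1" using p_le by simp
  have "(\<lambda>z. \<bar>u ^ z\<bar>) summable_on UNIV"
    using u by (intro summable_nonneg_imp_summable_on) (auto simp: power_abs intro!: summable_geometric)
  then have "(\<lambda>z. u ^ z) summable_on UNIV" by (simp add: abs_summable_summable)
  then have sm: "(\<lambda>z. u * u ^ z) summable_on UNIV" by (rule summable_on_cmult_right)
  have "(\<lambda>z. u * u ^ z) sums (u * (1 / (1 - u)))" using u by (intro sums_mult geometric_sums) simp
  from infsum_sums[OF sm this] sm have "((\<lambda>z. u * u ^ z) has_sum (u / (1 - u))) UNIV"
    by (simp add: has_sum_iff)
  moreover have uz: "e ^ Suc z * p ^ (s * Suc z) = u * u ^ z" for z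
    unfolding u_def power_Suc[of "e * p ^ s" z, symmetric] by (simp only: power_mult_distrib power_mult)
  moreover have "((\<lambda>z. u * u ^ z) has_sum (u / (1 - u))) UNIV \<longleftrightarrow>
      ((\<lambda>z. e ^ z * p ^ (s * z)) has_sum (u / (1 - u))) N"
    by (rule has_sum_reindex_bij_witness[of _ "\<lambda>z. z - 1" Suc])
      (auto simp: uz simp del: power_Suc mult_Suc_right)
  ultimately have "((\<lambda>z. e ^ z * p ^ (s * z)) has_sum (u / (1 - u))) N" by blast
  moreover have "(kap e (int s) - 1) / 2 = u / (1 - u)"
  proof -
    have "1 - u \<noteq> 0" using u by auto
    then have "(1 + u) / (1 - u) = 1 + 2 * (u / (1 - u))" by (simp add: field_simps)
    then have "kap e (int s) = 1 + 2 * (u / (1 - u))" by (simp add: kap_def u_def)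
    moreover have "x = 1 + 2 * y \<Longrightarrow> (x - 1) / 2 = y" for x y :: real by simp
    ultimately show ?thesis by blast
  qed
  ultimately show ?thesis by (simp only:)
qed

text \<open>With \<open>S s = 1 + I s\<close> and \<open>kap e s = 1 + 2 * k s\<close> the bracket
  \<open>kap e s * S s - 1\<close> is \<open>I s + 2 * k s + 2 * (I s * k s)\<close>; the three
  parts yield \<open>B1\<close>, \<open>B2\<close> and \<open>B3\<close>, with
  \<open>s = x + y\<close> in the first and last.\<close>

lemma X_eq_sums:
  assumes e: "\<bar>e\<bar> = 1" and n: "\<bar>n\<bar> = 1"
  defines "B1 \<equiv> (\<Sum>\<^sub>\<infinity>(x, y)\<in>N \<times> N. (n ^ x * n ^ y) * p ^ (x * y))"
    and "B2 \<equiv> (\<Sum>\<^sub>\<infinity>(x, y)\<in>N \<times> N. (n ^ x * e ^ y) * p ^ (x * y))"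
    and "B3 \<equiv> (\<Sum>\<^sub>\<infinity>(x, y, z)\<in>N \<times> N \<times> N. (n ^ (x + y) * e ^ z) * p ^ (x * y + y * z + z * x))"
  shows "X e n = 1 - 4 * (B3 + (1/2) * B1 + B2)"
proof -
  define I where "I s = (\<Sum>x = 1..<s. p ^ (x * (s - x)))" for s :: nat
  define k where "k s = (kap e (int s) - 1) / 2" for s :: nat
  have h1: "((\<lambda>s. n ^ s * I s) has_sum B1) N"
  proof (rule has_sum_SigmaD[where f = "\<lambda>(s, x). n ^ s * p ^ (x * (s - x))" and B = "\<lambda>s. {1..<s}"])
    show "((\<lambda>(s, x). n ^ s * p ^ (x * (s - x))) has_sum B1) (SIGMA s:N. {1..<s})"
      unfolding B1_def
      by (rule has_sum_reindex_bij_witness[of "N \<times> N" "\<lambda>(s, x). (x, s - x)" "\<lambda>(x, y). (x + y, x)", THEN iffD1, OF _ _ _ _ _ refl has_sum_infsum[OF Div_summable[OF n n]]])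
        (auto simp: power_add)
    show "((\<lambda>y. case (s, y) of (s, x) \<Rightarrow> n ^ s * p ^ (x * (s - x))) has_sum n ^ s * I s) {1..<s}" for s
      by (simp add: I_def sum_distrib_left)
  qed
  have h2: "((\<lambda>s. n ^ s * k s) has_sum B2) N"
  proof (rule has_sum_SigmaD[where f = "\<lambda>(x, y). (n ^ x * e ^ y) * p ^ (x * y)" and B = "\<lambda>s. N"])
    show "((\<lambda>(x, y). (n ^ x * e ^ y) * p ^ (x * y)) has_sum B2) (N \<times> N)"
      unfolding B2_def by (rule has_sum_infsum[OF Div_summable[OF e n]])
    show "((\<lambda>y. case (s, y) of (x, y) \<Rightarrow> (n ^ x * e ^ y) * p ^ (x * y)) has_sum n ^ s * k s) N" if "s \<in> N" for s
      using has_sum_cmult_right[OF kap_expand[OF e, of s], of "n ^ s"] that by (simp add: k_def mult.assoc)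
  qed
  have expo: "n ^ (x + y) * (p ^ (x * y) * (e ^ z * p ^ ((x + y) * z))) = n ^ (x + y) * e ^ z * p ^ (x * y + y * z + z * x)" for x y z
  proof -
    have "p ^ (x * y) * p ^ ((x + y) * z) = p ^ (x * y + y * z + z * x)"
      unfolding power_add[symmetric] by (rule arg_cong[where f = "power p"]) (simp add: algebra_simps)
    then show ?thesis by simp
  qed
  have h3: "((\<lambda>s. n ^ s * (I s * k s)) has_sum B3) N"
  proof (rule has_sum_SigmaD[where f = "\<lambda>(s, x, z). n ^ s * (p ^ (x * (s - x)) * (e ^ z * p ^ (s * z)))" and B = "\<lambda>s. {1..<s} \<times> N"])
    show "((\<lambda>(s, x, z). n ^ s * (p ^ (x * (s - x)) * (e ^ z * p ^ (s * z)))) has_sum B3) (SIGMA s:N. {1..<s} \<times> N)"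
      unfolding B3_def
      by (rule has_sum_reindex_bij_witness[of "N \<times> N \<times> N" "\<lambda>(s, x, z). (x, s - x, z)" "\<lambda>(x, y, z). (x + y, x, z)", THEN iffD1, OF _ _ _ _ _ refl has_sum_infsum[OF Tri_summable[OF e n]]])
        (auto simp: expo)
    fix s assume s: "s \<in> N"
    have "((\<lambda>(x, z). p ^ (x * (s - x)) * (e ^ z * p ^ (s * z))) has_sum (I s * k s)) ({1..<s} \<times> N)"
    proof (rule has_sum_SigmaI)
      show "((\<lambda>z. case (x, z) of (x, z) \<Rightarrow> p ^ (x * (s - x)) * (e ^ z * p ^ (s * z))) has_sum p ^ (x * (s - x)) * k s) N" for x
        using has_sum_cmult_right[OF kap_expand[OF e, of s]] s by (simp add: k_def)
      show "((\<lambda>x. p ^ (x * (s - x)) * k s) has_sum I s * k s) {1..<s}"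
        by (simp add: I_def sum_distrib_right)
      have "(\<lambda>z. e ^ z * p ^ (s * z)) summable_on N"
        using kap_expand[OF e, of s] s by (auto simp: summable_on_def)
      then show "(\<lambda>(x, z). p ^ (x * (s - x)) * (e ^ z * p ^ (s * z))) summable_on {1..<s} \<times> N"
        by (intro summable_on_Times) auto
    qed
    from has_sum_cmult_right[OF this, of "n ^ s"]
    show "((\<lambda>y. case (s, y) of (s, x, z) \<Rightarrow> n ^ s * (p ^ (x * (s - x)) * (e ^ z * p ^ (s * z)))) has_sum n ^ s * (I s * k s)) ({1..<s} \<times> N)"
      by (simp add: case_prod_unfold)
  qed
  have "((\<lambda>s. n ^ s * I s + 2 * (n ^ s * k s) + 2 * (n ^ s * (I s * k s))) has_sum (B1 + 2 * B2 + 2 * B3)) N"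
    by (intro has_sum_add has_sum_cmult_right h1 h2 h3)
  moreover have "n ^ s * I s + 2 * (n ^ s * k s) + 2 * (n ^ s * (I s * k s)) = n powi (int s) * (kap e (int s) * S (nat (int s)) - 1)" for s
  proof -
    have "S s = 1 + I s" unfolding S_def I_def ..
    then show ?thesis by (simp add: k_def field_simps)
  qed
  ultimately have "((\<lambda>s. n powi (int s) * (kap e (int s) * S (nat (int s)) - 1)) has_sum (B1 + 2 * B2 + 2 * B3)) N" by (simp only:)
  also have "?this \<longleftrightarrow> ((\<lambda>s. n powi s * (kap e s * S (nat s) - 1)) has_sum (B1 + 2 * B2 + 2 * B3)) {1..}"
    by (rule has_sum_reindex_bij_witness[of _ nat int]) auto
  finally have "(\<Sum>\<^sub>\<infinity>s\<in>{1..}. n powi s * (kap e s * S (nat s) - 1)) = B1 + 2 * B2 + 2 * B3"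
    by (rule infsumI)
  then show ?thesis by (simp add: X_def)
qed

lemma X_power_series:
  assumes e: "\<bar>e\<bar> = 1" and n: "\<bar>n\<bar> = 1"
  shows "((\<lambda>m. (of_bool (m = 0) - 4 * cX e n m) * p ^ m) has_sum X e n) UNIV"
proof -
  let ?B1 = "\<Sum>\<^sub>\<infinity>(x, y)\<in>N \<times> N. (n ^ x * n ^ y) * p ^ (x * y)"
  let ?B2 = "\<Sum>\<^sub>\<infinity>(x, y)\<in>N \<times> N. (n ^ x * e ^ y) * p ^ (x * y)"
  let ?B3 = "\<Sum>\<^sub>\<infinity>(x, y, z)\<in>N \<times> N \<times> N. (n ^ (x + y) * e ^ z) * p ^ (x * y + y * z + z * x)"
  have D: "((\<lambda>m. (\<Sum>(x, y)\<in>Div m. n ^ x * f ^ y) * p ^ m) has_sum (\<Sum>\<^sub>\<infinity>(x, y)\<in>N \<times> N. (n ^ x * f ^ y) * p ^ (x * y))) UNIV"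
    if f: "\<bar>f\<bar> = 1" for f
  proof -
    have d: "{a. a \<in> N \<times> N \<and> (case a of (x, y) \<Rightarrow> x * y) = m} = Div m" for m
      by (auto simp: Div_def)
    have s: "(\<lambda>a. (case a of (x, y) \<Rightarrow> n ^ x * f ^ y) * p ^ (case a of (x, y) \<Rightarrow> x * y)) =
        (\<lambda>(x, y). (n ^ x * f ^ y) * p ^ (x * y))" by auto
    show ?thesis
      using has_sum_fibres[of "\<lambda>(x, y). n ^ x * f ^ y" p "\<lambda>(x, y). x * y" "N \<times> N"] Div_summable[OF f n] finite_Div
      unfolding d s by blast
  qed
  have T: "((\<lambda>m. (\<Sum>(x, y, z)\<in>Tri m. n ^ (x + y) * e ^ z) * p ^ m) has_sum ?B3) UNIV"
  proof -
    have d: "{a. a \<in> N \<times> N \<times> N \<and> (case a of (x, y, z) \<Rightarrow> x * y + y * z + z * x) = m} = Tri m" for m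
      by (auto simp: Tri_def)
    have s: "(\<lambda>a. (case a of (x, y, z) \<Rightarrow> n ^ (x + y) * e ^ z) * p ^ (case a of (x, y, z) \<Rightarrow> x * y + y * z + z * x)) =
        (\<lambda>(x, y, z). (n ^ (x + y) * e ^ z) * p ^ (x * y + y * z + z * x))" by auto
    show ?thesis
      using has_sum_fibres[of "\<lambda>(x, y, z). n ^ (x + y) * e ^ z" p "\<lambda>(x, y, z). x * y + y * z + z * x" "N \<times> N \<times> N"]
        Tri_summable[OF e n] finite_Tri
      unfolding d s by blast
  qed
  have one: "((\<lambda>m. of_bool (m = 0) * p ^ m) has_sum 1) UNIV"
    by (rule has_sum_finite_neutralI[of "{0}"]) auto
  have "((\<lambda>m. of_bool (m = 0) * p ^ m + (-4) * ((\<Sum>(x, y, z)\<in>Tri m. n ^ (x + y) * e ^ z) * p ^ m +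
      (1/2) * ((\<Sum>(x, y)\<in>Div m. n ^ x * n ^ y) * p ^ m) + (\<Sum>(x, y)\<in>Div m. n ^ x * e ^ y) * p ^ m))
      has_sum (1 + (-4) * (?B3 + (1/2) * ?B1 + ?B2))) UNIV"
    by (intro has_sum_add has_sum_cmult_right one D T e n)
  moreover have "1 + (-4) * (?B3 + (1/2) * ?B1 + ?B2) = X e n" using X_eq_sums[OF e n] by simp
  moreover have "of_bool (m = 0) * p ^ m + (-4) * ((\<Sum>(x, y, z)\<in>Tri m. n ^ (x + y) * e ^ z) * p ^ m +
      (1/2) * ((\<Sum>(x, y)\<in>Div m. n ^ x * n ^ y) * p ^ m) + (\<Sum>(x, y)\<in>Div m. n ^ x * e ^ y) * p ^ m) =
      (of_bool (m = 0) - 4 * cX e n m) * p ^ m" for m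
    unfolding cX_def power_add by (simp add: algebra_simps)
  ultimately show ?thesis by (simp only:)
qed

end

section \<open>Representations as a sum of three squares\<close>

definition r3 :: "nat \<Rightarrow> nat" where
  "r3 m = card {(a :: int, b :: int, c :: int). a\<^sup>2 + b\<^sup>2 + c\<^sup>2 = int m}"

lemma square_le_imp_bounded: "(a::int)\<^sup>2 \<le> int m \<Longrightarrow> a \<in> {- int m..int m}"
proof -
  assume *: "a\<^sup>2 \<le> int m"
  have "\<bar>a\<bar> * 1 \<le> \<bar>a\<bar> * \<bar>a\<bar>" by (cases "a = 0") (simp, intro mult_left_mono, auto)
  then have "\<bar>a\<bar> \<le> a\<^sup>2" by (simp add: power2_eq_square)
  with * show ?thesis by auto
qed

lemma finite_three_squares: "finite {(a :: int, b :: int, c :: int). a\<^sup>2 + b\<^sup>2 + c\<^sup>2 = int m}"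
proof (rule finite_subset)
  show "{(a :: int, b :: int, c :: int). a\<^sup>2 + b\<^sup>2 + c\<^sup>2 = int m} \<subseteq> {- int m..int m} \<times> {- int m..int m} \<times> {- int m..int m}"
  proof (rule subsetI, simp only: mem_Collect_eq split_paired_all prod.case mem_Times_iff fst_conv snd_conv)
    fix a b c :: int assume *: "a\<^sup>2 + b\<^sup>2 + c\<^sup>2 = int m"
    have "0 \<le> a\<^sup>2" "0 \<le> b\<^sup>2" "0 \<le> c\<^sup>2" by simp_all
    with * have "a\<^sup>2 \<le> int m" "b\<^sup>2 \<le> int m" "c\<^sup>2 \<le> int m" by linarith+
    then show "a \<in> {- int m..int m} \<and> b \<in> {- int m..int m} \<and> c \<in> {- int m..int m}"
      using square_le_imp_bounded by blast
  qed
qed simp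

context base
begin

lemma theta_cube_power_series: "((\<lambda>m. ((-1) ^ m * real (r3 m)) * p ^ m) has_sum theta ^ 3) UNIV"
proof -
  have ths: "th summable_on UNIV" by (rule th_summable)
  have s2: "(\<lambda>(b, c). th b * th c) summable_on UNIV \<times> UNIV" by (rule summable_on_Times[OF ths ths])
  have s3: "(\<lambda>(a, v). th a * (case v of (b, c) \<Rightarrow> th b * th c)) summable_on UNIV \<times> UNIV \<times> UNIV"
    by (rule summable_on_Times[OF ths s2])
  have "(\<Sum>\<^sub>\<infinity>(b, c)\<in>UNIV \<times> UNIV. th b * th c) = theta * theta"
    by (subst infsum_Sigma'_banach[OF s2, symmetric]) (simp add: infsum_cmult_right' infsum_cmult_left' theta_def)
  then have "(\<Sum>\<^sub>\<infinity>(a, v)\<in>UNIV \<times> UNIV \<times> UNIV. th a * (case v of (b, c) \<Rightarrow> th b * th c)) = theta * (theta * theta)"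
    by (subst infsum_Sigma'_banach[OF s3, symmetric]) (simp add: infsum_cmult_right' infsum_cmult_left' theta_def)
  moreover have "(\<lambda>(a, v). th a * (case v of (b, c) \<Rightarrow> th b * th c)) =
      (\<lambda>v. (case v of (a, b, c) \<Rightarrow> (-1) powi (a + b + c)) * p ^ (case v of (a, b, c) \<Rightarrow> nat (a\<^sup>2 + b\<^sup>2 + c\<^sup>2)))"
  proof (rule ext, clarify)
    fix a b c :: int
    have "p ^ nat (a\<^sup>2 + b\<^sup>2 + c\<^sup>2) = p powi (a\<^sup>2 + b\<^sup>2 + c\<^sup>2)" by (simp add: power_int_nonneg_exp)
    also have "\<dots> = p powi (a * a) * p powi (b * b) * p powi (c * c)"
      by (simp add: power_int_add power2_eq_square)
    finally show "th a * (th b * th c) = (-1) powi (a + b + c) * p ^ nat (a\<^sup>2 + b\<^sup>2 + c\<^sup>2)"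
      by (simp add: th_def power_int_add)
  qed
  ultimately have tot: "(\<Sum>\<^sub>\<infinity>v. (case v of (a, b, c) \<Rightarrow> (-1) powi (a + b + c)) * p ^ (case v of (a, b, c) \<Rightarrow> nat (a\<^sup>2 + b\<^sup>2 + c\<^sup>2))) = theta ^ 3"
    and sm: "(\<lambda>v. (case v of (a, b, c) \<Rightarrow> (-1) powi (a + b + c)) * p ^ (case v of (a, b, c) \<Rightarrow> nat (a\<^sup>2 + b\<^sup>2 + c\<^sup>2))) summable_on UNIV"
    using s3 by (simp_all add: power3_eq_cube)
  have fib: "{v \<in> UNIV. (case v of (a, b, c) \<Rightarrow> nat (a\<^sup>2 + b\<^sup>2 + c\<^sup>2)) = m} = {(a, b, c). a\<^sup>2 + b\<^sup>2 + c\<^sup>2 = int m}" for m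
    by (auto simp: nat_eq_iff) 
  have "(\<Sum>v | v \<in> UNIV \<and> (case v of (a, b, c) \<Rightarrow> nat (a\<^sup>2 + b\<^sup>2 + c\<^sup>2)) = m. (case v of (a, b, c) \<Rightarrow> (-1 :: real) powi (a + b + c))) = (-1) ^ m * real (r3 m)" for m
  proof -
    have "(\<Sum>v | v \<in> UNIV \<and> (case v of (a, b, c) \<Rightarrow> nat (a\<^sup>2 + b\<^sup>2 + c\<^sup>2)) = m. (case v of (a, b, c) \<Rightarrow> (-1 :: real) powi (a + b + c))) =
       (\<Sum>v\<in>{(a, b, c). a\<^sup>2 + b\<^sup>2 + c\<^sup>2 = int m}. (-1) ^ m)"
      unfolding fib
    proof (rule sum.cong[OF refl], clarify)
      fix a b c :: int assume *: "a\<^sup>2 + b\<^sup>2 + c\<^sup>2 = int m"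
      have "even (a\<^sup>2 + b\<^sup>2 + c\<^sup>2) = even (a + b + c)" by simp
      with * have "even (a + b + c) = even m" by simp
      then show "(-1 :: real) powi (a + b + c) = (-1) ^ m"
        by (cases "even m") (auto simp: power_int_minus_left)
    qed
    then show ?thesis by (simp add: r3_def)
  qed
  with has_sum_fibres[OF sm] show ?thesis unfolding tot fib using finite_three_squares by simp
qed

end

theorem r3_eq: "(-1) ^ m * real (r3 m) = of_bool (m = 0) - 4 * cX (-1) (-1) m"
proof (rule power_series_eq_imp_coeff_eq[of "1/4" _ "\<lambda>q. base.theta q ^ 3"])
  fix q :: real assume q: "0 < q" "q \<le> 1/4"
  interpret base q by standard (use q in auto)
  show "((\<lambda>m. (-1) ^ m * real (r3 m) * q ^ m) has_sum theta ^ 3) UNIV"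
    by (rule theta_cube_power_series)
  show "((\<lambda>m. (of_bool (m = 0) - 4 * cX (-1) (-1) m) * q ^ m) has_sum theta ^ 3) UNIV"
    using X_power_series[of "-1" "-1"] by (simp add: X_minus_minus)
qed simp

section \<open>Generating functions of overpartitions\<close>

definition overpartitions :: "(nat \<times> bool) list set" where
  "overpartitions = {ps. is_overpartition ps (sum_list (map fst ps))}"

lemma is_overpartition_iff: "is_overpartition ps n \<longleftrightarrow> ps \<in> overpartitions \<and> sum_list (map fst ps) = n"
  by (auto simp: overpartitions_def is_overpartition_def is_partition_def)

lemma Nil_overpartition [simp]: "[] \<in> overpartitions"
  by (simp add: overpartitions_def is_overpartition_def is_partition_def)

lemma Cons_overpartition:
  "p # ps \<in> overpartitions \<longleftrightarrow> 0 < fst p \<and> (\<forall>r\<in>set ps. fst r \<le> fst p) \<and>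
    (\<forall>r\<in>set ps. fst r = fst p \<longrightarrow> \<not> snd r) \<and> ps \<in> overpartitions"
proof -
  have "(\<forall>i<length (p # ps). snd ((p # ps) ! i) \<longrightarrow> fst ((p # ps) ! i) \<notin> set (map fst (take i (p # ps)))) \<longleftrightarrow>
      (\<forall>i<length ps. snd (ps ! i) \<longrightarrow> fst (ps ! i) \<noteq> fst p \<and> fst (ps ! i) \<notin> set (map fst (take i ps)))"
    by (simp add: All_less_Suc2)
  also have "\<dots> \<longleftrightarrow> (\<forall>r\<in>set ps. fst r = fst p \<longrightarrow> \<not> snd r) \<and>
      (\<forall>i<length ps. snd (ps ! i) \<longrightarrow> fst (ps ! i) \<notin> set (map fst (take i ps)))"
    by (auto simp: all_set_conv_all_nth)
  finally show ?thesis
    by (auto simp: overpartitions_def is_overpartition_def is_partition_def)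
qed

definition parts_le :: "nat \<Rightarrow> (nat \<times> bool) list set" where
  "parts_le k = {ps \<in> overpartitions. \<forall>r\<in>set ps. fst r \<le> k}"

definition with_head :: "nat \<times> bool \<Rightarrow> (nat \<times> bool) list set" where
  "with_head p = {ps \<in> overpartitions. \<exists>qs. ps = p # qs}"

lemma overpartition_pos: "ps \<in> overpartitions \<Longrightarrow> r \<in> set ps \<Longrightarrow> 0 < fst r"
  by (induction ps) (auto simp: Cons_overpartition)

lemma parts_le_0: "parts_le 0 = {[]}"
proof (intro equalityI subsetI)
  fix ps assume "ps \<in> parts_le 0"
  then show "ps \<in> {[]}" by (cases ps) (auto simp: parts_le_def Cons_overpartition)
qed (simp add: parts_le_def)

lemma parts_le_Suc: "parts_le (Suc k) = parts_le k \<union> (with_head (Suc k, False) \<union> with_head (Suc k, True))"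
proof (intro equalityI subsetI)
  fix ps assume ps: "ps \<in> parts_le (Suc k)"
  show "ps \<in> parts_le k \<union> (with_head (Suc k, False) \<union> with_head (Suc k, True))"
  proof (cases ps)
    case Nil then show ?thesis by (simp add: parts_le_def)
  next
    case (Cons p qs)
    show ?thesis
    proof (cases "fst p = Suc k")
      case True
      then have "p = (Suc k, False) \<or> p = (Suc k, True)" by (cases p) auto
      then show ?thesis using ps Cons by (auto simp: with_head_def parts_le_def)
    next
      case False
      then have "fst p \<le> k" using ps Cons by (auto simp: parts_le_def)
      moreover have "\<forall>r\<in>set qs. fst r \<le> fst p" using ps Cons by (simp add: parts_le_def Cons_overpartition)
      ultimately have "\<forall>r\<in>set ps. fst r \<le> k" unfolding Cons using order.trans by auto
      then show ?thesis using ps by (simp add: parts_le_def)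
    qed
  qed
next
  fix ps assume "ps \<in> parts_le k \<union> (with_head (Suc k, False) \<union> with_head (Suc k, True))"
  then consider "ps \<in> parts_le k" | b qs where "ps = (Suc k, b) # qs" "ps \<in> overpartitions"
    by (auto simp: with_head_def)
  then show "ps \<in> parts_le (Suc k)"
  proof cases
    case 1
    then show ?thesis by (force simp: parts_le_def)
  next
    case 2
    then show ?thesis by (simp add: parts_le_def Cons_overpartition)
  qed
qed

text \<open>After the first copy of the largest part no further copy may be overlined. So a tail
  that starts with the same part starts with a non-overlined one, whatever \<open>b\<close>
  is.\<close>

lemma with_head_eq: "with_head (Suc k, b) = Cons (Suc k, b) ` (parts_le k \<union> with_head (Suc k, False))"
proof (intro equalityI subsetI)
  fix ps assume "ps \<in> with_head (Suc k, b)"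
  then obtain qs where ps: "ps = (Suc k, b) # qs" and o: "ps \<in> overpartitions" by (auto simp: with_head_def)
  have qs: "qs \<in> overpartitions" "\<forall>r\<in>set qs. fst r \<le> Suc k" "\<forall>r\<in>set qs. fst r = Suc k \<longrightarrow> \<not> snd r"
    using o unfolding ps Cons_overpartition by auto
  then have "qs \<in> parts_le (Suc k)" by (simp add: parts_le_def)
  moreover have "qs \<notin> with_head (Suc k, True)" using qs(3) by (force simp: with_head_def)
  ultimately show "ps \<in> Cons (Suc k, b) ` (parts_le k \<union> with_head (Suc k, False))"
    unfolding ps parts_le_Suc by auto
next
  fix ps assume "ps \<in> Cons (Suc k, b) ` (parts_le k \<union> with_head (Suc k, False))"
  then obtain qs where ps: "ps = (Suc k, b) # qs" and qs: "qs \<in> parts_le k \<or> qs \<in> with_head (Suc k, False)"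
    by blast
  have "qs \<in> overpartitions \<and> (\<forall>r\<in>set qs. fst r \<le> Suc k) \<and> (\<forall>r\<in>set qs. fst r = Suc k \<longrightarrow> \<not> snd r)"
    using qs
  proof
    assume "qs \<in> parts_le k"
    then show ?thesis by (force simp: parts_le_def)
  next
    assume "qs \<in> with_head (Suc k, False)"
    then obtain rs where "qs = (Suc k, False) # rs" "qs \<in> overpartitions" by (auto simp: with_head_def)
    then show ?thesis by (simp add: Cons_overpartition)
  qed
  then have "ps \<in> overpartitions" unfolding ps Cons_overpartition by simp
  then show "ps \<in> with_head (Suc k, b)" by (simp add: with_head_def ps)
qed

lemma heads_disjoint: "parts_le k \<inter> with_head (Suc k, b) = {}" "b \<noteq> b' \<Longrightarrow> with_head (j, b) \<inter> with_head (j, b') = {}"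
  by (auto simp: parts_le_def with_head_def)

text \<open>Forgetting the order and the rule for overlining gives a larger set with an easy
  recursion on the first entry; its bound \<open>3 ^ m\<close> is enough for convergence.\<close>

definition weak_lists :: "nat \<Rightarrow> (nat \<times> bool) list set" where
  "weak_lists m = {ps. (\<forall>r\<in>set ps. 0 < fst r) \<and> sum_list (map fst ps) = m}"

lemma card_weak_lists: "finite (weak_lists m) \<and> card (weak_lists m) \<le> 3 ^ m"
proof (induction m rule: less_induct)
  case (less m)
  show ?case
  proof (cases "m = 0")
    case True
    have "weak_lists 0 = {[]}"
    proof (intro equalityI subsetI)
      fix ps assume "ps \<in> weak_lists 0"
      then show "ps \<in> {[]}" by (cases ps) (auto simp: weak_lists_def)
    qed (simp add: weak_lists_def)
    with True show ?thesis by simp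
  next
    case False
    let ?F = "\<lambda>k. Cons (k, False) ` weak_lists (m - k) \<union> Cons (k, True) ` weak_lists (m - k)"
    have eq: "weak_lists m = (\<Union>k\<in>{1..m}. ?F k)"
    proof (intro equalityI subsetI)
      fix ps assume ps: "ps \<in> weak_lists m"
      with False obtain k b qs where eq: "ps = (k, b) # qs" by (cases ps) (auto simp: weak_lists_def)
      with ps have "k \<in> {1..m}" "qs \<in> weak_lists (m - k)" by (auto simp: weak_lists_def)
      then show "ps \<in> (\<Union>k\<in>{1..m}. ?F k)" unfolding eq by (cases b) blast+
    qed (auto simp: weak_lists_def)
    have fin: "finite (weak_lists (m - k))" "card (weak_lists (m - k)) \<le> 3 ^ (m - k)" if "k \<in> {1..m}" for k
      using less[of "m - k"] that by auto
    have cF: "card (?F k) \<le> 2 * 3 ^ (m - k)" if "k \<in> {1..m}" for k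
    proof -
      have "card (?F k) \<le> card (weak_lists (m - k)) + card (weak_lists (m - k))"
        by (intro order.trans[OF card_Un_le] add_mono card_image_le fin that)
      then show ?thesis using fin(2)[OF that] by linarith
    qed
    have "card (weak_lists m) \<le> (\<Sum>k\<in>{1..m}. card (?F k))"
      unfolding eq by (rule card_UN_le) simp
    also have "\<dots> \<le> (\<Sum>k\<in>{1..m}. 2 * 3 ^ (m - k))" by (rule sum_mono) (rule cF)
    also have "\<dots> = (\<Sum>i<m. 2 * 3 ^ i)"
      by (rule sum.reindex_bij_witness[of _ "\<lambda>i. m - i" "\<lambda>k. m - k"]) (use False in auto)
    also have "\<dots> \<le> 3 ^ m" by (induction m) auto
    finally have "card (weak_lists m) \<le> 3 ^ m" .
    moreover have "finite (weak_lists m)" unfolding eq using fin by auto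
    ultimately show ?thesis by blast
  qed
qed

lemma overpartitions_subset: "{ps \<in> overpartitions. sum_list (map fst ps) = m} \<subseteq> weak_lists m"
  using overpartition_pos by (auto simp: weak_lists_def)

lemma finite_overpartitions: "finite {ps \<in> overpartitions. sum_list (map fst ps) = m}"
  using finite_subset[OF overpartitions_subset] card_weak_lists by blast

abbreviation weight :: "(nat \<times> bool) list \<Rightarrow> nat" where "weight ps \<equiv> sum_list (map fst ps)"

definition msign :: "(nat \<times> bool \<Rightarrow> real) \<Rightarrow> (nat \<times> bool) list \<Rightarrow> real" where
  "msign c ps = prod_list (map c ps)"

context base
begin

lemma overpartitions_summable: "(\<lambda>ps. p ^ weight ps) summable_on overpartitions"
proof -
  let ?B = "\<lambda>m. {ps \<in> overpartitions. weight ps = m}"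
  have "(\<lambda>m. (3/4 :: real) ^ m) summable_on UNIV"
    by (intro summable_nonneg_imp_summable_on summable_geometric) auto
  moreover have "real (card (?B m)) * p ^ m \<le> (3/4) ^ m" for m
  proof -
    have "card (?B m) \<le> 3 ^ m"
      using card_mono[OF _ overpartitions_subset] card_weak_lists[of m] order.trans by blast
    then have "real (card (?B m)) \<le> 3 ^ m" using of_nat_mono[of "card (?B m)" "3 ^ m"] by simp
    then have "real (card (?B m)) * p ^ m \<le> 3 ^ m * (1/4) ^ m"
      using p_pos p_le by (intro mult_mono power_mono) auto
    then show ?thesis by (simp add: power_divide)
  qed
  ultimately have s: "(\<lambda>m. real (card (?B m)) * p ^ m) summable_on UNIV"
    by (elim summable_on_bound) simp
  have inner: "((\<lambda>ps. p ^ m) has_sum real (card (?B m)) * p ^ m) (?B m)" for m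
    using finite_overpartitions[of m] by (simp add: has_sum_finite_iff)
  have "(\<lambda>(m, ps). p ^ m) abs_summable_on Sigma UNIV ?B"
    unfolding abs_summable_on_Sigma_iff
  proof (intro conjI ballI)
    fix m :: nat
    show "(\<lambda>ps. norm (case (m, ps) of (m, ps) \<Rightarrow> p ^ m)) summable_on ?B m"
      by (rule summable_on_finite) (rule finite_overpartitions)
  next
    have "(\<Sum>\<^sub>\<infinity>ps\<in>?B m. norm (case (m, ps) of (m, ps) \<Rightarrow> p ^ m)) = real (card (?B m)) * p ^ m" for m
      using inner[of m] by (simp add: infsumI)
    then show "(\<lambda>m. norm (\<Sum>\<^sub>\<infinity>ps\<in>?B m. norm (case (m, ps) of (m, ps) \<Rightarrow> p ^ m))) summable_on UNIV"
      using s by simp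
  qed
  then have "(\<lambda>(m, ps). p ^ m) summable_on Sigma UNIV ?B" by (rule abs_summable_summable)
  then show ?thesis
    by (rule summable_on_reindex_bij_witness[of overpartitions snd "\<lambda>ps. (weight ps, ps)" "Sigma UNIV ?B" "\<lambda>(m, ps). p ^ m", THEN iffD2, rotated -1])
      auto
qed

lemma signed_summable:
  assumes "\<And>ps. \<bar>s ps\<bar> \<le> 1" "B \<subseteq> overpartitions"
  shows "(\<lambda>ps. s ps * p ^ weight ps) summable_on B"
  by (rule summable_on_mult_bounded[OF summable_on_subset_banach[OF overpartitions_summable assms(2)], where C = 1])
    (rule assms(1))

lemma subsets: "parts_le k \<subseteq> overpartitions" "with_head q \<subseteq> overpartitions"
  by (auto simp: parts_le_def with_head_def)

definition gf :: "(nat \<times> bool \<Rightarrow> real) \<Rightarrow> (nat \<times> bool) list set \<Rightarrow> real" where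
  "gf c B = (\<Sum>\<^sub>\<infinity>ps\<in>B. msign c ps * p ^ weight ps)"

context
  fixes c :: "nat \<times> bool \<Rightarrow> real"
  assumes c: "\<And>q. \<bar>c q\<bar> = 1"
begin

lemma msign_abs: "\<bar>msign c ps\<bar> \<le> 1"
  by (induction ps) (simp_all add: msign_def abs_mult c)

lemma gf_summable: "B \<subseteq> overpartitions \<Longrightarrow> (\<lambda>ps. msign c ps * p ^ weight ps) summable_on B"
  by (rule signed_summable[OF msign_abs])

lemma gf_head: "gf c (with_head (Suc k, b)) = c (Suc k, b) * p ^ Suc k * (gf c (parts_le k) + gf c (with_head (Suc k, False)))"
proof -
  let ?f = "\<lambda>ps. msign c ps * p ^ weight ps"
  have "gf c (with_head (Suc k, b)) = (\<Sum>\<^sub>\<infinity>ps\<in>parts_le k \<union> with_head (Suc k, False). ?f ((Suc k, b) # ps))"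
    unfolding gf_def with_head_eq[of k b] by (subst infsum_reindex) (auto simp: o_def)
  also have "\<dots> = (\<Sum>\<^sub>\<infinity>ps\<in>parts_le k \<union> with_head (Suc k, False). c (Suc k, b) * p ^ Suc k * ?f ps)"
    by (intro infsum_cong) (simp add: msign_def power_add)
  also have "\<dots> = c (Suc k, b) * p ^ Suc k * (\<Sum>\<^sub>\<infinity>ps\<in>parts_le k \<union> with_head (Suc k, False). ?f ps)"
    by (rule infsum_cmult_right')
  also have "(\<Sum>\<^sub>\<infinity>ps\<in>parts_le k \<union> with_head (Suc k, False). ?f ps) = gf c (parts_le k) + gf c (with_head (Suc k, False))"
    unfolding gf_def by (intro infsum_Un_disjoint gf_summable subsets heads_disjoint)
  finally show ?thesis .
qed

lemma one_minus_c_nz: "1 - c q * p ^ Suc k \<noteq> 0"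
proof -
  have "0 < p ^ Suc k" "p ^ Suc k < 1" by (rule p_Suc_bounds)+
  moreover have "c q = 1 \<or> c q = -1" using c[of q] by linarith
  ultimately show ?thesis by auto
qed

text \<open>For \<open>b = False\<close> the previous lemma is a linear equation for the series
  itself; its solution is the geometric series of repeated copies of the largest part.\<close>

lemma gf_head_eq: "gf c (with_head (Suc k, b)) = c (Suc k, b) * p ^ Suc k / (1 - c (Suc k, False) * p ^ Suc k) * gf c (parts_le k)"
proof -
  let ?d = "1 - c (Suc k, False) * p ^ Suc k"
  have "gf c (with_head (Suc k, False)) * ?d = c (Suc k, False) * p ^ Suc k * gf c (parts_le k)"
    using gf_head[of k False] by (simp add: algebra_simps)
  then have F: "gf c (with_head (Suc k, False)) = c (Suc k, False) * p ^ Suc k * gf c (parts_le k) / ?d"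
    using one_minus_c_nz by (simp add: eq_divide_eq)
  have "gf c (parts_le k) + gf c (with_head (Suc k, False)) = gf c (parts_le k) / ?d"
    unfolding F using one_minus_c_nz[of "(Suc k, False)" k] by (simp add: divide_simps del: power_Suc) (simp add: algebra_simps)
  then show ?thesis unfolding gf_head[of k b] by simp
qed

lemma gf_parts_le_0: "gf c (parts_le 0) = 1"
  by (simp add: gf_def parts_le_0 msign_def)

lemma gf_parts_le_Suc: "gf c (parts_le (Suc k)) =
    gf c (parts_le k) * (1 + c (Suc k, True) * p ^ Suc k) / (1 - c (Suc k, False) * p ^ Suc k)"
proof -
  have "gf c (parts_le (Suc k)) = gf c (parts_le k) + gf c (with_head (Suc k, False) \<union> with_head (Suc k, True))"
    unfolding gf_def parts_le_Suc 
    by (intro infsum_Un_disjoint gf_summable Un_least subsets) (simp add: Int_Un_distrib heads_disjoint(1))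
  also have "gf c (with_head (Suc k, False) \<union> with_head (Suc k, True)) = gf c (with_head (Suc k, False)) + gf c (with_head (Suc k, True))"
    unfolding gf_def by (intro infsum_Un_disjoint gf_summable subsets heads_disjoint) simp
  finally show ?thesis unfolding gf_head_eq using one_minus_c_nz[of "(Suc k, False)" k]
    by (simp add: divide_simps del: power_Suc) (simp add: algebra_simps)
qed

text \<open>The parity of either rank is a product of one sign per part, \<open>c\<close>, and a
  contribution \<open>\<sigma>\<close> of the largest part, which is the head of the list. The index
  \<open>k\<close> stands for largest part \<open>k + 1\<close>, and the \<open>- 1\<close> removes
  the empty overpartition.\<close>

lemma sum_overpartitions_by_head:
  fixes \<sigma> :: "nat \<times> bool \<Rightarrow> real" and sg :: "(nat \<times> bool) list \<Rightarrow> real"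
  assumes s: "\<And>ps. \<bar>sg ps\<bar> \<le> 1" and Nil: "sg [] = 1"
    and Cons: "\<And>q qs. q # qs \<in> overpartitions \<Longrightarrow> sg (q # qs) = \<sigma> q * msign c (q # qs)"
  shows "(\<lambda>k. \<sigma> (Suc k, False) * gf c (with_head (Suc k, False)) + \<sigma> (Suc k, True) * gf c (with_head (Suc k, True)))
    sums ((\<Sum>\<^sub>\<infinity>ps\<in>overpartitions. sg ps * p ^ weight ps) - 1)"
proof -
  let ?f = "\<lambda>ps. sg ps * p ^ weight ps"
  let ?H = "\<lambda>k. with_head (Suc k, False) \<union> with_head (Suc k, True)"
  have "overpartitions = insert [] (overpartitions - {[]})" by auto
  moreover have "?f summable_on overpartitions - {[]}" by (rule signed_summable[OF s]) auto
  then have "infsum ?f (insert [] (overpartitions - {[]})) = ?f [] + infsum ?f (overpartitions - {[]})"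
    by (rule infsum_insert) simp
  ultimately have "infsum ?f (overpartitions - {[]}) = infsum ?f overpartitions - 1" using Nil by simp
  moreover have "(?f has_sum infsum ?f (overpartitions - {[]})) (overpartitions - {[]})"
    by (rule has_sum_infsum, rule signed_summable[OF s]) auto
  ultimately have h: "(?f has_sum (infsum ?f overpartitions - 1)) (overpartitions - {[]})" by simp
  have "((\<lambda>(k, ps). ?f ps) has_sum (infsum ?f overpartitions - 1)) (Sigma UNIV ?H)"
  proof (rule has_sum_reindex_bij_witness[of "overpartitions - {[]}" snd "\<lambda>ps. (fst (hd ps) - 1, ps)", THEN iffD1, OF _ _ _ _ _ refl h])
    fix ps assume ps: "ps \<in> overpartitions - {[]}"
    then obtain k b qs where ps': "ps = (k, b) # qs" by (cases ps) auto
    then have "0 < k" using ps Cons_overpartition by auto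
    then have "(k - 1, ps) \<in> Sigma UNIV ?H" using ps by (cases b) (auto simp: ps' with_head_def)
    then show "(fst (hd ps) - 1, ps) \<in> Sigma UNIV ?H" by (simp add: ps')
  qed (auto simp: with_head_def)
  then have "((\<lambda>k. \<sigma> (Suc k, False) * gf c (with_head (Suc k, False)) + \<sigma> (Suc k, True) * gf c (with_head (Suc k, True)))
    has_sum (infsum ?f overpartitions - 1)) UNIV"
  proof (rule has_sum_SigmaD)
    fix k
    have g: "(?f has_sum \<sigma> (Suc k, b) * gf c (with_head (Suc k, b))) (with_head (Suc k, b))" for b
    proof -
      have "((\<lambda>ps. \<sigma> (Suc k, b) * (msign c ps * p ^ weight ps)) has_sum \<sigma> (Suc k, b) * gf c (with_head (Suc k, b))) (with_head (Suc k, b))"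
        unfolding gf_def by (intro has_sum_cmult_right has_sum_infsum gf_summable subsets)
      then show ?thesis
        by (rule has_sum_cong[THEN iffD1, rotated]) (auto simp: with_head_def Cons)
    qed
    show "((\<lambda>y. case (k, y) of (k, ps) \<Rightarrow> ?f ps) has_sum
        \<sigma> (Suc k, False) * gf c (with_head (Suc k, False)) + \<sigma> (Suc k, True) * gf c (with_head (Suc k, True))) (?H k)"
      using has_sum_Un_disjoint[OF g[of False] g[of True]] heads_disjoint(2)[of False True] by simp
  qed
  then show ?thesis by (rule has_sum_imp_sums)
qed

end

section \<open>The two ranks modulo 2\<close>

lemma has_sum_overpartitions_parity:
  fixes r :: "(nat \<times> bool) list \<Rightarrow> int"
  shows "((\<lambda>m. (real (card {ps. is_overpartition ps m \<and> even (r ps)}) - real (card {ps. is_overpartition ps m \<and> odd (r ps)})) * p ^ m)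
     has_sum (\<Sum>\<^sub>\<infinity>ps\<in>overpartitions. (if even (r ps) then 1 else - 1) * p ^ weight ps)) UNIV"
proof -
  let ?s = "\<lambda>ps. if even (r ps) then 1 else (- 1 :: real)"
  have "(\<lambda>ps. ?s ps * p ^ weight ps) summable_on overpartitions" by (rule signed_summable) auto
  from has_sum_fibres[OF this finite_overpartitions]
  have "((\<lambda>m. (\<Sum>ps | ps \<in> overpartitions \<and> weight ps = m. ?s ps) * p ^ m) has_sum
      (\<Sum>\<^sub>\<infinity>ps\<in>overpartitions. ?s ps * p ^ weight ps)) UNIV" .
  moreover have "(\<Sum>ps | ps \<in> overpartitions \<and> weight ps = m. ?s ps) =
      real (card {ps. is_overpartition ps m \<and> even (r ps)}) - real (card {ps. is_overpartition ps m \<and> odd (r ps)})" for m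
  proof -
    let ?B = "{ps \<in> overpartitions. weight ps = m}"
    have fin: "finite ?B" by (rule finite_overpartitions)
    have "sum ?s ?B = sum ?s {ps \<in> ?B. even (r ps)} + sum ?s {ps \<in> ?B. \<not> even (r ps)}"
      by (subst sum.union_disjoint[symmetric])
        (auto intro!: sum.cong intro: finite_subset[OF _ fin])
    also have "sum ?s {ps \<in> ?B. even (r ps)} = real (card {ps \<in> ?B. even (r ps)})" by simp
    also have "sum ?s {ps \<in> ?B. \<not> even (r ps)} = - real (card {ps \<in> ?B. \<not> even (r ps)})" by simp
    finally show ?thesis by (simp add: is_overpartition_iff conj_assoc)
  qed
  ultimately show ?thesis by simp
qed

text \<open>Each part changes the parity of the rank, so \<open>c\<close> is constantly
  \<open>-1\<close>, and the largest part contributes \<open>(-1)\<close> to its size. Overlined and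
  non-overlined heads give equal series, which is the factor 2 in \<open>Psi0\<close>.\<close>

theorem rank_power_series: "((\<lambda>m. (real (p_even m) - real (p_odd m)) * p ^ m) has_sum Psi 0) UNIV"
proof -
  let ?c = "\<lambda>q::nat \<times> bool. - 1 :: real"
  let ?\<sigma> = "\<lambda>q::nat \<times> bool. (- 1 :: real) ^ fst q"
  let ?sg = "\<lambda>ps. if even (overpartition_rank ps) then 1 else - 1 :: real"
  have msign: "msign ?c ps = (- 1) ^ length ps" for ps by (induction ps) (simp_all add: msign_def)
  have Z: "gf ?c (parts_le k) = P k" for k
  proof (induction k)
    case 0 show ?case by (simp add: gf_parts_le_0 P_def)
  next
    case (Suc k)
    then show ?case by (subst gf_parts_le_Suc) (simp_all add: P_def)
  qed
  have "(\<lambda>k. ?\<sigma> (Suc k, False) * gf ?c (with_head (Suc k, False)) + ?\<sigma> (Suc k, True) * gf ?c (with_head (Suc k, True)))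
    sums ((\<Sum>\<^sub>\<infinity>ps\<in>overpartitions. ?sg ps * p ^ weight ps) - 1)"
  proof (rule sum_overpartitions_by_head)
    fix q :: "nat \<times> bool" and qs
    show "?sg (q # qs) = ?\<sigma> q * msign ?c (q # qs)"
      unfolding msign by (simp add: overpartition_rank_def largest_part_def num_parts_def minus_one_power_iff)
  qed (auto simp: overpartition_rank_def largest_part_def num_parts_def)
  moreover have "?\<sigma> (Suc k, False) * gf ?c (with_head (Suc k, False)) + ?\<sigma> (Suc k, True) * gf ?c (with_head (Suc k, True)) =
      2 * ((-1) ^ k * P k * (p ^ Suc k / (1 + p ^ Suc k)))" for k
    by (subst (1 2) gf_head_eq) (simp_all add: Z)
  ultimately have "(\<lambda>k. 2 * ((-1) ^ k * P k * (p ^ Suc k / (1 + p ^ Suc k)))) sums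
      ((\<Sum>\<^sub>\<infinity>ps\<in>overpartitions. ?sg ps * p ^ weight ps) - 1)" by (simp only:)
  moreover have "(\<lambda>k. 2 * ((-1) ^ k * P k * (p ^ Suc k / (1 + p ^ Suc k)))) sums (2 * (\<Sum>k. (-1) ^ k * P k * (p ^ Suc k / (1 + p ^ Suc k))))"
    by (intro sums_mult summable_sums summable_Psi0)
  ultimately have "(\<Sum>\<^sub>\<infinity>ps\<in>overpartitions. ?sg ps * p ^ weight ps) = Psi 0"
    using sums_unique2 by (fastforce simp: Psi_def Psi0_def)
  then show ?thesis using has_sum_overpartitions_parity[of overpartition_rank] by (simp add: p_even_def p_odd_def)
qed

theorem M2_rank_power_series: "((\<lambda>m. (real (M2_even m) - real (M2_odd m)) * p ^ m) has_sum base.Psi (p\<^sup>2) p) UNIV"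
proof -
  interpret sq: base "p\<^sup>2" by (rule sq_base)
  have pw: "(p\<^sup>2) ^ k = p ^ (2 * k)" for k by (simp add: power_mult)
  \<comment> \<open>In the \<open>M2\<close>-rank \<open>- n + n_o\<close> changes parity with each
    part that is not odd and non-overlined. The ceiling, as \<open>Suc (fst q) div 2\<close>, and
    \<open>chi\<close> depend on the head only and go into \<open>\<sigma>\<close>.\<close>
  define c where "c q = (if odd (fst q) \<and> \<not> snd q then 1 else - 1 :: real)" for q :: "nat \<times> bool"
  define \<sigma> where "\<sigma> q = (- 1 :: real) ^ (Suc (fst q) div 2 + of_bool (odd (fst q) \<and> \<not> snd q))" for q :: "nat \<times> bool"
  let ?sg = "\<lambda>ps. if even (M2_rank ps) then 1 else - 1 :: real"
  have c: "\<bar>c q\<bar> = 1" for q by (simp add: c_def)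
  have cv: "c (k, b) = (if odd k \<and> \<not> b then 1 else - 1)" for k b by (simp add: c_def)
  have msign: "msign c ps = (- 1) ^ (length ps + length (odd_nonoverlined ps))" for ps
    by (induction ps) (auto simp: msign_def odd_nonoverlined_def c_def)
  have ceil: "\<lceil>real k / 2\<rceil> = int (Suc k div 2)" for k
  proof (cases "even k")
    case True
    then obtain j where "k = 2 * j" by blast
    then show ?thesis by simp
  next
    case False
    then obtain j where j: "k = 2 * j + 1" by (rule oddE)
    have "\<lceil>real k / 2\<rceil> = int j + 1" unfolding j by (rule ceiling_unique) (auto simp: field_simps)
    then show ?thesis by (simp add: j)
  qed
  \<comment> \<open>For an odd part the sign \<open>-1\<close> of the overlined copy meets the sign
    1 of the others, and the factor \<open>(1 - p^k) / (1 - p^k)\<close> is 1. Only even parts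
    remain, which is the reason for the base \<open>p^2\<close>.\<close>
  have Z: "gf c (parts_le (2 * j)) = sq.P j \<and> gf c (parts_le (Suc (2 * j))) = sq.P j" for j
  proof (induction j)
    case 0
    show ?case using gf_parts_le_Suc[of c 0, OF c] p_lt_1 by (simp add: gf_parts_le_0[OF c] sq.P_def cv)
  next
    case (Suc j)
    have "gf c (parts_le (Suc (Suc (2 * j)))) = sq.P j * (1 - p ^ (2 * Suc j)) / (1 + p ^ (2 * Suc j))"
      using gf_parts_le_Suc[of c "Suc (2 * j)", OF c] Suc by (simp add: cv)
    also have "\<dots> = sq.P (Suc j)" unfolding sq.P_def power_mult by (simp del: power_Suc)
    finally have e: "gf c (parts_le (2 * Suc j)) = sq.P (Suc j)" by simp
    have "gf c (parts_le (Suc (2 * Suc j))) = sq.P (Suc j) * (1 - p ^ Suc (2 * Suc j)) / (1 - p ^ Suc (2 * Suc j))"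
      using gf_parts_le_Suc[of c "2 * Suc j", OF c] e by (simp add: cv)
    then show ?case using e p_Suc_bounds(2)[of "2 * Suc j"] by simp
  qed
  define a where "a k = \<sigma> (Suc k, False) * gf c (with_head (Suc k, False)) + \<sigma> (Suc k, True) * gf c (with_head (Suc k, True))" for k
  have "a sums ((\<Sum>\<^sub>\<infinity>ps\<in>overpartitions. ?sg ps * p ^ weight ps) - 1)"
    unfolding a_def
  proof (rule sum_overpartitions_by_head[OF c])
    fix q :: "nat \<times> bool" and qs
    show "?sg (q # qs) = \<sigma> q * msign c (q # qs)"
      unfolding msign \<sigma>_def
      by (auto simp: M2_rank_def largest_part_def num_parts_def chi_def ceil minus_one_power_iff)
  qed (auto simp: M2_rank_def largest_part_def num_parts_def chi_def odd_nonoverlined_def)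
  \<comment> \<open>Largest parts \<open>2 * j + 1\<close> and \<open>2 * j + 2\<close> are paired;
    they feed the sum in \<open>Psi\<close> at \<open>s = p\<close> and the one in
    \<open>Psi0\<close>, respectively.\<close>
  from sums_group[OF this, of 2]
  have "(\<lambda>j. a (2 * j) + a (Suc (2 * j))) sums ((\<Sum>\<^sub>\<infinity>ps\<in>overpartitions. ?sg ps * p ^ weight ps) - 1)"
    by (simp add: mult.commute[of _ 2])
  moreover have "a (2 * j) + a (Suc (2 * j)) = 2 * ((-1) ^ j * sq.P j * (p * (p\<^sup>2) ^ j / (1 - p * (p\<^sup>2) ^ j))) +
      2 * ((-1) ^ j * sq.P j * ((p\<^sup>2) ^ Suc j / (1 + (p\<^sup>2) ^ Suc j)))" for j
  proof -
    have "a (2 * j) = 2 * ((-1) ^ j * sq.P j * (p ^ Suc (2 * j) / (1 - p ^ Suc (2 * j))))"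
      unfolding a_def gf_head_eq[OF c] by (simp add: Z \<sigma>_def cv)
    moreover have "a (Suc (2 * j)) = 2 * ((-1) ^ j * sq.P j * (p ^ (2 * Suc j) / (1 + p ^ (2 * Suc j))))"
      unfolding a_def gf_head_eq[OF c] by (simp add: Z \<sigma>_def cv)
    ultimately show ?thesis unfolding pw by simp
  qed
  ultimately have "(\<lambda>j. 2 * ((-1) ^ j * sq.P j * (p * (p\<^sup>2) ^ j / (1 - p * (p\<^sup>2) ^ j))) +
      2 * ((-1) ^ j * sq.P j * ((p\<^sup>2) ^ Suc j / (1 + (p\<^sup>2) ^ Suc j)))) sums
      ((\<Sum>\<^sub>\<infinity>ps\<in>overpartitions. ?sg ps * p ^ weight ps) - 1)" by (simp only:)
  moreover have "(\<lambda>j. 2 * ((-1) ^ j * sq.P j * (p * (p\<^sup>2) ^ j / (1 - p * (p\<^sup>2) ^ j))) +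
      2 * ((-1) ^ j * sq.P j * ((p\<^sup>2) ^ Suc j / (1 + (p\<^sup>2) ^ Suc j)))) sums
      (2 * (\<Sum>j. (-1) ^ j * sq.P j * (p * (p\<^sup>2) ^ j / (1 - p * (p\<^sup>2) ^ j))) +
       2 * (\<Sum>j. (-1) ^ j * sq.P j * ((p\<^sup>2) ^ Suc j / (1 + (p\<^sup>2) ^ Suc j))))"
    by (intro sums_add sums_mult summable_sums sq.summable_Psi sq.summable_Psi0) (use p_pos p_le in auto)
  ultimately have "(\<Sum>\<^sub>\<infinity>ps\<in>overpartitions. ?sg ps * p ^ weight ps) = sq.Psi p"
    using sums_unique2 unfolding sq.Psi_def sq.Psi0_def by fastforce
  then show ?thesis using has_sum_overpartitions_parity[of M2_rank] by (simp add: M2_even_def M2_odd_def)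
qed

end

theorem rank_parity_eq: "real (p_even m) - real (p_odd m) = of_bool (m = 0) - 4 * cX (-1) 1 m"
proof (rule power_series_eq_imp_coeff_eq[of "1/4" _ "\<lambda>q. base.Psi q 0"])
  fix q :: real assume q: "0 < q" "q \<le> 1/4"
  interpret base q by standard (use q in auto)
  show "((\<lambda>m. (real (p_even m) - real (p_odd m)) * q ^ m) has_sum Psi 0) UNIV"
    by (rule rank_power_series)
  show "((\<lambda>m. (of_bool (m = 0) - 4 * cX (-1) 1 m) * q ^ m) has_sum Psi 0) UNIV"
    using X_power_series[of "-1" 1] by (simp add: X_minus_plus)
qed simp

theorem M2_rank_parity_eq: "real (M2_even m) - real (M2_odd m) = of_bool (m = 0) - 4 * cX 1 (-1) m"
proof (rule power_series_eq_imp_coeff_eq[of "1/4" _ "\<lambda>q. base.Psi (q\<^sup>2) q"])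
  fix q :: real assume q: "0 < q" "q \<le> 1/4"
  interpret base q by standard (use q in auto)
  show "((\<lambda>m. (real (M2_even m) - real (M2_odd m)) * q ^ m) has_sum base.Psi (q\<^sup>2) q) UNIV"
    by (rule M2_rank_power_series)
  show "((\<lambda>m. (of_bool (m = 0) - 4 * cX 1 (-1) m) * q ^ m) has_sum base.Psi (q\<^sup>2) q) UNIV"
    using X_power_series[of 1 "-1"] by (simp add: X_plus_minus)
qed simp

section \<open>Cores and beta sets\<close>

text \<open>For a partition these are the hook lengths of the first column.\<close>

fun beta :: "nat list \<Rightarrow> nat set" where
  "beta [] = {}"
| "beta (x # xs) = insert (x + length xs) (beta xs)"

abbreviation decreasing :: "nat list \<Rightarrow> bool" where "decreasing \<equiv> sorted_wrt (\<ge>)"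

lemma beta_less: "decreasing (x # xs) \<Longrightarrow> b \<in> beta xs \<Longrightarrow> b < x + length xs"
  by (induction xs arbitrary: x) fastforce+

lemma finite_beta [simp]: "finite (beta xs)"
  by (induction xs) auto

lemma card_beta: "decreasing xs \<Longrightarrow> card (beta xs) = length xs"
proof (induction xs)
  case (Cons x xs)
  then have "x + length xs \<notin> beta xs" using beta_less[of x xs "x + length xs"] by auto
  with Cons show ?case by simp
qed simp

lemma sum_beta: "decreasing xs \<Longrightarrow> \<Sum>(beta xs) = sum_list xs + \<Sum>{..<length xs}"
proof (induction xs)
  case (Cons x xs)
  then have "x + length xs \<notin> beta xs" using beta_less[of x xs "x + length xs"] by auto
  with Cons show ?case by simp
qed simp

lemma zero_notin_beta: "0 \<notin> set xs \<Longrightarrow> 0 \<notin> beta xs"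
  by (induction xs) auto

lemma Max_beta: "decreasing (x # xs) \<Longrightarrow> Max (beta (x # xs)) = x + length xs"
  using beta_less[of x xs] by (intro Max_eqI) (auto intro: less_imp_le)

lemma beta_inj: "decreasing xs \<Longrightarrow> decreasing ys \<Longrightarrow> beta xs = beta ys \<Longrightarrow> xs = ys"
proof (induction xs arbitrary: ys)
  case Nil
  then show ?case by (cases ys) auto
next
  case (Cons x xs)
  then obtain y ys' where ys: "ys = y # ys'" by (cases ys) auto
  have len: "length xs = length ys'" using card_beta[OF Cons.prems(1)] card_beta[OF Cons.prems(2)] Cons.prems(3) ys by simp
  have "x + length xs = y + length ys'"
    using Max_beta[OF Cons.prems(1)] Max_beta[of y ys'] Cons.prems(2,3) ys by simp
  with len have xy: "x = y" by simp
  have "beta xs = beta (x # xs) - {x + length xs}" using beta_less[OF Cons.prems(1)] by auto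
  also have "\<dots> = beta (y # ys') - {y + length ys'}" using Cons.prems(3) ys len xy by simp
  also have "\<dots> = beta ys'" using beta_less[of y ys'] Cons.prems(2) ys by auto
  finally show ?case using Cons ys xy by simp
qed

text \<open>The maximum \<open>b\<close> determines the first part as \<open>b - length xs\<close>.
  It is positive because the other elements lie in \<open>{1..<b}\<close>, and this uses
  \<open>0 \<notin> B\<close>.\<close>

lemma beta_surj: "finite B \<Longrightarrow> 0 \<notin> B \<Longrightarrow> \<exists>xs. decreasing xs \<and> 0 \<notin> set xs \<and> beta xs = B"
proof (induction "card B" arbitrary: B)
  case 0
  then show ?case by (intro exI[of _ "[]"]) auto
next
  case (Suc n)
  define b where "b = Max B"
  have "B \<noteq> {}" using Suc.hyps(2) by auto
  then have b: "b \<in> B" "\<And>x. x \<in> B \<Longrightarrow> x \<le> b" using Suc.prems by (auto simp: b_def)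
  have "n = card (B - {b})" using Suc.hyps(2) b Suc.prems by simp
  then obtain xs where xs: "decreasing xs" "0 \<notin> set xs" "beta xs = B - {b}"
    using Suc.hyps(1)[of "B - {b}"] Suc.prems by auto
  have len: "length xs = n" using card_beta[OF xs(1)] xs(3) \<open>n = card (B - {b})\<close> by simp
  have "B - {b} \<subseteq> {1..<b}"
  proof
    fix x assume x: "x \<in> B - {b}"
    then have "x \<noteq> 0" using Suc.prems by (metis DiffD1)
    moreover have "x < b" using b(2)[of x] x by simp
    ultimately show "x \<in> {1..<b}" by simp
  qed
  from card_mono[OF _ this] have "length xs < b"
    using len \<open>n = card (B - {b})\<close> Suc.prems b(1) by (cases "b = 0") auto
  moreover have "y \<le> b - length xs" if "y \<in> set xs" for y
  proof (cases xs)
    case (Cons z zs)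
    then have "z + length zs \<in> B - {b}" using xs(3) by auto
    then have "z + length zs < b" using b(2)[of "z + length zs"] by simp
    moreover have "y \<le> z" using that xs(1) Cons by auto
    ultimately show ?thesis using Cons by simp
  qed (use that in simp)
  ultimately have "decreasing ((b - length xs) # xs) \<and> 0 \<notin> set ((b - length xs) # xs) \<and> beta ((b - length xs) # xs) = B"
    using xs b(1) by auto
  then show ?case by blast
qed

text \<open>Number the boundary steps of the Young diagram from 0, starting at the lower left. The
  vertical steps carry the elements of \<open>beta xs\<close>, and \<open>gap xs j\<close> is the
  number of the horizontal step of column \<open>j\<close>; beyond the diagram the numbering
  continues along the axis.\<close>

definition gap :: "nat list \<Rightarrow> nat \<Rightarrow> nat" where
  "gap xs j = j + length (filter (\<lambda>y. y \<le> j) xs)"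

lemma gap_less_iff: "\<forall>y\<in>set xs. y \<le> x \<Longrightarrow> gap xs j < x + length xs \<longleftrightarrow> j < x"
proof
  assume le: "\<forall>y\<in>set xs. y \<le> x" and "gap xs j < x + length xs"
  show "j < x"
  proof (rule ccontr)
    assume "\<not> j < x"
    then have "filter (\<lambda>y. y \<le> j) xs = xs" using le by (auto simp: filter_id_conv)
    then show False using \<open>gap xs j < x + length xs\<close> \<open>\<not> j < x\<close> by (simp add: gap_def)
  qed
next
  assume "j < x"
  then show "gap xs j < x + length xs" unfolding gap_def by (rule add_less_le_mono) simp
qed

lemma range_gap: "decreasing xs \<Longrightarrow> range (gap xs) = - beta xs"
proof (induction xs)
  case Nil
  then show ?case by (simp add: gap_def)
next
  case (Cons y ys)
  have le: "\<forall>z\<in>set ys. z \<le> y" using Cons.prems by auto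
  have IH: "range (gap ys) = - beta ys" using Cons by simp
  have big: "gap (y # ys) j = Suc (j + length ys)" if "y \<le> j" for j
  proof -
    have "filter (\<lambda>z. z \<le> j) ys = ys" using le that by (auto simp: filter_id_conv)
    then show ?thesis using that by (simp add: gap_def)
  qed
  have small: "gap (y # ys) j = gap ys j" if "j < y" for j using that by (simp add: gap_def)
  show ?case
  proof (intro equalityI subsetI)
    fix m assume "m \<in> range (gap (y # ys))"
    then obtain j where j: "m = gap (y # ys) j" by auto
    show "m \<in> - beta (y # ys)"
    proof (cases "j < y")
      case True
      then have "gap ys j < y + length ys" using gap_less_iff[OF le] by simp
      moreover have "gap ys j \<notin> beta ys" using IH by auto
      ultimately show ?thesis using j small[OF True] by simp
    next
      case False
      then show ?thesis using j big[of j] beta_less[OF Cons.prems, of m] by auto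
    qed
  next
    fix m assume m: "m \<in> - beta (y # ys)"
    show "m \<in> range (gap (y # ys))"
    proof (cases "m < y + length ys")
      case True
      have "m \<in> range (gap ys)" using m IH by simp
      then obtain j where j: "m = gap ys j" by auto
      then have "j < y" using True gap_less_iff[OF le] by simp
      then show ?thesis using small[of j] j by (metis rangeI)
    next
      case False
      then have "Suc (y + length ys) \<le> m" using m by simp
      then have "m = gap (y # ys) (m - Suc (length ys))" using big[of "m - Suc (length ys)"] by simp
      then show ?thesis by (metis rangeI)
    qed
  qed
qed

lemma hook_length_Cons_0:
  assumes "j < x"
  shows "hook_length (x # xs) 0 j = x + length xs - gap xs j"
proof -
  have "{k. 0 < k \<and> k < length (x # xs) \<and> j < (x # xs) ! k} = Suc ` {k. k < length xs \<and> j < xs ! k}"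
    by (auto simp: image_iff gr0_conv_Suc)
  then have "card {k. 0 < k \<and> k < length (x # xs) \<and> j < (x # xs) ! k} = length (filter (\<lambda>y. j < y) xs)"
    by (simp add: card_image length_filter_conv_card)
  moreover have "length (filter (\<lambda>y. y \<le> j) xs) + length (filter (\<lambda>y. j < y) xs) = length xs"
    using sum_length_filter_compl[of "\<lambda>y. y \<le> j" xs] by (simp add: not_le)
  ultimately show ?thesis using assms by (simp add: hook_length_def gap_def)
qed

lemma hook_length_Cons_Suc: "hook_length (x # xs) (Suc i) j = hook_length xs i j"
proof -
  have "{k. Suc i < k \<and> k < length (x # xs) \<and> j < (x # xs) ! k} = Suc ` {k. i < k \<and> k < length xs \<and> j < xs ! k}"
    by (auto simp: image_iff Suc_less_eq2)
  then show ?thesis by (simp add: hook_length_def card_image)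
qed

text \<open>The hook lengths in the row belonging to \<open>b\<close> are the differences
  \<open>b - m\<close> with \<open>m < b\<close> outside the beta set. A new first row adds an
  element above all others, so it does not affect the condition for the smaller ones.\<close>

lemma is_core_iff:
  assumes "decreasing xs"
  shows "is_core t xs \<longleftrightarrow> (\<forall>b\<in>beta xs. \<forall>m<b. m \<notin> beta xs \<longrightarrow> \<not> t dvd b - m)"
  using assms
proof (induction xs)
  case Nil
  then show ?case by (simp add: is_core_def)
next
  case (Cons x xs)
  have le: "\<forall>z\<in>set xs. z \<le> x" and dec: "decreasing xs" using Cons.prems by auto
  let ?b = "x + length xs"
  have less: "b < ?b" if "b \<in> beta xs" for b using beta_less[OF Cons.prems that] .
  have "is_core t (x # xs) \<longleftrightarrow> (\<forall>j<x. \<not> t dvd hook_length (x # xs) 0 j) \<and> is_core t xs"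
    by (simp add: is_core_def All_less_Suc2 hook_length_Cons_Suc)
  also have "(\<forall>j<x. \<not> t dvd hook_length (x # xs) 0 j) \<longleftrightarrow> (\<forall>j. gap xs j < ?b \<longrightarrow> \<not> t dvd ?b - gap xs j)"
    using hook_length_Cons_0[of _ x xs] gap_less_iff[OF le] by auto
  also have "\<dots> \<longleftrightarrow> (\<forall>m\<in>range (gap xs). m < ?b \<longrightarrow> \<not> t dvd ?b - m)" by auto
  also have "\<dots> \<longleftrightarrow> (\<forall>m<?b. m \<notin> beta (x # xs) \<longrightarrow> \<not> t dvd ?b - m)"
    unfolding range_gap[OF dec] by auto
  also have "is_core t xs \<longleftrightarrow> (\<forall>b\<in>beta xs. \<forall>m<b. m \<notin> beta (x # xs) \<longrightarrow> \<not> t dvd b - m)"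
    unfolding Cons.IH[OF dec] using less by (auto dest: less_trans)
  finally show ?case by auto
qed

text \<open>An abacus with four runners whose beads are all pushed to the start, \<open>ci\<close>
  of them on runner \<open>i\<close>. Runner 0 is empty because beta sets do not contain 0.\<close>

definition runners :: "nat \<times> nat \<times> nat \<Rightarrow> nat set" where
  "runners = (\<lambda>(c1, c2, c3). (\<lambda>k. 4 * k + 1) ` {..<c1} \<union> (\<lambda>k. 4 * k + 2) ` {..<c2} \<union> (\<lambda>k. 4 * k + 3) ` {..<c3})"

lemma mem_runners: "b \<in> runners (c1, c2, c3) \<longleftrightarrow>
    b mod 4 = 1 \<and> b div 4 < c1 \<or> b mod 4 = 2 \<and> b div 4 < c2 \<or> b mod 4 = 3 \<and> b div 4 < c3"
proof -
  have "b \<in> (\<lambda>k. 4 * k + i) ` {..<c} \<longleftrightarrow> b mod 4 = i \<and> b div 4 < c" if "i < 4" for i c :: nat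
  proof
    assume "b \<in> (\<lambda>k. 4 * k + i) ` {..<c}"
    then show "b mod 4 = i \<and> b div 4 < c" using that by auto
  next
    assume "b mod 4 = i \<and> b div 4 < c"
    moreover have "4 * (b div 4) + b mod 4 = b" by (rule mult_div_mod_eq)
    ultimately show "b \<in> (\<lambda>k. 4 * k + i) ` {..<c}" by (intro image_eqI[of _ _ "b div 4"]) auto
  qed
  from this[of 1 c1] this[of 2 c2] this[of 3 c3] show ?thesis
    unfolding runners_def prod.case Un_iff by (simp only: one_less_numeral_iff semiring_norm numeral_less_iff) blast
qed

lemma finite_down_closed:
  assumes "finite (D :: nat set)" "\<And>k. Suc k \<in> D \<Longrightarrow> k \<in> D"
  shows "\<exists>c. D = {..<c}"
proof -
  obtain c where c: "c \<notin> D" "\<And>k. k < c \<Longrightarrow> k \<in> D"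
    using exists_least_iff[of "\<lambda>c. c \<notin> D"] ex_new_if_finite[OF infinite_UNIV_nat assms(1)] by auto
  have "k \<notin> D" if "c \<le> k" for k using that
    by (induction k rule: dec_induct) (use c(1) assms(2) in auto)
  with c(2) have "D = {..<c}" using not_le by blast
  then show ?thesis ..
qed

text \<open>The condition says that \<open>B\<close> is closed under subtracting multiples of 4, so
  on each residue class it is an initial segment.\<close>

lemma core_set_iff_runners:
  assumes fin: "finite B" and zero: "0 \<notin> B"
  shows "(\<forall>b\<in>B. \<forall>m<b. m \<notin> B \<longrightarrow> \<not> 4 dvd b - m) \<longleftrightarrow> B \<in> range runners"
proof
  assume core: "\<forall>b\<in>B. \<forall>m<b. m \<notin> B \<longrightarrow> \<not> 4 dvd b - m"
  have down: "4 * k + i \<in> B" if "4 * Suc k + i \<in> B" for k i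
    using core[rule_format, OF that, of "4 * k + i"] by auto
  have "\<exists>c. {k. 4 * k + i \<in> B} = {..<c}" for i
  proof (rule finite_down_closed)
    show "finite {k. 4 * k + i \<in> B}"
      using finite_vimageI[OF fin, of "\<lambda>k. 4 * k + i"] by (simp add: vimage_def inj_on_def)
  qed (use down in auto)
  then have "\<forall>i. \<exists>c. {k. 4 * k + i \<in> B} = {..<c}" by blast
  from choice[OF this] obtain c where c: "\<And>i. {k. 4 * k + i \<in> B} = {..<c i}" by blast
  have "0 \<notin> {k. 4 * k + 0 \<in> B}" using zero by simp
  then have "0 \<notin> {..<c 0}" unfolding c .
  then have "c 0 = 0" by simp
  have mem: "b \<in> B \<longleftrightarrow> b div 4 < c (b mod 4)" for b
  proof -
    have "b \<in> B \<longleftrightarrow> b div 4 \<in> {k. 4 * k + b mod 4 \<in> B}" by simp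
    then show ?thesis unfolding c by simp
  qed
  have "b \<in> B \<longleftrightarrow> b \<in> runners (c 1, c 2, c 3)" for b
  proof -
    have "b mod 4 < 4" by simp
    then consider "b mod 4 = 0" | "b mod 4 = 1" | "b mod 4 = 2" | "b mod 4 = 3" by linarith
    then show ?thesis unfolding mem mem_runners by cases (simp_all add: \<open>c 0 = 0\<close>)
  qed
  then have "B = runners (c 1, c 2, c 3)" by blast
  then show "B \<in> range runners" by auto
next
  assume "B \<in> range runners"
  then obtain c1 c2 c3 where B: "B = runners (c1, c2, c3)" by auto
  show "\<forall>b\<in>B. \<forall>m<b. m \<notin> B \<longrightarrow> \<not> 4 dvd b - m"
  proof (intro ballI allI impI notI)
    fix b m assume b: "b \<in> B" "m < b" "m \<notin> B" "4 dvd b - m"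
    then have "m mod 4 = b mod 4" using mod_eq_dvd_iff_nat[of m b 4] by auto
    moreover have "m div 4 \<le> b div 4" using b(2) by (intro div_le_mono) simp
    ultimately show False using b(1,3) unfolding B mem_runners by auto
  qed
qed

lemma runners_sum: "int (\<Sum>(runners (c1, c2, c3))) =
    2 * (int c1)\<^sup>2 - int c1 + 2 * (int c2)\<^sup>2 + 2 * (int c3)\<^sup>2 + int c3"
  and runners_card: "card (runners (c1, c2, c3)) = c1 + c2 + c3"
proof -
  have lin: "int (\<Sum>k<c. 4 * k + i) = 2 * (int c)\<^sup>2 - 2 * int c + int i * int c" for c i
    by (induction c) (simp_all add: power2_eq_square algebra_simps)
  have im: "\<Sum>((\<lambda>k. 4 * k + i) ` {..<c}) = (\<Sum>k<c. 4 * k + i)" for c i :: nat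
    by (subst sum.reindex) (auto simp: inj_on_def)
  have cim: "card ((\<lambda>k. 4 * k + i) ` {..<c}) = c" for c i :: nat
    by (subst card_image) (auto simp: inj_on_def)
  let ?A = "\<lambda>i c. (\<lambda>k. 4 * k + i) ` {..<c::nat}"
  have d12: "?A 1 c1 \<inter> ?A 2 c2 = {}" and d123: "(?A 1 c1 \<union> ?A 2 c2) \<inter> ?A 3 c3 = {}"
    by (auto; presburger)+
  show "int (\<Sum>(runners (c1, c2, c3))) =
    2 * (int c1)\<^sup>2 - int c1 + 2 * (int c2)\<^sup>2 + 2 * (int c3)\<^sup>2 + int c3"
    unfolding runners_def prod.case
    by (simp only: sum.union_disjoint[OF _ _ d123] sum.union_disjoint[OF _ _ d12] finite_UnI finite_imageI finite_lessThan im of_nat_add lin)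
  show "card (runners (c1, c2, c3)) = c1 + c2 + c3"
    unfolding runners_def prod.case
    by (simp only: card_Un_disjoint[OF _ _ d123] card_Un_disjoint[OF _ _ d12] finite_UnI finite_imageI finite_lessThan cim)
qed

lemma finite_runners: "finite (runners c)" and zero_notin_runners: "0 \<notin> runners c"
  by (auto simp: runners_def split: prod.splits)

lemma inj_runners: "inj runners"
proof (rule injI)
  fix c d assume eq: "runners c = runners d"
  obtain c1 c2 c3 d1 d2 d3 where cd: "c = (c1, c2, c3)" "d = (d1, d2, d3)" by (cases c, cases d) auto
  have r: "k < c1 \<longleftrightarrow> 4 * k + 1 \<in> runners (c1, c2, c3)" "k < c2 \<longleftrightarrow> 4 * k + 2 \<in> runners (c1, c2, c3)"
    "k < c3 \<longleftrightarrow> 4 * k + 3 \<in> runners (c1, c2, c3)" for k c1 c2 c3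
  proof -
    have d: "(4 * k + 1) mod 4 = 1" "(4 * k + 1) div 4 = k" "(4 * k + 2) mod 4 = 2" "(4 * k + 2) div 4 = k"
      "(4 * k + 3) mod 4 = 3" "(4 * k + 3) div 4 = k" by presburger+
    show "k < c1 \<longleftrightarrow> 4 * k + 1 \<in> runners (c1, c2, c3)" "k < c2 \<longleftrightarrow> 4 * k + 2 \<in> runners (c1, c2, c3)"
      "k < c3 \<longleftrightarrow> 4 * k + 3 \<in> runners (c1, c2, c3)" unfolding mem_runners d by simp_all
  qed
  have "k < c1 \<longleftrightarrow> k < d1" "k < c2 \<longleftrightarrow> k < d2" "k < c3 \<longleftrightarrow> k < d3" for k
    unfolding r(1)[of k c1 c2 c3] r(1)[of k d1 d2 d3] r(2)[of k c2 c1 c3] r(2)[of k d2 d1 d3]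
      r(3)[of k c3 c1 c2] r(3)[of k d3 d1 d2] using eq unfolding cd by blast+
  then have "c1 = d1 \<and> c2 = d2 \<and> c3 = d3" by (metis linorder_neqE_nat less_irrefl)
  then show "c = d" unfolding cd by simp
qed

text \<open>The size of the partition is the sum of its beta set minus \<open>l (l - 1) / 2\<close>
  with \<open>l = c1 + c2 + c3\<close>. Multiplying by 8 and completing squares gives this form; the
  constant is \<open>5 = 2^2 + 1^2\<close>.\<close>

definition core_triples :: "nat \<Rightarrow> (nat \<times> nat \<times> nat) set" where
  "core_triples n = {(c1, c2, c3). (2 * (int c1 - int c2 - int c3) - 2)\<^sup>2 +
     (2 * (int c2 - int c1 - int c3) - 1)\<^sup>2 + (2 * (int c3 - int c1 - int c2))\<^sup>2 = 8 * int n + 5}"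

lemma C4_eq_card_core_triples: "C4 n = card (core_triples n)"
proof -
  let ?A = "{xs. is_partition xs n \<and> is_core 4 xs}"
  have sum_less: "2 * int (\<Sum>{..<l}) = int l * (int l - 1)" for l
    by (induction l) (simp_all add: algebra_simps)
  have size: "sum_list xs = n \<longleftrightarrow> c \<in> core_triples n" if "decreasing xs" "beta xs = runners c" for xs c
  proof -
    obtain c1 c2 c3 where c: "c = (c1, c2, c3)" by (cases c) auto
    let ?s = "2 * (int c1)\<^sup>2 - int c1 + 2 * (int c2)\<^sup>2 + 2 * (int c3)\<^sup>2 + int c3"
    let ?l = "int c1 + int c2 + int c3"
    have "length xs = c1 + c2 + c3" using card_beta[OF that(1)] that(2) runners_card c by simp
    then have "2 * int (\<Sum>{..<length xs}) = ?l * (?l - 1)" using sum_less[of "length xs"] by simp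
    moreover have "int (\<Sum>(beta xs)) = ?s" using runners_sum that(2) c by simp
    ultimately have "2 * int (sum_list xs) = 2 * ?s - ?l * (?l - 1)" using sum_beta[OF that(1)] by simp
    then have "8 * int (sum_list xs) + 5 = (2 * (int c1 - int c2 - int c3) - 2)\<^sup>2 +
     (2 * (int c2 - int c1 - int c3) - 1)\<^sup>2 + (2 * (int c3 - int c1 - int c2))\<^sup>2"
      by (simp add: power2_eq_square algebra_simps)
    then show ?thesis unfolding core_triples_def c by auto
  qed
  have "beta ` ?A = runners ` core_triples n"
  proof (intro equalityI subsetI)
    fix B assume "B \<in> beta ` ?A"
    then obtain xs where xs: "B = beta xs" "is_partition xs n" "is_core 4 xs" by auto
    then have p: "decreasing xs" "0 \<notin> set xs" "sum_list xs = n" by (auto simp: is_partition_def)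
    have "B \<in> range runners"
      using core_set_iff_runners[OF finite_beta zero_notin_beta[OF p(2)]] is_core_iff[OF p(1)] xs by auto
    then obtain c where c: "B = runners c" by auto
    then show "B \<in> runners ` core_triples n" using size[OF p(1)] xs(1) p(3) by auto
  next
    fix B assume "B \<in> runners ` core_triples n"
    then obtain c where c: "B = runners c" "c \<in> core_triples n" by auto
    obtain xs where xs: "decreasing xs" "0 \<notin> set xs" "beta xs = B"
      using beta_surj[OF finite_runners zero_notin_runners] c(1) by metis
    have "is_core 4 xs"
      using core_set_iff_runners[OF finite_runners zero_notin_runners, of c] is_core_iff[OF xs(1)] xs(3) c(1) by auto
    moreover have "is_partition xs n" using xs size[of xs c] c by (auto simp: is_partition_def)
    ultimately show "B \<in> beta ` ?A" using xs(3) by blast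
  qed
  moreover have "card (beta ` ?A) = card ?A"
    by (intro card_image inj_onI beta_inj) (auto simp: is_partition_def)
  moreover have "card (runners ` core_triples n) = card (core_triples n)"
    by (intro card_image inj_on_subset[OF inj_runners]) simp
  ultimately show ?thesis by (simp add: C4_def)
qed

section \<open>Sums of three squares and the theorem\<close>

text \<open>For the three numbers squared in \<open>core_triples\<close> the pairwise sums are
  \<open>- 4 * c1 - 1\<close>, \<open>- 4 * c2 - 2\<close> and \<open>- 4 * c3 - 3\<close>. So the
  existence of each \<open>k\<close> expresses that \<open>c1\<close>, \<open>c2\<close>,
  \<open>c3\<close> are integral and nonnegative.\<close>

definition core_vectors :: "nat \<Rightarrow> (int \<times> int \<times> int) set" where
  "core_vectors m = {(a, b, c). a\<^sup>2 + b\<^sup>2 + c\<^sup>2 = int m \<and>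
     (\<exists>k. b + c = - 4 * int k - 1) \<and> (\<exists>k. a + c = - 4 * int k - 2) \<and> (\<exists>k. a + b = - 4 * int k - 3)}"

lemma card_core_triples: "card (core_triples n) = card (core_vectors (8 * n + 5))"
proof (rule bij_betw_same_card)
  let ?f = "\<lambda>(c1 :: nat, c2 :: nat, c3 :: nat). (2 * (int c1 - int c2 - int c3) - 2,
    2 * (int c2 - int c1 - int c3) - 1, 2 * (int c3 - int c1 - int c2))"
  let ?g = "\<lambda>(a, b, c). (nat ((- (b + c) - 1) div 4), nat ((- (a + c) - 2) div 4), nat ((- (a + b) - 3) div 4))"
  have g: "?g (a, b, c) = (k1, k2, k3)" and abc: "a = 2 * (int k1 - int k2 - int k3) - 2"
      "b = 2 * (int k2 - int k1 - int k3) - 1" "c = 2 * (int k3 - int k1 - int k2)"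
    if k: "b + c = - 4 * int k1 - 1" "a + c = - 4 * int k2 - 2" "a + b = - 4 * int k3 - 3" for a b c k1 k2 k3
  proof -
    have "- (b + c) - 1 = 4 * int k1" "- (a + c) - 2 = 4 * int k2" "- (a + b) - 3 = 4 * int k3"
      using k by linarith+
    then show "?g (a, b, c) = (k1, k2, k3)" by (simp only: prod.case) simp
    have "2 * a = (a + c) + (a + b) - (b + c)" by simp
    also have "\<dots> = 2 * (2 * (int k1 - int k2 - int k3) - 2)" unfolding k by simp
    finally show a: "a = 2 * (int k1 - int k2 - int k3) - 2" by simp
    show "b = 2 * (int k2 - int k1 - int k3) - 1" using k(3) unfolding a by smt
    show "c = 2 * (int k3 - int k1 - int k2)" using k(2) unfolding a by smt
  qed
  show "bij_betw ?f (core_triples n) (core_vectors (8 * n + 5))"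
  proof (rule bij_betw_byWitness[where f' = ?g])
    show "\<forall>x\<in>core_triples n. ?g (?f x) = x" by auto
    show "\<forall>y\<in>core_vectors (8 * n + 5). ?f (?g y) = y"
    proof
      fix y assume "y \<in> core_vectors (8 * n + 5)"
      moreover obtain a b c where y: "y = (a, b, c)" by (cases y) auto
      ultimately obtain k1 k2 k3 where k: "b + c = - 4 * int k1 - 1" "a + c = - 4 * int k2 - 2" "a + b = - 4 * int k3 - 3"
        by (auto simp: core_vectors_def)
      show "?f (?g y) = y" unfolding y g[OF k] using abc[OF k] by simp
    qed
    show "?f ` core_triples n \<subseteq> core_vectors (8 * n + 5)"
    proof (rule image_subsetI)
      fix x assume "x \<in> core_triples n"
      moreover obtain c1 c2 c3 where "x = (c1, c2, c3)" by (cases x) auto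
      ultimately show "?f x \<in> core_vectors (8 * n + 5)"
        by (auto simp: core_triples_def core_vectors_def intro!: exI[of _ c1] exI[of _ c2] exI[of _ c3])
    qed
    show "?g ` core_vectors (8 * n + 5) \<subseteq> core_triples n"
    proof (rule image_subsetI)
      fix y assume *: "y \<in> core_vectors (8 * n + 5)"
      moreover obtain a b c where y: "y = (a, b, c)" by (cases y) auto
      ultimately obtain k1 k2 k3 where k: "b + c = - 4 * int k1 - 1" "a + c = - 4 * int k2 - 2" "a + b = - 4 * int k3 - 3"
        by (auto simp: core_vectors_def)
      have "a\<^sup>2 + b\<^sup>2 + c\<^sup>2 = 8 * int n + 5" using * y by (simp add: core_vectors_def)
      then have "(k1, k2, k3) \<in> core_triples n" unfolding core_triples_def abc[OF k] by simp
      then show "?g y \<in> core_triples n" unfolding y g[OF k] .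
    qed
  qed
qed

section \<open>Symmetries of the representations: the factor \<open>24 = 3 * 4 * 2\<close>\<close>

lemma square_mod_8: "(x::int)\<^sup>2 mod 8 = (if odd x then 1 else if x mod 4 = 0 then 0 else 4)"
proof -
  have "x mod 8 \<in> {0..<8}" by simp
  then have "x mod 8 = 0 \<or> x mod 8 = 1 \<or> x mod 8 = 2 \<or> x mod 8 = 3 \<or> x mod 8 = 4 \<or> x mod 8 = 5 \<or> x mod 8 = 6 \<or> x mod 8 = 7"
    by (simp; presburger)
  moreover have "x\<^sup>2 mod 8 = (x mod 8)\<^sup>2 mod 8" by (simp add: power_mod)
  moreover have "x mod 4 = x mod 8 mod 4" by (simp add: mod_mod_cancel)
  moreover have "odd x = odd (x mod 8)" by presburger
  ultimately show ?thesis by (elim disjE) simp_all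
qed

context
  fixes m :: nat
  assumes m: "m mod 8 = 5"
begin

definition vecs :: "(int \<times> int \<times> int) set" where
  "vecs = {(a, b, c). a\<^sup>2 + b\<^sup>2 + c\<^sup>2 = int m}"

lemma finite_vecs: "finite vecs"
  unfolding vecs_def by (rule finite_three_squares)

text \<open>Squares are 0, 1 or 4 modulo 8, and \<open>0 + 1 + 4\<close> is the only way to obtain
  5. One entry is odd, one is divisible by 4 and one is 2 modulo 4.\<close>

lemma vecs_cases:
  assumes "(a, b, c) \<in> vecs"
  shows "odd a \<and> even b \<and> even c \<and> (b + c) mod 4 = 2 \<and> (b - c) mod 4 = 2 \<or>
    even a \<and> odd b \<and> even c \<and> (a + c) mod 4 = 2 \<and> (a - c) mod 4 = 2 \<or>
    even a \<and> even b \<and> odd c \<and> (a + b) mod 4 = 2 \<and> (a - b) mod 4 = 2"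
proof -
  have "(a\<^sup>2 mod 8 + b\<^sup>2 mod 8 + c\<^sup>2 mod 8) mod 8 = (a\<^sup>2 + b\<^sup>2 + c\<^sup>2) mod 8"
    by (intro mod_add_cong mod_mod_trivial)
  also have "\<dots> = int m mod 8" using assms by (simp add: vecs_def)
  also have "int m mod 8 = 5" using m by presburger
  finally have "(a\<^sup>2 mod 8 + b\<^sup>2 mod 8 + c\<^sup>2 mod 8) mod 8 = 5" .
  then show ?thesis unfolding square_mod_8 by (auto split: if_splits; presburger)
qed

definition vecs_b :: "(int \<times> int \<times> int) set" where
  "vecs_b = {(a, b, c) \<in> vecs. odd b}"

definition vecs_neg :: "(int \<times> int \<times> int) set" where
  "vecs_neg = {(a, b, c) \<in> vecs_b. b + c < 0 \<and> a + c < 0 \<and> a + b < 0}"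

lemma vecs_b_iff: "(a, b, c) \<in> vecs_b \<longleftrightarrow> (a, b, c) \<in> vecs \<and> odd b \<and> even a \<and> even c \<and> (a + c) mod 4 = 2 \<and> (a - c) mod 4 = 2"
  using vecs_cases[of a b c] by (auto simp: vecs_b_def)

lemma card_vecs: "card vecs = 3 * card vecs_b"
proof -
  let ?A = "{(a, b, c) \<in> vecs. odd a}" and ?C = "{(a, b, c) \<in> vecs. odd c}"
  have v: "vecs = ?A \<union> vecs_b \<union> ?C" using vecs_cases by (fastforce simp: vecs_b_def)
  have fin: "finite ?A" "finite ?C" "finite vecs_b"
    by (rule finite_subset[OF _ finite_vecs]; auto simp: vecs_b_def)+
  have dis: "?A \<inter> vecs_b = {}" "(?A \<union> vecs_b) \<inter> ?C = {}"
    using vecs_cases by (auto simp: vecs_b_def; blast)+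
  have "card vecs = card ?A + card vecs_b + card ?C"
    by (subst v, subst card_Un_disjoint[OF _ fin(2) dis(2)], use fin in simp, subst card_Un_disjoint[OF fin(1,3) dis(1)]) simp
  moreover have "card ?A = card vecs_b"
    by (rule bij_betw_same_card[of "\<lambda>(a, b, c). (b, a, c)"], rule bij_betw_byWitness[where f' = "\<lambda>(a, b, c). (b, a, c)"])
      (auto simp: vecs_b_def vecs_def algebra_simps)
  moreover have "card ?C = card vecs_b"
    by (rule bij_betw_same_card[of "\<lambda>(a, b, c). (a, c, b)"], rule bij_betw_byWitness[where f' = "\<lambda>(a, b, c). (a, c, b)"])
      (auto simp: vecs_b_def vecs_def algebra_simps)
  ultimately show ?thesis by simp
qed

text \<open>In terms of the four numbers \<open>a + b + c\<close>, \<open>a - b - c\<close>, \<open>b - a - c\<close>, \<open>c - a - b\<close>, which are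
  pairwise distinct, the set \<^term>\<open>vecs_neg\<close> says that the first one is the least; an even number of
  sign changes permutes them.\<close>

lemma card_vecs_b: "card vecs_b = 4 * card vecs_neg"
proof -
  let ?B = "{(a, b, c) \<in> vecs_b. b + c > 0 \<and> a < b \<and> a < c}"
  let ?C = "{(a, b, c) \<in> vecs_b. a + c > 0 \<and> b < a \<and> b < c}"
  let ?D = "{(a, b, c) \<in> vecs_b. a + b > 0 \<and> c < a \<and> c < b}"
  \<comment> \<open>Parity separates \<open>b\<close> from the even entries \<open>a\<close> and
    \<open>c\<close>, while \<open>a + c\<close> and \<open>a - c\<close> are 2 modulo 4 and hence
    nonzero.\<close>
  have ne: "b + c \<noteq> 0" "a + c \<noteq> 0" "a + b \<noteq> 0" "a \<noteq> b" "a \<noteq> c" "b \<noteq> c" if "(a, b, c) \<in> vecs_b" for a b c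
    using that unfolding vecs_b_iff by (auto; presburger)+
  have v: "vecs_b = vecs_neg \<union> (?B \<union> (?C \<union> ?D))"
  proof (intro equalityI subsetI)
    fix x assume x: "x \<in> vecs_b"
    obtain a b c where abc: "x = (a, b, c)" by (cases x) auto
    have "b + c < 0 \<and> a + c < 0 \<and> a + b < 0 \<or> b + c > 0 \<and> a < b \<and> a < c \<or>
      a + c > 0 \<and> b < a \<and> b < c \<or> a + b > 0 \<and> c < a \<and> c < b"
      using ne[OF x[unfolded abc]] by linarith
    then show "x \<in> vecs_neg \<union> (?B \<union> (?C \<union> ?D))" using x abc by (auto simp: vecs_neg_def)
  qed (auto simp: vecs_neg_def)
  have finb: "finite vecs_b" by (rule finite_subset[OF _ finite_vecs]) (auto simp: vecs_b_def)
  have fin: "finite vecs_neg" "finite ?B" "finite ?C" "finite ?D"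
    by (rule finite_subset[OF _ finb]; auto simp: vecs_neg_def)+
  have dis: "vecs_neg \<inter> (?B \<union> (?C \<union> ?D)) = {}" "?B \<inter> (?C \<union> ?D) = {}" "?C \<inter> ?D = {}"
    by (auto simp: vecs_neg_def)
  have "card vecs_b = card vecs_neg + (card ?B + (card ?C + card ?D))"
    by (subst v) (simp only: card_Un_disjoint[OF fin(1) _ dis(1)] card_Un_disjoint[OF fin(2) _ dis(2)]
      card_Un_disjoint[OF fin(3,4) dis(3)] finite_UnI fin)
  moreover have "card ?B = card vecs_neg"
    by (rule bij_betw_same_card[of "\<lambda>(a, b, c). (a, - b, - c)"], rule bij_betw_byWitness[where f' = "\<lambda>(a, b, c). (a, - b, - c)"])
      (auto simp: vecs_neg_def vecs_b_def vecs_def)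
  moreover have "card ?C = card vecs_neg"
    by (rule bij_betw_same_card[of "\<lambda>(a, b, c). (- a, b, - c)"], rule bij_betw_byWitness[where f' = "\<lambda>(a, b, c). (- a, b, - c)"])
      (auto simp: vecs_neg_def vecs_b_def vecs_def)
  moreover have "card ?D = card vecs_neg"
    by (rule bij_betw_same_card[of "\<lambda>(a, b, c). (- a, - b, c)"], rule bij_betw_byWitness[where f' = "\<lambda>(a, b, c). (- a, - b, c)"])
      (auto simp: vecs_neg_def vecs_b_def vecs_def)
  ultimately show ?thesis by simp
qed

lemma ex_nat_iff: "(\<exists>k. x = - 4 * int k - r) \<longleftrightarrow> x \<le> - r \<and> (x + r) mod 4 = 0"
proof
  assume *: "x \<le> - r \<and> (x + r) mod 4 = 0"
  then have "x = - 4 * int (nat ((- r - x) div 4)) - r" by (simp; presburger)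
  then show "\<exists>k. x = - 4 * int k - r" ..
qed auto

text \<open>In \<open>vecs_neg\<close> always \<open>a + c\<close> is 2 modulo 4, and
  \<open>a + b = (b + c) + (a - c)\<close> is fixed modulo 4 by \<open>b + c\<close>. With these
  congruences, negativity sharpens to the bounds \<open>- 1\<close>, \<open>- 2\<close>,
  \<open>- 3\<close>.\<close>

lemma core_vectors_iff: "(a, b, c) \<in> core_vectors m \<longleftrightarrow> (a, b, c) \<in> vecs_neg \<and> (b + c) mod 4 = 3"
proof
  assume "(a, b, c) \<in> core_vectors m"
  then have v: "(a, b, c) \<in> vecs" and e: "b + c \<le> - 1 \<and> (b + c + 1) mod 4 = 0" "a + c \<le> - 2 \<and> (a + c + 2) mod 4 = 0"
      "a + b \<le> - 3 \<and> (a + b + 3) mod 4 = 0"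
    unfolding core_vectors_def vecs_def ex_nat_iff mem_Collect_eq prod.case by blast+
  have "odd (b + c)" "even (a + c)" "odd (a + b)" using e by presburger+
  then have "odd b" using vecs_cases[OF v] by auto
  moreover have "(b + c) mod 4 = 3" using e(1) by presburger
  ultimately show "(a, b, c) \<in> vecs_neg \<and> (b + c) mod 4 = 3" using v e by (auto simp: vecs_neg_def vecs_b_def)
next
  assume *: "(a, b, c) \<in> vecs_neg \<and> (b + c) mod 4 = 3"
  then have b: "(a, b, c) \<in> vecs_b" and neg: "b + c < 0" "a + c < 0" "a + b < 0" by (auto simp: vecs_neg_def)
  then have v: "(a, b, c) \<in> vecs" and mods: "(a + c) mod 4 = 2" "(a - c) mod 4 = 2" unfolding vecs_b_iff by auto
  have bc: "(b + c) mod 4 = 3" using * by simp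
  have "(b + c + 1) mod 4 = 0" using bc by presburger
  moreover have "(a + c + 2) mod 4 = 0" using mods(1) by presburger
  moreover have "(a + b + 3) mod 4 = 0" using mods(2) bc by presburger
  moreover have "b + c \<le> - 1" using neg by simp
  moreover have "a + c \<le> - 2" using neg mods by presburger
  moreover have "a + b \<le> - 3" using neg \<open>(a + b + 3) mod 4 = 0\<close> by presburger
  ultimately show "(a, b, c) \<in> core_vectors m"
    using v unfolding core_vectors_def vecs_def ex_nat_iff mem_Collect_eq prod.case by blast
qed

text \<open>Exchanging \<open>a\<close> and \<open>c\<close> preserves \<open>vecs_neg\<close>.
  Since \<open>b + c\<close> is odd and \<open>a - c\<close> is 2 modulo 4, exactly one of
  \<open>b + c\<close> and \<open>a + b\<close> is 3 modulo 4, so the exchange matches the two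
  halves.\<close>

lemma card_vecs_neg: "card vecs_neg = 2 * card (core_vectors m)"
proof -
  let ?D = "{(a, b, c) \<in> vecs_neg. (b + c) mod 4 = 3}" and ?D' = "{(a, b, c) \<in> vecs_neg. (a + b) mod 4 = 3}"
  have D: "core_vectors m = ?D"
  proof (intro equalityI subsetI)
    fix x show "x \<in> core_vectors m \<Longrightarrow> x \<in> ?D" and "x \<in> ?D \<Longrightarrow> x \<in> core_vectors m"
      using core_vectors_iff by (cases x; auto)+
  qed
  have ex: "((b + c) mod 4 = 3) \<noteq> ((a + b) mod 4 = 3)" if "(a, b, c) \<in> vecs_neg" for a b c
  proof -
    have "odd b" "even c" "(a - c) mod 4 = 2" using that vecs_b_iff[of a b c] by (auto simp: vecs_neg_def)
    then show ?thesis by presburger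
  qed
  have v: "vecs_neg = ?D \<union> ?D'" using ex by auto
  have dis: "?D \<inter> ?D' = {}" using ex by auto
  have fin: "finite ?D" "finite ?D'"
    by (rule finite_subset[OF _ finite_vecs]; auto simp: vecs_neg_def vecs_b_def)+
  have "card vecs_neg = card ?D + card ?D'" by (subst v) (rule card_Un_disjoint[OF fin dis])
  moreover have "card ?D' = card ?D"
    by (rule bij_betw_same_card[of "\<lambda>(a, b, c). (c, b, a)"], rule bij_betw_byWitness[where f' = "\<lambda>(a, b, c). (c, b, a)"])
      (auto simp: vecs_neg_def vecs_b_def vecs_def algebra_simps)
  ultimately show ?thesis unfolding D by simp
qed

lemma r3_eq_24: "r3 m = 24 * card (core_vectors m)"
  using card_vecs card_vecs_b card_vecs_neg by (simp add: r3_def vecs_def)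

end

lemma r3_eq_C4: "r3 (8 * n + 5) = 24 * C4 n"
  using r3_eq_24[of "8 * n + 5"] by (simp add: C4_eq_card_core_triples card_core_triples)

text \<open>Three odd entries would give 3 modulo 4 and two even ones an even number, so exactly one
  entry is even. The sign is 1 if this is \<open>z\<close> and \<open>n * e\<close> otherwise, and
  permuting entries makes the three cases equinumerous. Divisor pairs are odd, with weights one half
  and \<open>n * e\<close>, hence in the same ratio \<open>1 : 2 * (n * e)\<close>.\<close>

lemma cX_symmetric:
  assumes m: "m mod 4 = 1" and e: "e = 1 \<or> e = -1" and n: "n = 1 \<or> n = (-1::real)"
  shows "cX e n m = (real (card {(x, y, z) \<in> Tri m. even z}) + real (card (Div m)) / 2) * (1 + 2 * (n * e))"
proof -
  let ?X = "{(x, y, z) \<in> Tri m. even x}" and ?Y = "{(x, y, z) \<in> Tri m. even y}" and ?Z = "{(x, y, z) \<in> Tri m. even z}"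
  let ?f = "\<lambda>(x, y, z). n ^ (x + y) * e ^ z"
  have ex: "even x \<and> odd y \<and> odd z \<or> odd x \<and> even y \<and> odd z \<or> odd x \<and> odd y \<and> even z"
    if "(x, y, z) \<in> Tri m" for x y z
  proof -
    have s: "x * y + y * z + z * x = m" using that by (simp add: Tri_def)
    have "odd m" using m by presburger
    then have o: "odd (x * y + y * z + z * x)" using s by simp
    have "\<not> (odd x \<and> odd y \<and> odd z)"
    proof
      assume "odd x \<and> odd y \<and> odd z"
      then obtain i j k where "x = 2 * i + 1" "y = 2 * j + 1" "z = 2 * k + 1" by (metis oddE)
      then have "m = 4 * (i * j + j * k + k * i + i + j + k) + 3" using s by (simp add: algebra_simps)
      then show False using m by presburger
    qed
    with o show ?thesis by auto
  qed
  have T: "Tri m = ?X \<union> (?Y \<union> ?Z)" and dis: "?X \<inter> (?Y \<union> ?Z) = {}" "?Y \<inter> ?Z = {}"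
    using ex by blast+
  have fin: "finite ?X" "finite ?Y" "finite ?Z" by (rule finite_subset[OF _ finite_Tri[of m]]; auto)+
  have cX': "card ?X = card ?Z"
    by (rule bij_betw_same_card[of "\<lambda>(x, y, z). (z, y, x)"], rule bij_betw_byWitness[where f' = "\<lambda>(x, y, z). (z, y, x)"])
      (auto simp: Tri_def algebra_simps)
  have cY: "card ?Y = card ?Z"
    by (rule bij_betw_same_card[of "\<lambda>(x, y, z). (x, z, y)"], rule bij_betw_byWitness[where f' = "\<lambda>(x, y, z). (x, z, y)"])
      (auto simp: Tri_def algebra_simps)
  have "sum ?f (Tri m) = sum ?f ?X + (sum ?f ?Y + sum ?f ?Z)"
    by (subst T) (simp only: sum.union_disjoint[OF fin(1) _ dis(1)] sum.union_disjoint[OF fin(2,3) dis(2)] finite_UnI fin)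
  also have "sum ?f ?X = (\<Sum>v\<in>?X. n * e)"
    by (rule sum.cong[OF refl]) (use ex e n in \<open>fastforce simp: minus_one_power_iff\<close>)
  also have "sum ?f ?Y = (\<Sum>v\<in>?Y. n * e)"
    by (rule sum.cong[OF refl]) (use ex e n in \<open>fastforce simp: minus_one_power_iff\<close>)
  also have "sum ?f ?Z = (\<Sum>v\<in>?Z. 1)"
    by (rule sum.cong[OF refl]) (use ex e n in \<open>fastforce simp: minus_one_power_iff\<close>)
  finally have 1: "sum ?f (Tri m) = real (card ?Z) * (1 + 2 * (n * e))"
    by (simp only: sum_constant cX' cY) (simp add: algebra_simps)
  have odds: "odd x \<and> odd y" if "(x, y) \<in> Div m" for x y
  proof -
    have "x * y = m" using that by (simp add: Div_def)
    moreover have "odd m" using m by presburger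
    ultimately have "odd (x * y)" by simp
    then show ?thesis by simp
  qed
  have 2: "(\<Sum>(x, y)\<in>Div m. n ^ (x + y)) = (\<Sum>v\<in>Div m. 1)"
    by (rule sum.cong[OF refl]) (use odds n in \<open>auto simp: minus_one_power_iff\<close>)
  have 3: "(\<Sum>(x, y)\<in>Div m. n ^ x * e ^ y) = (\<Sum>v\<in>Div m. n * e)"
    by (rule sum.cong[OF refl]) (use odds n e in \<open>auto simp: minus_one_power_iff\<close>)
  show ?thesis unfolding cX_def 1 2 3 by (simp add: algebra_simps)
qed

theorem corollary1p5:
  fixes n :: nat
  assumes "squarefree (8 * n + 5)"
  shows "8 * int (C4 n) = int (p_even (8 * n + 5)) - int (p_odd (8 * n + 5))
    \<and> int (p_even (8 * n + 5)) - int (p_odd (8 * n + 5))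
        = int (M2_even (8 * n + 5)) - int (M2_odd (8 * n + 5))"
proof -
  let ?m = "8 * n + 5"
  have m: "?m mod 4 = 1" "odd ?m" "?m \<noteq> 0" by presburger+
  have "- real (r3 ?m) = - 4 * cX (-1) (-1) ?m" using r3_eq[of ?m] m by simp
  moreover have "real (p_even ?m) - real (p_odd ?m) = - 4 * cX (-1) 1 ?m" using rank_parity_eq[of ?m] m by simp
  moreover have "real (M2_even ?m) - real (M2_odd ?m) = - 4 * cX 1 (-1) ?m" using M2_rank_parity_eq[of ?m] m by simp
  \<comment> \<open>The factor \<open>1 + 2 * (n * e)\<close> is 3 for equal signs and
    \<open>-1\<close> for opposite ones; dividing 24 by this 3 leaves the 8 of the theorem.\<close>
  moreover have "cX (-1) (-1) ?m = - 3 * cX (-1) 1 ?m" "cX 1 (-1) ?m = cX (-1) 1 ?m"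
    by (simp_all add: cX_symmetric[OF m(1)])
  moreover have "real (r3 ?m) = 24 * real (C4 n)" by (simp add: r3_eq_C4)
  ultimately have "real_of_int (8 * int (C4 n)) = real_of_int (int (p_even ?m) - int (p_odd ?m))"
    "real_of_int (int (p_even ?m) - int (p_odd ?m)) = real_of_int (int (M2_even ?m) - int (M2_odd ?m))"
    by simp_all
  then show ?thesis unfolding of_int_eq_iff by blast
qed

end
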